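(* Let $\varepsilon:\mathbb{N}\to(0,\infty)$ be any function with $\varepsilon(m)\to0$ as $m\to\infty$ (arbitrarily slowly). Then for almost all positive integers $m$, every set $A\subset\mathbb{Z}_m$ with $(A-A)\cap R_m=\{0\}$ satisfies $$|A|\leq m^{1/2-\varepsilon(m)}.$$
   Context: $\mathbb{Z}_m$ is the ring of integers modulo $m$; $R_m=\{a^2 : a\in\mathbb{Z}_m\}$ is the set of all squares in $\mathbb{Z}_m$ (including $0$ and squares that are not units); $A-A=\{a-b : a,b\in A\}$. "For almost all $m$" means for all $m$ in a set of density $1$, where the density of $M\subseteq\mathbb{N}$ is the lower asymptotic density $\liminf_{N\to\infty}\frac{\#(M\cap\{1,\dots,N\})}{N}$. *)

theory Defs
  imports Complex_Main "HOL-Library.Extended_Real" "HOL-Library.Liminf_Limsup"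
    "HOL-Number_Theory.Residues"
begin

(* All squares of R, including zero and non-units; QuadRes from the library is the
   corresponding predicate on integers. *)
definition square_set :: "('a, 'b) ring_scheme \<Rightarrow> 'a set"
  where "square_set R = {a [^]\<^bsub>R\<^esub> (2::nat) | a. a \<in> carrier R}"

definition difference_set :: "('a, 'b) ring_scheme \<Rightarrow> 'a set \<Rightarrow> 'a set"
  where "difference_set R A = {a \<ominus>\<^bsub>R\<^esub> b | a b. a \<in> A \<and> b \<in> A}"

(* The limit inferior is taken in the extended reals, so that it always exists; the
   value 0/0 = 0 at N = 0 does not affect it. *)
definition lower_density :: "nat set \<Rightarrow> ereal"
  where "lower_density M = liminf (\<lambda>N. ereal (real (card (M \<inter> {1..N})) / real N))"

definition almost_all :: "(nat \<Rightarrow> bool) \<Rightarrow> bool"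
  where "almost_all P \<longleftrightarrow> (\<exists>M \<subseteq> {1..}. lower_density M = 1 \<and> (\<forall>m\<in>M. P m))"

end

theory Submission
  imports Defs "HOL-Number_Theory.Number_Theory" "HOL-Number_Theory.Prime_Powers"
begin

text \<open>
  If \<open>F\<close> is a nonnegative combination of characters with constant coefficient at least \<open>1\<close> and \<open>F\<close>
  vanishes at all nonzero differences of \<open>A\<close>, then summing \<open>F (a - b)\<close> over \<open>A \<times> A\<close> gives
  \<open>|A| \<le> F 0\<close>. For a squarefree odd modulus such an \<open>F\<close> is built from Legendre symbols: a
  prime \<open>p \<equiv> 1 (mod 4)\<close> contributes a factor \<open>\<surd>p\<close> to \<open>F 0\<close>. If \<open>K\<close> is the set of the prime factors
  \<open>\<equiv> 3 (mod 4)\<close>, then a difference and its negative are both nonsquares only if the signs on \<open>K\<close> are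
  mixed, so products of Legendre symbols over subsets of \<open>K\<close> of even size suffice; when \<open>|K|\<close> is odd
  such a subset misses a prime of \<open>K\<close>, and \<open>\<surd>(min K)\<close> is saved.

  A general modulus \<open>m\<close> is reduced to this case by discarding a unitary divisor \<open>D\<close> (restrict \<open>A\<close> to a
  class modulo \<open>D\<close>), which costs \<open>\<surd>D\<close>. One discards \<open>2\<close>, the primes whose square divides \<open>m\<close>, and the
  primes \<open>\<equiv> 3 (mod 4)\<close> below a prime \<open>p\<close>, with or without \<open>p\<close> itself depending on the parity. This
  wins a power of \<open>p\<close> if the product of the prime factors \<open>q \<equiv> 3 (mod 4)\<close>, \<open>q < p\<close>, of \<open>m\<close> is at most
  \<open>p\<close> to the \<open>24/25\<close> and \<open>m\<close> has no such prime factor in \<open>(p, p\<^sup>2]\<close>. By Mertens' theorem modulo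
  \<open>4\<close> the expected defect of these two conditions at a given \<open>p\<close> is at most
  \<open>25/24 \<cdot> 1/2 + 1/4 + 1/6 < 1\<close>, and a second moment argument shows that almost all \<open>m\<close> have such a \<open>p\<close>
  that is at least a small power of \<open>m\<close>.
\<close>

section \<open>Positive definite functions on the integers\<close>

text \<open>Even size is needed twice. A product of Legendre symbols over an even number of primes
  congruent to 3 modulo 4 is an even function, so its Fourier transform is real and a multiple
  \<open>sqrt (\<Prod>S)\<close> of the indicator of 0 modulo S dominates its negative part. And if
  |K| were even, S = K itself would occur and save nothing. The parity therefore has to be repaired
  by discarding \<open>p\<close>, which costs one more factor \<open>p\<close> under the root and is
  affordable because the next prime of K then exceeds p^2: this is the origin of the gap condition.
  As the primes of K are at least a fixed power of \<open>m\<close>, |K| is bounded and the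
  combinatorial factor 2^(|K|^2) is harmless.

  No fixed \<open>p\<close> works for almost all \<open>m\<close>. But the defect at
  \<open>p\<close> has mean below 1 uniformly in \<open>p\<close>, while the number of candidates
  \<open>p\<close> dividing \<open>m\<close> has unbounded mean; if all of them failed, the total
  defect would be at least their number, against concentration. The exponent 24/25 enters through
  its inverse: with 5/12 for the gap, any exponent strictly between 6/7 and 1 leaves both a mean
  below 1 and a power of \<open>p\<close> to win.\<close>

text \<open>
  The condition \<open>pos_def (\<lambda>x. F x - 1)\<close> used below says that the constant coefficient of \<open>F\<close> is at
  least \<open>1\<close> and all others are nonnegative.
\<close>

inductive pos_def :: "(int \<Rightarrow> complex) \<Rightarrow> bool" where
  zero: "pos_def (\<lambda>x. 0)"
| add_char: "pos_def F \<Longrightarrow> 0 \<le> c \<Longrightarrow> pos_def (\<lambda>x. F x + of_real c * cis (t * of_int x))"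

lemma pos_def_char: "0 \<le> c \<Longrightarrow> pos_def (\<lambda>x. of_real c * cis (t * of_int x))"
  using pos_def.add_char[OF pos_def.zero, of c t] by simp

lemma pos_def_const: "0 \<le> c \<Longrightarrow> pos_def (\<lambda>x. of_real c)"
  using pos_def_char[of c 0] by simp

lemma pos_def_add:
  assumes "pos_def F" "pos_def G"
  shows "pos_def (\<lambda>x. F x + G x)"
  using assms(2)
proof induction
  case zero
  show ?case using assms(1) by simp
next
  case (add_char G c t)
  have "pos_def (\<lambda>x. (F x + G x) + of_real c * cis (t * of_int x))"
    using add_char by (intro pos_def.add_char)
  thus ?case by (simp add: add.assoc)
qed

lemma pos_def_mult_char:
  assumes "pos_def F" "0 \<le> d"
  shows "pos_def (\<lambda>x. F x * (of_real d * cis (s * of_int x)))"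
  using assms(1)
proof induction
  case zero
  show ?case using pos_def.zero by simp
next
  case (add_char G c t)
  have "pos_def (\<lambda>x. G x * (of_real d * cis (s * of_int x)) + of_real (c * d) * cis ((t + s) * of_int x))"
    using add_char assms(2) by (intro pos_def.add_char) auto
  also have "(\<lambda>x. G x * (of_real d * cis (s * of_int x)) + of_real (c * d) * cis ((t + s) * of_int x)) =
      (\<lambda>x. (G x + of_real c * cis (t * of_int x)) * (of_real d * cis (s * of_int x)))"
    by (rule ext) (simp add: algebra_simps flip: cis_mult)
  finally show ?case .
qed

lemma pos_def_mult:
  assumes "pos_def F" "pos_def G"
  shows "pos_def (\<lambda>x. F x * G x)"
  using assms(2)
proof induction
  case zero
  show ?case using pos_def.zero by simp
next
  case (add_char G c t)
  have "pos_def (\<lambda>x. F x * G x + F x * (of_real c * cis (t * of_int x)))"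
    using add_char assms(1) by (intro pos_def_add pos_def_mult_char)
  thus ?case by (simp add: algebra_simps)
qed

lemma pos_def_scale: "pos_def F \<Longrightarrow> 0 \<le> c \<Longrightarrow> pos_def (\<lambda>x. of_real c * F x)"
  using pos_def_mult[OF pos_def_const] by blast

lemma pos_def_sum: "(\<And>i. i \<in> I \<Longrightarrow> pos_def (F i)) \<Longrightarrow> pos_def (\<lambda>x. \<Sum>i\<in>I. F i x)"
  by (induction I rule: infinite_finite_induct) (auto intro: pos_def.zero pos_def_add)

lemma pos_def_prod: "(\<And>i. i \<in> I \<Longrightarrow> pos_def (F i)) \<Longrightarrow> pos_def (\<lambda>x. \<Prod>i\<in>I. F i x)"
  using pos_def_const[of 1]
  by (induction I rule: infinite_finite_induct) (auto intro: pos_def_mult)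

text \<open>A single character contributes \<open>c\<close> times the squared modulus of its sum
  over \<open>A\<close>.\<close>

lemma pos_def_double_sum_nonneg:
  assumes "pos_def F"
  shows "0 \<le> Re (\<Sum>a\<in>A. \<Sum>b\<in>A. F (a - b))"
  using assms
proof induction
  case (add_char G c t)
  let ?S = "\<Sum>a\<in>A. cis (t * of_int a)"
  have "(\<Sum>a\<in>A. \<Sum>b\<in>A. of_real c * cis (t * of_int (a - b))) =
      of_real c * (\<Sum>a\<in>A. \<Sum>b\<in>A. cis (t * of_int a) * cnj (cis (t * of_int b)))"
    by (simp add: sum_distrib_left cis_cnj cis_mult algebra_simps)
  also have "\<dots> = of_real c * (?S * cnj ?S)"
    by (simp add: sum_product)
  also have "\<dots> = of_real (c * (cmod ?S)\<^sup>2)"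
    by (simp only: of_real_mult complex_norm_square)
  finally have "(\<Sum>a\<in>A. \<Sum>b\<in>A. G (a - b) + of_real c * cis (t * of_int (a - b))) =
     (\<Sum>a\<in>A. \<Sum>b\<in>A. G (a - b)) + of_real (c * (cmod ?S)\<^sup>2)"
    by (simp add: sum.distrib)
  with add_char show ?case by simp
qed simp

section \<open>Additive characters modulo \<open>n\<close> and Fourier inversion\<close>

definition nth_char :: "int \<Rightarrow> int \<Rightarrow> complex" where
  "nth_char n z = cis (2 * pi * of_int z / of_int n)"

lemma nth_char_add: "nth_char n (x + y) = nth_char n x * nth_char n y"
  by (simp add: nth_char_def cis_mult add_divide_distrib distrib_left)

lemma nth_char_cnj: "cnj (nth_char n x) = nth_char n (- x)"
  by (simp add: nth_char_def cis_cnj)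

lemma nth_char_eq_1_iff:
  assumes "n > 0"
  shows "nth_char n x = 1 \<longleftrightarrow> n dvd x"
proof
  assume "n dvd x"
  then obtain k where k: "x = n * k" by auto
  hence "2 * pi * of_int x / of_int n = 2 * pi * of_int k" using assms by simp
  thus "nth_char n x = 1" using cis_multiple_2pi[of "of_int k"] unfolding nth_char_def by simp
next
  assume "nth_char n x = 1"
  hence "cos (2 * pi * of_int x / of_int n) = 1" by (simp add: nth_char_def complex_eq_iff)
  then obtain k :: int where "2 * pi * of_int x / of_int n = of_int k * 2 * pi"
    using cos_one_2pi_int by blast
  hence "of_int x = of_int k * (of_int n :: real)" using assms by (simp add: field_simps)
  hence "x = k * n" using of_int_eq_iff[of x "k * n", where ?'a = real] by simp
  thus "n dvd x" by simp
qed

lemma nth_char_mod: "n > 0 \<Longrightarrow> nth_char n (x mod n) = nth_char n x"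
  using nth_char_add[of n "x mod n" "x - x mod n"] nth_char_eq_1_iff[of n "x - x mod n"]
  by (simp add: dvd_minus_mod)

lemma nth_char_sum:
  assumes "n > 0"
  shows "(\<Sum>u\<in>{0..<n}. nth_char n (u * x)) = (if n dvd x then of_int n else 0)"
proof -
  let ?w = "nth_char n x"
  have pow: "nth_char n (int u * x) = ?w ^ u" for u
  proof (induction u)
    case (Suc u)
    have "int (Suc u) * x = x + int u * x" by (simp add: algebra_simps)
    thus ?case using Suc by (simp only: nth_char_add power_Suc)
  qed (simp add: nth_char_def)
  have "(\<Sum>u\<in>{0..<n}. nth_char n (u * x)) = (\<Sum>u\<in>int ` {..<nat n}. nth_char n (u * x))"
  proof (rule sum.cong)
    show "{0..<n} = int ` {..<nat n}"
      using assms image_int_atLeastLessThan[of 0 "nat n"] by (simp add: lessThan_atLeast0)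
  qed simp
  also have "\<dots> = (\<Sum>u<nat n. ?w ^ u)"
    by (subst sum.reindex) (auto simp: pow)
  also have "\<dots> = (if n dvd x then of_int n else 0)"
  proof (cases "n dvd x")
    case True
    thus ?thesis using nth_char_eq_1_iff[OF assms, of x] assms by simp
  next
    case False
    have "?w ^ nat n = nth_char n (n * x)" using pow[of "nat n"] assms by simp
    also have "\<dots> = 1" using nth_char_eq_1_iff[OF assms] by simp
    finally show ?thesis using False nth_char_eq_1_iff[OF assms, of x] by (simp add: sum_gp_strict)
  qed
  finally show ?thesis .
qed

text \<open>Fourier inversion modulo \<open>n\<close>: the weights \<open>r u / n\<close> at the
  frequencies \<open>2 * pi * u / n\<close> rebuild \<open>f\<close>. Concrete functions enter the
  inductive \<open>pos_def\<close> through this criterion.\<close>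

lemma pos_def_of_fourier_nonneg:
  assumes n: "n > 0" and per: "\<And>x. f (x mod n) = f x"
    and pos: "\<And>u. \<exists>r\<ge>0. (\<Sum>y\<in>{0..<n}. f y * nth_char n (- (u * y))) = of_real r"
  shows "pos_def f"
proof -
  obtain r where r: "\<And>u. r u \<ge> 0" "\<And>u. (\<Sum>y\<in>{0..<n}. f y * nth_char n (- (u * y))) = of_real (r u)"
    using pos by metis
  have "f x = (\<Sum>u\<in>{0..<n}. of_real (r u / of_int n) * cis (2 * pi * of_int u / of_int n * of_int x))" for x
  proof -
    have "(\<Sum>u\<in>{0..<n}. of_real (r u / of_int n) * cis (2 * pi * of_int u / of_int n * of_int x)) =
        (\<Sum>u\<in>{0..<n}. of_real (r u) * nth_char n (u * x)) / of_int n"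
      by (simp add: nth_char_def sum_divide_distrib mult_ac)
    also have "(\<Sum>u\<in>{0..<n}. of_real (r u) * nth_char n (u * x)) =
        (\<Sum>u\<in>{0..<n}. \<Sum>y\<in>{0..<n}. f y * nth_char n (u * (x - y)))"
    proof (intro sum.cong refl)
      fix u
      have "of_real (r u) * nth_char n (u * x) =
          (\<Sum>y\<in>{0..<n}. f y * (nth_char n (- (u * y)) * nth_char n (u * x)))"
        by (simp only: r(2)[symmetric] sum_distrib_right mult.assoc)
      thus "of_real (r u) * nth_char n (u * x) = (\<Sum>y\<in>{0..<n}. f y * nth_char n (u * (x - y)))"
        by (simp add: algebra_simps flip: nth_char_add)
    qed
    also have "\<dots> = (\<Sum>y\<in>{0..<n}. f y * (\<Sum>u\<in>{0..<n}. nth_char n (u * (x - y))))"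
      by (subst sum.swap) (simp add: sum_distrib_left)
    also have "\<dots> = (\<Sum>y\<in>{0..<n}. if y = x mod n then f y * of_int n else 0)"
    proof (rule sum.cong)
      fix y assume y: "y \<in> {0..<n}"
      have "n dvd x - y \<longleftrightarrow> x mod n = y mod n" by (simp add: mod_eq_dvd_iff)
      also have "\<dots> \<longleftrightarrow> y = x mod n" using y by auto
      finally show "f y * (\<Sum>u\<in>{0..<n}. nth_char n (u * (x - y))) = (if y = x mod n then f y * of_int n else 0)"
        using nth_char_sum[OF n, of "x - y"] by simp
    qed simp
    also have "\<dots> = f x * of_int n"
      using n per[of x] by (subst sum.delta) auto
    finally show ?thesis using n by simp
  qed
  moreover have "pos_def (\<lambda>x. \<Sum>u\<in>{0..<n}. of_real (r u / of_int n) * cis (2 * pi * of_int u / of_int n * of_int x))"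
    using r(1) n by (intro pos_def_sum pos_def_char) auto
  ultimately show ?thesis by presburger
qed

lemma sum_residues_affine:
  fixes f :: "int \<Rightarrow> 'a :: comm_monoid_add"
  assumes n: "n > 0" and per: "\<And>x. f (x mod n) = f x" and c: "coprime a n"
  shows "(\<Sum>y\<in>{0..<n}. f (a * y)) = (\<Sum>y\<in>{0..<n}. f y)"
proof -
  have inj: "inj_on (\<lambda>y. (a * y) mod n) {0..<n}"
  proof (rule inj_onI)
    fix x y assume xy: "x \<in> {0..<n}" "y \<in> {0..<n}" "(a * x) mod n = (a * y) mod n"
    hence "[x = y] (mod n)" using c cong_mult_lcancel[of a n x y] by (simp add: cong_def)
    thus "x = y" using xy by (simp add: cong_def)
  qed
  have "(\<lambda>y. (a * y) mod n) ` {0..<n} = {0..<n}"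
    by (rule endo_inj_surj) (use n inj in auto)
  hence "(\<Sum>y\<in>{0..<n}. f y) = (\<Sum>y\<in>{0..<n}. f ((a * y) mod n))"
    using sum.reindex[OF inj, of f] by simp
  thus ?thesis using per by simp
qed

section \<open>Legendre symbols and Gauss sums\<close>

definition chi :: "nat \<Rightarrow> int \<Rightarrow> real" where
  "chi p x = of_int (Legendre x (int p))"

lemma chi_0_iff: "chi p x = 0 \<longleftrightarrow> int p dvd x"
  by (auto simp: chi_def Legendre_def cong_0_iff)

lemma chi_cases: "chi p x = 0 \<or> chi p x = 1 \<or> chi p x = -1"
  by (auto simp: chi_def Legendre_def)

lemma chi_mod: "chi p (x mod int p) = chi p x"
  by (simp add: chi_def Legendre_def QuadRes_def cong_def)

text \<open>By Euler's criterion both sides agree modulo \<open>p\<close>; they differ by at most 2,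
  which is less than \<open>p\<close>.\<close>

lemma Legendre_mult:
  assumes "prime p" "p > 2"
  shows "Legendre (a * b) (int p) = Legendre a (int p) * Legendre b (int p)"
proof -
  have "[Legendre (a * b) (int p) = (a * b) ^ ((p - 1) div 2)] (mod int p)"
    using euler_criterion assms by blast
  also have "(a * b) ^ ((p - 1) div 2) = a ^ ((p - 1) div 2) * b ^ ((p - 1) div 2)"
    by (simp add: power_mult_distrib)
  also have "[\<dots> = Legendre a (int p) * Legendre b (int p)] (mod int p)"
    using euler_criterion assms by (intro cong_mult) (auto simp: cong_sym)
  finally have "int p dvd Legendre (a * b) (int p) - Legendre a (int p) * Legendre b (int p)"
    by (simp add: cong_iff_dvd_diff)
  moreover have "\<bar>Legendre (a * b) (int p) - Legendre a (int p) * Legendre b (int p)\<bar> < int p"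
    using assms(2) by (auto simp: Legendre_def)
  ultimately show ?thesis
    using dvd_imp_le_int[of "Legendre (a * b) (int p) - Legendre a (int p) * Legendre b (int p)" "int p"]
    by force
qed

lemma chi_mult: "prime p \<Longrightarrow> p > 2 \<Longrightarrow> chi p (a * b) = chi p a * chi p b"
  by (simp add: chi_def Legendre_mult)

lemma chi_minus:
  assumes "prime p" "p > 2"
  shows "chi p (- x) = (if p mod 4 = 1 then chi p x else - chi p x)"
proof -
  have odd: "odd p" using assms prime_odd_nat by auto
  have "[Legendre (-1) (int p) = (-1) ^ ((p - 1) div 2)] (mod int p)"
    using euler_criterion assms by blast
  hence "int p dvd Legendre (-1) (int p) - (-1) ^ ((p - 1) div 2)"
    by (simp add: cong_iff_dvd_diff)
  moreover have "\<bar>Legendre (-1) (int p) - (-1) ^ ((p - 1) div 2)\<bar> < int p"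
    using assms(2) by (cases "even ((p - 1) div 2)") (simp_all add: Legendre_def)
  ultimately have "Legendre (-1) (int p) = (-1) ^ ((p - 1) div 2)" 
    using dvd_imp_le_int[of "Legendre (-1) (int p) - (-1) ^ ((p - 1) div 2)" "int p"] by force
  moreover have "even ((p - 1) div 2) \<longleftrightarrow> p mod 4 = 1" using odd by presburger
  ultimately have "chi p (-1) = (if p mod 4 = 1 then 1 else -1)" by (auto simp: chi_def)
  thus ?thesis using chi_mult[OF assms, of "-1" x] by auto
qed

text \<open>If all residues were squares, squaring would be onto, hence injective, on the finite set
  of residues; but 1 and \<open>p - 1\<close> have the same square.\<close>

lemma nonresidue_exists:
  assumes "prime p" "p > 2"
  shows "\<exists>a. chi p a = -1"
proof (rule ccontr)
  assume "\<nexists>a. chi p a = -1"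
  have sq: "QuadRes (int p) a" for a
  proof (cases "[a = 0] (mod int p)")
    case True
    thus ?thesis by (auto simp: QuadRes_def cong_def intro!: exI[of _ 0])
  next
    case False
    have "chi p a \<noteq> -1" using \<open>\<nexists>a. chi p a = -1\<close> by blast
    thus ?thesis using False by (simp add: chi_def Legendre_def split: if_splits)
  qed
  let ?f = "\<lambda>y. y\<^sup>2 mod int p"
  have sub: "{0..<int p} \<subseteq> ?f ` {0..<int p}"
  proof
    fix a assume a: "a \<in> {0..<int p}"
    obtain y where "[y\<^sup>2 = a] (mod int p)" using sq[of a] by (auto simp: QuadRes_def)
    hence "?f (y mod int p) = a" using a by (simp add: cong_def power_mod)
    moreover have "y mod int p \<in> {0..<int p}" using assms(2) by simp
    ultimately show "a \<in> ?f ` {0..<int p}" by force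
  qed
  moreover have "?f ` {0..<int p} \<subseteq> {0..<int p}" using assms(2) by auto
  ultimately have "?f ` {0..<int p} = {0..<int p}" by blast
  hence inj: "inj_on ?f {0..<int p}" by (intro eq_card_imp_inj_on) auto
  have eq: "?f 1 = ?f (int p - 1)"
  proof -
    have "int p dvd 1\<^sup>2 - (int p - 1)\<^sup>2" by (simp add: power2_eq_square algebra_simps)
    thus ?thesis using mod_eq_dvd_iff by blast
  qed
  have "1 = int p - 1" by (rule inj_onD[OF inj eq]) (use assms(2) in auto)
  thus False using assms(2) by simp
qed

definition gauss_sum :: "nat \<Rightarrow> int \<Rightarrow> complex" where
  "gauss_sum p u = (\<Sum>y\<in>{0..<int p}. of_real (chi p y) * nth_char (int p) (- (u * y)))"

text \<open>Multiplying the summation variable by a nonresidue permutes the residues and reverses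
  the sign of the sum.\<close>

lemma chi_sum_0:
  assumes "prime p" "p > 2"
  shows "(\<Sum>y\<in>{0..<int p}. chi p y) = 0"
proof -
  obtain a where a: "chi p a = -1" using nonresidue_exists assms by blast
  hence "coprime a (int p)" using assms(1) chi_0_iff[of p a]
    by (metis coprime_commute prime_imp_coprime prime_nat_int_transfer zero_neq_neg_one)
  hence "(\<Sum>y\<in>{0..<int p}. chi p (a * y)) = (\<Sum>y\<in>{0..<int p}. chi p y)"
    using assms(2) by (intro sum_residues_affine) (auto simp: chi_mod)
  thus ?thesis by (simp add: chi_mult[OF assms] a sum_negf)
qed

lemma gauss_sum_mult:
  assumes "prime p" "p > 2"
  shows "gauss_sum p u = of_real (chi p u) * gauss_sum p 1"
proof (cases "int p dvd u")
  case True
  have "gauss_sum p u = (\<Sum>y\<in>{0..<int p}. of_real (chi p y))"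
    unfolding gauss_sum_def using True assms(2)
    by (intro sum.cong) (auto simp: nth_char_eq_1_iff)
  also have "\<dots> = 0" using chi_sum_0[OF assms] by (simp flip: of_real_sum)
  finally show ?thesis using True by (simp add: chi_0_iff)
next
  case False
  have c: "coprime u (int p)" using False assms(1)
    by (metis coprime_commute prime_imp_coprime prime_nat_int_transfer)
  let ?f = "\<lambda>z. of_real (chi p z) * nth_char (int p) (- z)"
  have per: "?f (x mod int p) = ?f x" for x
    using nth_char_mod[of "int p" "- (x mod int p)"] nth_char_mod[of "int p" "- x"] assms(2)
    by (simp add: chi_mod mod_minus_eq)
  have "gauss_sum p 1 = (\<Sum>y\<in>{0..<int p}. ?f (u * y))"
    unfolding gauss_sum_def using sum_residues_affine[of "int p" ?f u, OF _ per c] assms(2) by simp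
  also have "\<dots> = of_real (chi p u) * gauss_sum p u"
    by (simp add: gauss_sum_def sum_distrib_left chi_mult[OF assms] mult.assoc)
  finally have "of_real (chi p u) * gauss_sum p 1 = of_real ((chi p u)\<^sup>2) * gauss_sum p u"
    by (simp add: power2_eq_square)
  moreover have "(chi p u)\<^sup>2 = 1" using chi_cases[of p u] chi_0_iff[of p u] False by auto
  ultimately show ?thesis by simp
qed

text \<open>Parseval: the sum of |\<open>gauss_sum p u\<close>|^2 over all \<open>u\<close> is
  \<open>p * (p - 1)\<close> by orthogonality of the characters, and \<open>p - 1\<close> times
  |\<open>gauss_sum p 1\<close>|^2 by \<open>gauss_sum_mult\<close>.\<close>

lemma gauss_sum_norm:
  assumes "prime p" "p > 2"
  shows "cmod (gauss_sum p u) \<le> sqrt p"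
proof -
  let ?R = "{0..<int p}"
  have sq: "(\<Sum>y\<in>?R. (chi p y)\<^sup>2) = real p - 1"
  proof -
    have "(\<Sum>y\<in>?R. (chi p y)\<^sup>2) = (\<Sum>y\<in>?R - {0}. (chi p y)\<^sup>2)"
      using assms(2) by (intro sum.mono_neutral_right) (auto simp: chi_0_iff)
    also have "\<dots> = (\<Sum>y\<in>?R - {0}. 1)"
    proof (rule sum.cong)
      fix y assume y: "y \<in> ?R - {0}"
      hence "\<not> int p dvd y" using zdvd_imp_le[of "int p" y] by auto
      thus "(chi p y)\<^sup>2 = 1" using chi_cases[of p y] chi_0_iff[of p y] by auto
    qed simp
    also have "\<dots> = real p - 1" using assms(2) by simp
    finally show ?thesis .
  qed
  have "(\<Sum>u\<in>?R. gauss_sum p u * cnj (gauss_sum p u)) =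
      (\<Sum>u\<in>?R. \<Sum>y\<in>?R. \<Sum>z\<in>?R. of_real (chi p y * chi p z) * nth_char (int p) (u * (z - y)))"
  proof (intro sum.cong refl)
    fix u
    have "gauss_sum p u * cnj (gauss_sum p u) = (\<Sum>y\<in>?R. \<Sum>z\<in>?R. of_real (chi p y * chi p z) *
        (nth_char (int p) (- (u * y)) * nth_char (int p) (u * z)))"
      unfolding gauss_sum_def cnj_sum sum_product
      by (intro sum.cong refl) (simp add: nth_char_cnj mult_ac)
    thus "gauss_sum p u * cnj (gauss_sum p u) = (\<Sum>y\<in>?R. \<Sum>z\<in>?R. of_real (chi p y * chi p z) *
        nth_char (int p) (u * (z - y)))"
      by (simp add: algebra_simps flip: nth_char_add)
  qed
  also have "\<dots> = (\<Sum>y\<in>?R. \<Sum>u\<in>?R. \<Sum>z\<in>?R. of_real (chi p y * chi p z) * nth_char (int p) (u * (z - y)))"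
    by (rule sum.swap)
  also have "\<dots> = (\<Sum>y\<in>?R. \<Sum>z\<in>?R. of_real (chi p y * chi p z) * (\<Sum>u\<in>?R. nth_char (int p) (u * (z - y))))"
    by (rule sum.cong[OF refl], subst sum.swap) (simp add: sum_distrib_left)
  also have "\<dots> = (\<Sum>y\<in>?R. \<Sum>z\<in>?R. if z = y then of_real ((chi p y)\<^sup>2 * real p) else 0)"
  proof (intro sum.cong refl)
    fix y z assume yz: "y \<in> ?R" "z \<in> ?R"
    have "int p dvd z - y \<longleftrightarrow> z mod int p = y mod int p" by (simp add: mod_eq_dvd_iff)
    also have "\<dots> \<longleftrightarrow> z = y" using yz by auto
    finally show "of_real (chi p y * chi p z) * (\<Sum>u\<in>?R. nth_char (int p) (u * (z - y))) =
        (if z = y then of_real ((chi p y)\<^sup>2 * real p) else 0)"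
      using nth_char_sum[of "int p" "z - y"] assms(2) by (simp add: power2_eq_square)
  qed
  also have "\<dots> = of_real ((\<Sum>y\<in>?R. (chi p y)\<^sup>2) * real p)"
    by (simp add: sum_distrib_right)
  also have "\<dots> = of_real ((real p - 1) * real p)" by (simp only: sq)
  finally have "(\<Sum>u\<in>?R. gauss_sum p u * cnj (gauss_sum p u)) = of_real ((real p - 1) * real p)" .
  moreover have "(\<Sum>u\<in>?R. gauss_sum p u * cnj (gauss_sum p u)) =
      (\<Sum>u\<in>?R. of_real ((chi p u)\<^sup>2 * (cmod (gauss_sum p 1))\<^sup>2))"
  proof (intro sum.cong refl)
    fix u
    have "cmod (gauss_sum p u) = \<bar>chi p u\<bar> * cmod (gauss_sum p 1)"
      using arg_cong[OF gauss_sum_mult[OF assms, of u], of cmod] by (simp add: norm_mult)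
    hence "(cmod (gauss_sum p u))\<^sup>2 = (chi p u)\<^sup>2 * (cmod (gauss_sum p 1))\<^sup>2"
      by (simp add: power_mult_distrib)
    thus "gauss_sum p u * cnj (gauss_sum p u) = of_real ((chi p u)\<^sup>2 * (cmod (gauss_sum p 1))\<^sup>2)"
      by (metis complex_norm_square)
  qed
  moreover have "\<dots> = of_real ((\<Sum>u\<in>?R. (chi p u)\<^sup>2) * (cmod (gauss_sum p 1))\<^sup>2)"
    by (simp add: sum_distrib_right)
  ultimately have "of_real ((real p - 1) * real p) = (of_real ((real p - 1) * (cmod (gauss_sum p 1))\<^sup>2) :: complex)"
    by (simp only: sq)
  hence "(real p - 1) * real p = (real p - 1) * (cmod (gauss_sum p 1))\<^sup>2" by (simp only: of_real_eq_iff)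
  hence "(cmod (gauss_sum p 1))\<^sup>2 = real p" using assms(2) by simp
  hence "cmod (gauss_sum p 1) = sqrt p" by (metis norm_ge_zero real_sqrt_unique)
  moreover have "cmod (gauss_sum p u) = \<bar>chi p u\<bar> * cmod (gauss_sum p 1)"
    using arg_cong[OF gauss_sum_mult[OF assms, of u], of cmod] by (simp add: norm_mult)
  moreover have "\<bar>chi p u\<bar> \<le> 1" using chi_cases[of p u] by auto
  ultimately show ?thesis by (simp add: mult_left_le_one_le)
qed

text \<open>The factor \<open>\<i>\<close> makes the odd character Hermitian, so that its Fourier transform is real.\<close>

definition psi :: "nat \<Rightarrow> int \<Rightarrow> complex" where
  "psi p x = (if p mod 4 = 1 then 1 else \<i>) * of_real (chi p x)"

definition delta :: "nat \<Rightarrow> int \<Rightarrow> complex" where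
  "delta p x = (if int p dvd x then 1 else 0)"

text \<open>At every nonzero frequency \<open>sqrt p * delta p\<close> has coefficient
  \<open>sqrt p\<close>, which dominates the Gauss sum. At frequency 0 the transform of
  \<open>psi p\<close> vanishes, so subtracting the mean \<open>1 / p\<close> of
  \<open>delta p\<close> keeps positivity. The centred form is what allows the constant coefficient
  to be normalised to exactly 1 later.\<close>

lemma pos_def_centred_delta_psi:
  assumes p: "prime p" "p > 2" and s: "s = 1 \<or> s = -1"
  shows "pos_def (\<lambda>x. of_real (sqrt p) * (delta p x - 1 / of_nat p) + s * psi p x)"
proof (rule pos_def_of_fourier_nonneg[of "int p"])
  show "int p > 0" using p by simp
  show "of_real (sqrt p) * (delta p (x mod int p) - 1 / of_nat p) + s * psi p (x mod int p) =
      of_real (sqrt p) * (delta p x - 1 / of_nat p) + s * psi p x" for x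
    by (simp add: delta_def psi_def chi_mod dvd_mod_iff)
  fix u
  let ?R = "{0..<int p}"
  let ?G = "\<Sum>y\<in>?R. psi p y * nth_char (int p) (- (u * y))"
  have G: "?G = (if p mod 4 = 1 then 1 else \<i>) * gauss_sum p u"
    by (simp add: psi_def gauss_sum_def sum_distrib_left mult.assoc)
  have "cnj ?G = (\<Sum>y\<in>?R. psi p (-1 * y) * nth_char (int p) (- (u * (-1 * y))))"
    by (simp add: psi_def nth_char_cnj chi_minus[OF p])
  also have "\<dots> = ?G"
  proof (rule sum_residues_affine)
    fix x
    have "u * (x mod int p) mod int p = u * x mod int p" by (rule mod_mult_right_eq)
    hence "(- (u * (x mod int p))) mod int p = (- (u * x)) mod int p" using mod_minus_cong by blast
    hence "nth_char (int p) (- (u * (x mod int p))) = nth_char (int p) (- (u * x))"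
      using nth_char_mod[of "int p"] p(2) by (metis of_nat_0_less_iff prime_gt_0_nat p(1))
    thus "psi p (x mod int p) * nth_char (int p) (- (u * (x mod int p))) = psi p x * nth_char (int p) (- (u * x))"
      by (simp add: psi_def chi_mod)
  qed (use p in auto)
  finally have real: "?G = of_real (Re ?G)" by (metis Reals_cnj_iff of_real_Re)
  have "\<bar>Re ?G\<bar> \<le> cmod ?G" by (rule abs_Re_le_cmod)
  also have "\<dots> = cmod (gauss_sum p u)" by (simp add: G norm_mult)
  also have "\<dots> \<le> sqrt p" by (rule gauss_sum_norm[OF p])
  finally have bd: "\<bar>Re ?G\<bar> \<le> sqrt p" .
  let ?e = "if int p dvd u then 0 else 1 :: real"
  have D: "(\<Sum>y\<in>?R. delta p y * nth_char (int p) (- (u * y))) = 1"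
  proof -
    have "(\<Sum>y\<in>?R. delta p y * nth_char (int p) (- (u * y))) = (\<Sum>y\<in>?R. if y = 0 then 1 else 0)"
    proof (intro sum.cong refl)
      fix y assume "y \<in> ?R"
      hence "int p dvd y \<longleftrightarrow> y = 0" using zdvd_not_zless[of y "int p"] by (cases "y = 0") auto
      thus "delta p y * nth_char (int p) (- (u * y)) = (if y = 0 then 1 else 0)"
        by (simp add: delta_def nth_char_def)
    qed
    also have "\<dots> = 1" using p by simp
    finally show ?thesis .
  qed
  have O: "(\<Sum>y\<in>?R. nth_char (int p) (- (u * y))) = (if int p dvd u then of_nat p else 0)"
    using nth_char_sum[of "int p" "- u"] p by (simp add: mult.commute)
  have "(\<Sum>y\<in>?R. (of_real (sqrt p) * (delta p y - 1 / of_nat p) + s * psi p y) * nth_char (int p) (- (u * y))) =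
     of_real (sqrt p) * ((\<Sum>y\<in>?R. delta p y * nth_char (int p) (- (u * y))) -
       (\<Sum>y\<in>?R. nth_char (int p) (- (u * y))) / of_nat p) + s * ?G"
    by (simp add: sum.distrib sum_distrib_left sum_divide_distrib sum_subtractf algebra_simps)
  also have "\<dots> = of_real (sqrt p * ?e) + s * of_real (Re ?G)"
    using p real by (simp add: D O)
  finally have eq: "(\<Sum>y\<in>?R. (of_real (sqrt p) * (delta p y - 1 / of_nat p) + s * psi p y) *
     nth_char (int p) (- (u * y))) = of_real (sqrt p * ?e) + s * of_real (Re ?G)" .
  have bd': "\<bar>Re ?G\<bar> \<le> sqrt p * ?e"
  proof (cases "int p dvd u")
    case True
    hence "?G = 0" unfolding G using gauss_sum_mult[OF p, of u] chi_0_iff[of p u] by simp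
    thus ?thesis using True by simp
  qed (use bd in simp)
  show "\<exists>r\<ge>0. (\<Sum>y\<in>?R. (of_real (sqrt p) * (delta p y - 1 / of_nat p) + s * psi p y) *
     nth_char (int p) (- (u * y))) = of_real r"
    using s
  proof
    assume "s = 1"
    thus ?thesis using eq bd' by (intro exI[of _ "sqrt p * ?e + Re ?G"]) auto
  next
    assume "s = -1"
    thus ?thesis using eq bd' by (intro exI[of _ "sqrt p * ?e - Re ?G"]) auto
  qed
qed

lemma pos_def_delta_psi:
  assumes p: "prime p" "p > 2" and s: "s = 1 \<or> s = -1"
  shows "pos_def (\<lambda>x. of_real (sqrt p) * delta p x + s * psi p x)"
proof -
  have "pos_def (\<lambda>x. (of_real (sqrt p) * (delta p x - 1 / of_nat p) + s * psi p x) +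
      of_real (sqrt p * (1 / real p)))"
    by (rule pos_def_add[OF pos_def_centred_delta_psi[OF assms] pos_def_const]) simp
  moreover have e: "complex_of_real (sqrt p * (1 / real p)) = of_real (sqrt p) * (1 / of_nat p)"
    by (simp only: of_real_mult of_real_divide of_real_1 of_real_of_nat_eq)
  ultimately show ?thesis
    by (simp only: right_diff_distrib diff_add_eq add_diff_cancel_right')
qed

section \<open>Sets whose differences avoid squares\<close>

lemma pos_def_delta: "p > 0 \<Longrightarrow> pos_def (delta p)"
proof (rule pos_def_of_fourier_nonneg[of "int p"])
  assume p: "p > 0"
  show "\<exists>r\<ge>0. (\<Sum>y\<in>{0..<int p}. delta p y * nth_char (int p) (- (u * y))) = of_real r" for u
  proof (intro exI[of _ 1] conjI)
    have "(\<Sum>y\<in>{0..<int p}. delta p y * nth_char (int p) (- (u * y))) = (\<Sum>y\<in>{0..<int p}. if y = 0 then 1 else 0)"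
    proof (intro sum.cong refl)
      fix y assume "y \<in> {0..<int p}"
      hence "int p dvd y \<longleftrightarrow> y = 0" using zdvd_not_zless[of y "int p"] by (cases "y = 0") auto
      thus "delta p y * nth_char (int p) (- (u * y)) = (if y = 0 then 1 else 0)"
        by (simp add: delta_def nth_char_def)
    qed
    also have "\<dots> = of_real 1" using p by simp
    finally show "(\<Sum>y\<in>{0..<int p}. delta p y * nth_char (int p) (- (u * y))) = of_real 1" .
  qed simp
qed (auto simp: delta_def dvd_mod_iff)

text \<open>The average of (a + b)(a' + s b') and (a - b)(a' - s b') is a a' + s b b': the cross
  terms cancel. The induction thus needs both signs for every factor, hence the free
  \<open>s\<close>.\<close>

lemma pos_def_delta_psi_prod:
  assumes "finite S" "\<And>p. p \<in> S \<Longrightarrow> prime p \<and> p > 2" "s = 1 \<or> s = -1"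
  shows "pos_def (\<lambda>x. of_real (sqrt (\<Prod>S)) * (\<Prod>p\<in>S. delta p x) + s * (\<Prod>p\<in>S. psi p x))"
  using assms
proof (induction S arbitrary: s rule: finite_induct)
  case empty
  thus ?case using pos_def_const[of 2] pos_def_const[of 0] by auto
next
  case (insert p S)
  let ?a = "\<lambda>x. of_real (sqrt p) * delta p x" and ?b = "psi p"
  let ?a' = "\<lambda>x. of_real (sqrt (\<Prod>S)) * (\<Prod>p\<in>S. delta p x)" and ?b' = "\<lambda>x. \<Prod>p\<in>S. psi p x"
  have "pos_def (\<lambda>x. of_real (1/2) * ((?a x + 1 * ?b x) * (?a' x + s * ?b' x) + (?a x + (-1) * ?b x) * (?a' x + (- s) * ?b' x)))"
    by (rule pos_def_scale[OF pos_def_add[OF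
          pos_def_mult[OF pos_def_delta_psi insert.IH] pos_def_mult[OF pos_def_delta_psi insert.IH]]])
       (use insert.prems in auto)
  also have "(\<lambda>x. of_real (1/2) * ((?a x + 1 * ?b x) * (?a' x + s * ?b' x) + (?a x + (-1) * ?b x) * (?a' x + (- s) * ?b' x))) =
     (\<lambda>x. of_real (sqrt (\<Prod>(insert p S))) * (\<Prod>p\<in>insert p S. delta p x) + s * (\<Prod>p\<in>insert p S. psi p x))"
  proof
    fix x
    have "1/2 * ((a + 1 * b) * (a' + s * b') + (a + (-1) * b) * (a' + (- s) * b')) = a * a' + s * (b * b')"
      for a b a' b' :: complex by (simp add: algebra_simps)
    thus "of_real (1/2) * ((?a x + 1 * ?b x) * (?a' x + s * ?b' x) + (?a x + (-1) * ?b x) * (?a' x + (- s) * ?b' x)) =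
       of_real (sqrt (\<Prod>(insert p S))) * (\<Prod>p\<in>insert p S. delta p x) + s * (\<Prod>p\<in>insert p S. psi p x)"
      using insert.hyps by (simp add: real_sqrt_mult)
  qed
  finally show ?case .
qed

text \<open>For an even number 2k of factors the powers of the imaginary unit in \<open>psi\<close>
  combine to the real sign (-1)^k, which the choice of \<open>s\<close> cancels.\<close>

lemma pos_def_delta_chi_prod:
  assumes "finite S" "even (card S)" "\<And>p. p \<in> S \<Longrightarrow> prime p \<and> p mod 4 = 3"
  shows "pos_def (\<lambda>x. of_real (sqrt (\<Prod>S)) * (\<Prod>p\<in>S. delta p x) + of_real (\<Prod>p\<in>S. chi p x))"
proof -
  obtain k where k: "card S = 2 * k" using assms(2) by auto
  have p: "prime p \<and> p > 2" if "p \<in> S" for p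
  proof -
    have "p \<noteq> 2" using assms(3)[OF that] by auto
    thus ?thesis using assms(3)[OF that] prime_ge_2_nat[of p] by linarith
  qed
  have "(\<Prod>p\<in>S. psi p x) = (\<Prod>p\<in>S. \<i> * of_real (chi p x))" for x
    using assms(3) by (intro prod.cong) (auto simp: psi_def)
  hence psi: "(\<Prod>p\<in>S. psi p x) = (-1) ^ k * of_real (\<Prod>p\<in>S. chi p x)" for x
    by (simp add: prod.distrib k power_mult)
  have "pos_def (\<lambda>x. of_real (sqrt (\<Prod>S)) * (\<Prod>p\<in>S. delta p x) + (-1) ^ k * (\<Prod>p\<in>S. psi p x))"
    by (rule pos_def_delta_psi_prod) (use assms(1) p in \<open>auto simp: minus_one_power_iff\<close>)
  thus ?thesis by (simp add: psi flip: mult.assoc power_mult_distrib)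
qed

section \<open>Kernels with constant coefficient at least 1\<close>

lemma pos_def_minus_one_mult:
  assumes "pos_def (\<lambda>x. F x - 1)" "pos_def (\<lambda>x. G x - 1)"
  shows "pos_def (\<lambda>x. F x * G x - 1)"
proof -
  have "pos_def (\<lambda>x. (F x - 1) * (G x - 1) + ((F x - 1) + (G x - 1)))"
    by (rule pos_def_add[OF pos_def_mult[OF assms] pos_def_add[OF assms]])
  thus ?thesis by (simp add: algebra_simps)
qed

lemma pos_def_minus_one_prod:
  "(\<And>i. i \<in> I \<Longrightarrow> pos_def (\<lambda>x. F i x - 1)) \<Longrightarrow> pos_def (\<lambda>x. (\<Prod>i\<in>I. F i x) - 1)"
  by (induction I rule: infinite_finite_induct) (auto intro: pos_def.zero pos_def_minus_one_mult)

text \<open>The use is for \<open>f\<close> with values among 0, 1 and -1: a value -1 annihilates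
  the first product and a value 1 the second, so the sum vanishes where both signs occur.\<close>

lemma sum_even_subsets_prod:
  fixes f :: "'a \<Rightarrow> real"
  assumes "finite K"
  shows "2 * (\<Sum>S | S \<subseteq> K \<and> even (card S). \<Prod>p\<in>S. f p) = (\<Prod>p\<in>K. 1 + f p) + (\<Prod>p\<in>K. 1 - f p)"
proof -
  have "(\<Prod>p\<in>K. 1 + f p) = (\<Sum>S\<in>Pow K. \<Prod>p\<in>S. f p)"
    using prod_add[OF assms, of f "\<lambda>_. 1"] by (simp add: add.commute)
  moreover have "(\<Prod>p\<in>K. 1 - f p) = (\<Sum>S\<in>Pow K. (-1) ^ card S * (\<Prod>p\<in>S. f p))"
  proof -
    have "(\<Prod>p\<in>K. 1 - f p) = (\<Prod>p\<in>K. (-1) * f p + 1)" by simp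
    also have "\<dots> = (\<Sum>S\<in>Pow K. (\<Prod>p\<in>S. (-1) * f p) * (\<Prod>p\<in>K - S. 1))"
      by (rule prod_add[OF assms])
    finally show ?thesis by (simp only: prod.distrib prod_constant mult_1_right power_one)
  qed
  ultimately have "(\<Prod>p\<in>K. 1 + f p) + (\<Prod>p\<in>K. 1 - f p) = (\<Sum>S\<in>Pow K. (\<Prod>p\<in>S. f p) + (-1) ^ card S * (\<Prod>p\<in>S. f p))"
    by (simp add: sum.distrib)
  also have "\<dots> = (\<Sum>S | S \<subseteq> K \<and> even (card S). (\<Prod>p\<in>S. f p) + (-1) ^ card S * (\<Prod>p\<in>S. f p))"
    using assms by (intro sum.mono_neutral_right) auto
  also have "\<dots> = (\<Sum>S | S \<subseteq> K \<and> even (card S). 2 * (\<Prod>p\<in>S. f p))"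
    by (intro sum.cong) auto
  finally show ?thesis by (simp add: sum_distrib_left)
qed

text \<open>Where the signs on \<open>K\<close> are mixed, the sum over even subsets vanishes, and a
  correction term for S can survive only if every prime of S divides \<open>x\<close>. The mixed
  signs then lie in \<open>K - S\<close>, where the kernel from the induction hypothesis is 0.
  Removing an even set keeps the cardinality odd, so \<open>K - S\<close> is never empty and each
  correction term saves \<open>sqrt y\<close>. At 0 all corrections have the same bound; there are
  fewer than 2^k of them, each with at most k - 1 primes left, and k + (k - 1)^2 is at most
  k^2.\<close>

lemma exists_odd_kernel:
  assumes "finite K" "odd (card K)" "\<And>p. p \<in> K \<Longrightarrow> prime p \<and> p mod 4 = 3 \<and> y \<le> real p" "y > 0"
  shows "\<exists>F. pos_def (\<lambda>x. F x - 1) \<and>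
    (\<forall>x. (\<exists>p\<in>K. chi p x = 1) \<and> (\<exists>p\<in>K. chi p x = -1) \<longrightarrow> F x = 0) \<and>
    Re (F 0) \<le> 2 ^ (card K)\<^sup>2 * sqrt (real (\<Prod>K) / y)"
  using assms
proof (induction K rule: finite_psubset_induct)
  case (psubset K)
  define k where "k = card K"
  define Ev where "Ev = {S. S \<subseteq> K \<and> even (card S) \<and> S \<noteq> {}}"
  define P where "P = (\<lambda>L F. pos_def (\<lambda>x. F x - 1) \<and>
    (\<forall>x. (\<exists>p\<in>L. chi p x = 1) \<and> (\<exists>p\<in>L. chi p x = -1) \<longrightarrow> F x = 0) \<and>
    Re (F 0) \<le> 2 ^ (card L)\<^sup>2 * sqrt (real (\<Prod>L) / y))"
  have fin: "finite Ev" using psubset.hyps by (simp add: Ev_def)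
  have "\<exists>F. P (K - S) F" if S: "S \<in> Ev" for S
    unfolding P_def
  proof (rule psubset.IH)
    show "K - S \<subset> K" using S by (auto simp: Ev_def)
    have "card (K - S) = card K - card S" "card S \<le> card K"
      using S psubset.hyps by (auto simp: Ev_def card_Diff_subset finite_subset card_mono)
    thus "odd (card (K - S))" using S psubset.prems(1) by (simp add: Ev_def)
  qed (use psubset.prems in auto)
  then obtain G where G: "\<And>S. S \<in> Ev \<Longrightarrow> P (K - S) (G S)" by metis
  \<comment> \<open>The correction terms \<open>\<delta>\<^sub>S G\<^sub>S\<close> compensate the negative Fourier coefficients of \<open>\<chi>\<^sub>S\<close>, which are at
    the frequencies supported on \<open>S\<close>; \<open>G\<^sub>S\<close> is the kernel for the remaining primes \<open>K - S\<close>.\<close>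
  define F where "F = (\<lambda>x. of_real (\<Sum>S | S \<subseteq> K \<and> even (card S). \<Prod>p\<in>S. chi p x) +
     (\<Sum>S\<in>Ev. of_real (sqrt (\<Prod>S)) * (\<Prod>p\<in>S. delta p x) * G S x))"
  have split: "(\<Sum>S | S \<subseteq> K \<and> even (card S). \<Prod>p\<in>S. chi p x) = 1 + (\<Sum>S\<in>Ev. \<Prod>p\<in>S. chi p x)" for x
  proof -
    have "{S. S \<subseteq> K \<and> even (card S)} = insert {} Ev" by (auto simp: Ev_def)
    thus ?thesis using fin by (simp add: Ev_def)
  qed
  have "pos_def (\<lambda>x. \<Sum>S\<in>Ev. (of_real (sqrt (\<Prod>S)) * (\<Prod>p\<in>S. delta p x) + of_real (\<Prod>p\<in>S. chi p x))
      + of_real (sqrt (\<Prod>S)) * ((\<Prod>p\<in>S. delta p x) * (G S x - 1)))"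
  proof (rule pos_def_sum, rule pos_def_add)
    fix S assume S: "S \<in> Ev"
    show "pos_def (\<lambda>x. of_real (sqrt (\<Prod>S)) * (\<Prod>p\<in>S. delta p x) + of_real (\<Prod>p\<in>S. chi p x))"
      by (rule pos_def_delta_chi_prod)
         (use S psubset.prems(2) psubset.hyps in \<open>auto simp: Ev_def intro: finite_subset\<close>)
    have "pos_def (\<lambda>x. G S x - 1)" using G[OF S] by (simp add: P_def)
    moreover have "pos_def (\<lambda>x. \<Prod>p\<in>S. delta p x)"
    proof (rule pos_def_prod)
      fix p assume "p \<in> S"
      thus "pos_def (delta p)"
        using S psubset.prems(2)[of p] by (intro pos_def_delta) (auto simp: Ev_def prime_gt_0_nat)
    qed
    ultimately show "pos_def (\<lambda>x. of_real (sqrt (\<Prod>S)) * ((\<Prod>p\<in>S. delta p x) * (G S x - 1)))"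
      by (intro pos_def_scale[OF pos_def_mult]) (auto intro!: prod_nonneg)
  qed
  also have "(\<lambda>x. \<Sum>S\<in>Ev. (of_real (sqrt (\<Prod>S)) * (\<Prod>p\<in>S. delta p x) + of_real (\<Prod>p\<in>S. chi p x))
      + of_real (sqrt (\<Prod>S)) * ((\<Prod>p\<in>S. delta p x) * (G S x - 1))) = (\<lambda>x. F x - 1)"
    by (rule ext) (simp add: F_def split sum.distrib sum_subtractf right_diff_distrib mult.assoc)
  finally have "pos_def (\<lambda>x. F x - 1)" .
  moreover have "F x = 0" if x: "\<exists>p\<in>K. chi p x = 1" "\<exists>p\<in>K. chi p x = -1" for x
  proof -
    obtain p q where pq: "p \<in> K" "chi p x = 1" "q \<in> K" "chi q x = -1" using x by blast
    have "(\<Prod>p\<in>K. 1 + chi p x) = 0" by (rule prod_zero[OF psubset.hyps(1) bexI[OF _ pq(3)]]) (simp add: pq)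
    moreover have "(\<Prod>p\<in>K. 1 - chi p x) = 0"
      by (rule prod_zero[OF psubset.hyps(1) bexI[OF _ pq(1)]]) (simp add: pq)
    ultimately have E: "(\<Sum>S | S \<subseteq> K \<and> even (card S). \<Prod>p\<in>S. chi p x) = 0"
      using sum_even_subsets_prod[OF psubset.hyps, of "\<lambda>p. chi p x"] by simp
    have "of_real (sqrt (\<Prod>S)) * (\<Prod>p\<in>S. delta p x) * G S x = 0" if S: "S \<in> Ev" for S
    proof (cases "\<forall>p\<in>S. chi p x = 0")
      case True
      hence "(\<exists>p\<in>K - S. chi p x = 1) \<and> (\<exists>p\<in>K - S. chi p x = -1)" using x by force
      thus ?thesis using G[OF S] by (simp add: P_def)
    next
      case False
      then obtain p where "p \<in> S" "delta p x = 0" by (auto simp: chi_0_iff delta_def)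
      moreover have "finite S" using S psubset.hyps by (auto simp: Ev_def intro: finite_subset)
      ultimately have "(\<Prod>p\<in>S. delta p x) = 0" by (intro prod_zero) auto
      thus ?thesis by simp
    qed
    hence "(\<Sum>S\<in>Ev. of_real (sqrt (\<Prod>S)) * (\<Prod>p\<in>S. delta p x) * G S x) = 0"
      by (intro sum.neutral) blast
    with E show ?thesis unfolding F_def by (simp only: of_real_0 add_0)
  qed
  moreover have "Re (F 0) \<le> 2 ^ k\<^sup>2 * sqrt (real (\<Prod>K) / y)"
  proof -
    let ?R = "sqrt (real (\<Prod>K) / y)"
    have k: "k > 0" using psubset.prems(1) by (auto simp: k_def intro: Nat.gr0I)
    have "(\<Prod>p\<in>S. chi p 0) = 0" if "S \<in> Ev" for S
    proof -
      obtain p where "p \<in> S" using \<open>S \<in> Ev\<close> by (auto simp: Ev_def)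
      moreover have "finite S" using \<open>S \<in> Ev\<close> psubset.hyps by (auto simp: Ev_def intro: finite_subset)
      ultimately show ?thesis by (intro prod_zero) (auto simp: chi_0_iff)
    qed
    hence "(\<Sum>S\<in>Ev. \<Prod>p\<in>S. chi p 0) = 0" by (intro sum.neutral) blast
    hence E: "(\<Sum>S | S \<subseteq> K \<and> even (card S). \<Prod>p\<in>S. chi p 0) = 1" by (simp only: split add_0_right)
    have "delta p 0 = 1" for p by (simp add: delta_def)
    hence "F 0 = 1 + (\<Sum>S\<in>Ev. of_real (sqrt (\<Prod>S)) * G S 0)"
      by (simp only: F_def E of_real_1 prod.neutral_const mult_1_right)
    hence "Re (F 0) = 1 + (\<Sum>S\<in>Ev. sqrt (\<Prod>S) * Re (G S 0))" by simp
    also have "\<dots> \<le> ?R + (\<Sum>S\<in>Ev. 2 ^ (k - 1)\<^sup>2 * ?R)"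
    proof (intro add_mono sum_mono)
      obtain p where p: "p \<in> K" using psubset.prems(1) by (metis card.empty ex_in_conv even_zero)
      have "p \<le> \<Prod>K"
        using p psubset.hyps psubset.prems(2)
        by (intro dvd_imp_le dvd_prodI prod_pos) (auto simp: prime_gt_0_nat)
      hence "y \<le> real (\<Prod>K)" using psubset.prems(2)[OF p] by linarith
      thus "1 \<le> ?R" using psubset.prems(3) by simp
    next
      fix S assume S: "S \<in> Ev"
      have SK: "S \<subseteq> K" "S \<noteq> {}" using S by (auto simp: Ev_def)
      have "finite S" using SK(1) psubset.hyps by (rule finite_subset)
      hence "card (K - S) \<le> k - 1"
        using SK psubset.hyps card_gt_0_iff[of S] by (simp add: k_def card_Diff_subset)
      hence c: "(2::real) ^ (card (K - S))\<^sup>2 \<le> 2 ^ (k - 1)\<^sup>2" by (intro power_increasing power_mono) auto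
      have "sqrt (\<Prod>S) * Re (G S 0) \<le> sqrt (\<Prod>S) * (2 ^ (card (K - S))\<^sup>2 * sqrt (real (\<Prod>(K - S)) / y))"
        using G[OF S] by (intro mult_left_mono) (auto simp: P_def intro: prod_nonneg)
      also have "\<dots> \<le> sqrt (\<Prod>S) * (2 ^ (k - 1)\<^sup>2 * sqrt (real (\<Prod>(K - S)) / y))"
        using c psubset.prems(3)
        by (intro mult_left_mono mult_right_mono real_sqrt_ge_zero divide_nonneg_pos) (simp_all add: prod_nonneg)
      also have "\<dots> = 2 ^ (k - 1)\<^sup>2 * ?R"
      proof -
        have "\<Prod>K = \<Prod>S * \<Prod>(K - S)"
          using prod.subset_diff[OF SK(1) psubset.hyps, of "\<lambda>x. x"] by (simp add: mult.commute)
        thus ?thesis by (simp add: real_sqrt_mult real_sqrt_divide)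
      qed
      finally show "sqrt (\<Prod>S) * Re (G S 0) \<le> 2 ^ (k - 1)\<^sup>2 * ?R" .
    qed
    also have "\<dots> = (1 + real (card Ev) * 2 ^ (k - 1)\<^sup>2) * ?R" by (simp add: algebra_simps)
    also have "\<dots> \<le> 2 ^ k\<^sup>2 * ?R"
    proof (rule mult_right_mono)
      have "insert {} Ev \<subseteq> Pow K" by (auto simp: Ev_def)
      hence "card (insert {} Ev) \<le> 2 ^ k"
        using psubset.hyps card_mono[of "Pow K"] by (simp add: k_def card_Pow)
      moreover have "card (insert {} Ev) = card Ev + 1" using fin by (simp add: Ev_def)
      ultimately have "card Ev + 1 \<le> 2 ^ k" by linarith
      hence "real (card Ev + 1) \<le> real (2 ^ k)" by (rule of_nat_mono)
      hence cE: "real (card Ev) + 1 \<le> 2 ^ k" by simp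
      have "1 + real (card Ev) * 2 ^ (k - 1)\<^sup>2 \<le> (real (card Ev) + 1) * 2 ^ (k - 1)\<^sup>2"
        by (simp add: algebra_simps)
      also have "\<dots> \<le> 2 ^ k * 2 ^ (k - 1)\<^sup>2" using cE by (intro mult_right_mono) auto
      also have "\<dots> = 2 ^ (k + (k - 1)\<^sup>2)" by (simp add: power_add)
      also have "\<dots> \<le> 2 ^ k\<^sup>2"
      proof (rule power_increasing)
        obtain j where "k = Suc j" using k by (cases k) auto
        thus "k + (k - 1)\<^sup>2 \<le> k\<^sup>2" by (simp add: power2_eq_square)
      qed simp
      finally show "1 + real (card Ev) * 2 ^ (k - 1)\<^sup>2 \<le> 2 ^ k\<^sup>2" .
    qed (use psubset.prems(3) in \<open>simp add: prod_nonneg\<close>)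
    finally show ?thesis .
  qed
  ultimately show ?case unfolding k_def by blast
qed

lemma card_le_kernel_zero:
  assumes "finite A" "pos_def (\<lambda>x. F x - 1)" "\<And>a b. a \<in> A \<Longrightarrow> b \<in> A \<Longrightarrow> a \<noteq> b \<Longrightarrow> F (a - b) = 0"
    "A \<noteq> {}"
  shows "real (card A) \<le> Re (F 0)"
proof -
  have "(\<Sum>a\<in>A. \<Sum>b\<in>A. F (a - b) - 1) = (\<Sum>a\<in>A. (\<Sum>b\<in>A. if b = a then F 0 else 0) - of_nat (card A))"
    using assms(3) by (intro sum.cong refl) (auto simp: sum_subtractf intro!: sum.cong)
  also have "\<dots> = of_nat (card A) * (F 0 - of_nat (card A))"
    using assms(1) by simp
  finally have "0 \<le> Re (of_nat (card A) * (F 0 - of_nat (card A)))"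
    using pos_def_double_sum_nonneg[OF assms(2), of A] by simp
  hence "0 \<le> real (card A) * (Re (F 0) - real (card A))" by simp
  moreover have "real (card A) > 0" using assms by (simp add: card_gt_0_iff)
  ultimately show ?thesis by (simp add: zero_le_mult_iff)
qed

text \<open>The bracket has mean 1 + 1 / \<open>sqrt p\<close>, as \<open>psi p\<close> has mean 0
  and \<open>delta p\<close> has mean \<open>1 / p\<close>; the outer factor is the inverse of this
  mean. After removal of the mean a multiple of the centred function remains. With this
  normalisation the value at 0 is exactly \<open>sqrt p\<close>, and for \<open>p mod 4 = 1\<close>
  the bracket vanishes at nonresidues.\<close>

lemma pos_def_quadratic_factor:
  assumes "prime p" "p > 2"
  shows "pos_def (\<lambda>x. of_real (sqrt p / (sqrt p + 1)) * (1 + psi p x + of_real (sqrt p) * delta p x) - 1)"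
proof -
  define c where "c = sqrt p / (sqrt p + 1)"
  have sp: "sqrt p > 0" using assms by simp
  have "t / (t + 1) * (1 + 1 / t) = 1" if "t > 0" for t :: real
  proof -
    have "1 + 1 / t = (t + 1) / t" using that by (simp add: add_divide_distrib)
    thus ?thesis using that by simp
  qed
  hence "c * (1 + 1 / sqrt p) = 1" using sp unfolding c_def by blast
  moreover have "1 / sqrt p = sqrt p * (1 / p)" using sp by (simp add: field_simps)
  ultimately have "c * (1 + sqrt p * (1 / p)) = 1" by simp
  hence c: "complex_of_real c * (1 + of_real (sqrt p) * (1 / of_nat p)) = 1"
    by (metis (no_types, lifting) of_real_1 of_real_add of_real_divide of_real_mult of_real_of_nat_eq)
  have "pos_def (\<lambda>x. of_real c * (of_real (sqrt p) * (delta p x - 1 / of_nat p) + 1 * psi p x))"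
    by (rule pos_def_scale[OF pos_def_centred_delta_psi[OF assms]]) (use sp in \<open>auto simp: c_def\<close>)
  also have "(\<lambda>x. of_real c * (of_real (sqrt p) * (delta p x - 1 / of_nat p) + 1 * psi p x)) =
      (\<lambda>x. of_real c * (1 + psi p x + of_real (sqrt p) * delta p x) - 1)"
  proof
    fix x
    have "c' * (t * (d - n) + 1 * s) = c' * (1 + s + t * d) - c' * (1 + t * n)"
      for c' t d n s :: complex by (simp add: algebra_simps)
    from this[of "of_real c" "of_real (sqrt p)" "delta p x" "1 / of_nat p" "psi p x"]
    show "of_real c * (of_real (sqrt p) * (delta p x - 1 / of_nat p) + 1 * psi p x) =
        of_real c * (1 + psi p x + of_real (sqrt p) * delta p x) - 1"
      unfolding c .
  qed
  finally show ?thesis unfolding c_def .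
qed

text \<open>The hypothesis applies to \<open>a - b\<close> and to \<open>b - a\<close>. If
  \<open>a - b\<close> is a nonresidue at a prime congruent to 1 modulo 4, the factor
  \<open>H\<close> there vanishes. Otherwise both witnesses lie in \<open>K\<close>, and the one for
  \<open>b - a\<close> gives the symbol 1 at \<open>a - b\<close>, so the signs on \<open>K\<close>
  are mixed and \<open>F\<close> vanishes.\<close>

lemma card_difference_avoiding_le:
  fixes Q :: "nat set" and A :: "int set"
  defines "K \<equiv> {q \<in> Q. q mod 4 = 3}"
  assumes Q: "finite Q" "\<And>q. q \<in> Q \<Longrightarrow> prime q \<and> q > 2"
    and K: "odd (card K)" "\<And>q. q \<in> K \<Longrightarrow> y \<le> real q" "y > 0"
    and A: "finite A" "\<And>a b. a \<in> A \<Longrightarrow> b \<in> A \<Longrightarrow> a \<noteq> b \<Longrightarrow> \<exists>q\<in>Q. chi q (a - b) = -1"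
  shows "real (card A) \<le> 2 ^ (card K)\<^sup>2 * sqrt (real (\<Prod>Q) / y)"
proof (cases "A = {}")
  case True
  have "0 \<le> real (\<Prod>Q) / y" using K(3) by (intro divide_nonneg_pos) (simp_all add: prod_nonneg)
  thus ?thesis using True by simp
next
  case False
  define L where "L = {q \<in> Q. q mod 4 = 1}"
  have QKL: "Q = K \<union> L" "K \<inter> L = {}"
  proof -
    have "q mod 4 = 3 \<or> q mod 4 = 1" if "q \<in> Q" for q
    proof -
      have "odd q" using Q(2)[OF that] prime_odd_nat by auto
      thus ?thesis by presburger
    qed
    thus "Q = K \<union> L" "K \<inter> L = {}" by (auto simp: K_def L_def)
  qed
  have fin: "finite K" "finite L" using Q(1) by (auto simp: K_def L_def)
  obtain F where F: "pos_def (\<lambda>x. F x - 1)"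
     "\<And>x. (\<exists>p\<in>K. chi p x = 1) \<Longrightarrow> (\<exists>p\<in>K. chi p x = -1) \<Longrightarrow> F x = 0"
     "Re (F 0) \<le> 2 ^ (card K)\<^sup>2 * sqrt (real (\<Prod>K) / y)"
  proof -
    have "prime p \<and> p mod 4 = 3 \<and> y \<le> real p" if "p \<in> K" for p
      using that K(2)[OF that] Q(2)[of p] by (simp add: K_def)
    from exists_odd_kernel[OF fin(1) K(1) this K(3)] show ?thesis using that by blast
  qed
  define H where "H = (\<lambda>p x. of_real (sqrt p / (sqrt p + 1)) * (1 + psi p x + of_real (sqrt p) * delta p x))"
  have H: "pos_def (\<lambda>x. H p x - 1)" if "p \<in> L" for p
    unfolding H_def using pos_def_quadratic_factor Q(2) that by (simp add: L_def)
  define \<Phi> where "\<Phi> = (\<lambda>x. F x * (\<Prod>p\<in>L. H p x))"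
  have pd: "pos_def (\<lambda>x. \<Phi> x - 1)"
    unfolding \<Phi>_def by (rule pos_def_minus_one_mult[OF F(1) pos_def_minus_one_prod[OF H]])
  have zero: "\<Phi> (a - b) = 0" if ab: "a \<in> A" "b \<in> A" "a \<noteq> b" for a b
  proof (cases "\<exists>q\<in>L. chi q (a - b) = -1")
    case True
    then obtain q where q: "q \<in> L" "chi q (a - b) = -1" by blast
    hence "\<not> int q dvd (a - b)" using chi_0_iff[of q "a - b"] by auto
    hence "H q (a - b) = 0" using q by (simp add: H_def psi_def L_def delta_def)
    thus ?thesis using q fin by (auto simp: \<Phi>_def)
  next
    case False
    obtain q where q: "q \<in> Q" "chi q (a - b) = -1" using A(2)[OF ab] by blast
    obtain q' where q': "q' \<in> Q" "chi q' (b - a) = -1" using A(2)[of b a] ab by blast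
    have m: "chi q' (a - b) = (if q' mod 4 = 1 then -1 else 1)"
      using chi_minus[of q' "b - a"] Q(2)[OF q'(1)] q' by auto
    have "q \<in> K" using q False QKL(1) by blast
    moreover have "q' \<notin> L" using m False by (auto simp: L_def)
    hence "q' \<in> K" using q'(1) QKL(1) by blast
    moreover have "chi q' (a - b) = 1" using m \<open>q' \<in> K\<close> by (auto simp: K_def)
    ultimately have "F (a - b) = 0" using q(2) by (intro F(2)) blast+
    thus ?thesis by (simp add: \<Phi>_def)
  qed
  have H0: "H p 0 = of_real (sqrt p)" for p
  proof -
    have "sqrt p + 1 > 0" by (simp add: add_nonneg_pos)
    hence "sqrt p / (sqrt p + 1) * (1 + sqrt p) = sqrt p" by (simp add: field_simps)
    from arg_cong[OF this, of complex_of_real] show ?thesis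
      by (simp add: H_def psi_def delta_def chi_0_iff[of p 0, simplified])
  qed
  have "real (card A) \<le> Re (\<Phi> 0)" by (rule card_le_kernel_zero[OF A(1) pd zero False])
  also have "\<dots> = Re (F 0) * (\<Prod>p\<in>L. sqrt p)"
    by (simp add: \<Phi>_def H0 flip: of_real_prod)
  also have "\<dots> \<le> 2 ^ (card K)\<^sup>2 * sqrt (real (\<Prod>K) / y) * (\<Prod>p\<in>L. sqrt p)"
    by (intro mult_right_mono F prod_nonneg) auto
  also have "(\<Prod>p\<in>L. sqrt p) = sqrt (\<Prod>L)"
    using fin(2) by (induction L rule: finite_induct) (auto simp: real_sqrt_mult)
  also have "2 ^ (card K)\<^sup>2 * sqrt (real (\<Prod>K) / y) * sqrt (\<Prod>L) = 2 ^ (card K)\<^sup>2 * sqrt (real (\<Prod>Q) / y)"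
    using fin QKL by (simp add: prod.union_disjoint real_sqrt_mult real_sqrt_divide)
  finally show ?thesis .
qed

section \<open>From integers back to the residue ring\<close>

lemma QuadRes_mult:
  assumes "coprime m n" "QuadRes m z" "QuadRes n z"
  shows "QuadRes (m * n) z"
proof -
  obtain x y where xy: "[x\<^sup>2 = z] (mod m)" "[y\<^sup>2 = z] (mod n)" using assms by (auto simp: QuadRes_def)
  obtain w where w: "[w = x] (mod m)" "[w = y] (mod n)"
    using binary_chinese_remainder_int[OF assms(1)] by blast
  have "[w\<^sup>2 = z] (mod m)" "[w\<^sup>2 = z] (mod n)"
    using xy w by (meson cong_pow cong_trans)+
  hence "[w\<^sup>2 = z] (mod m * n)" using assms(1) by (intro coprime_cong_mult)
  thus ?thesis by (auto simp: QuadRes_def)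
qed

lemma QuadRes_of_chi: "chi q z \<noteq> -1 \<Longrightarrow> QuadRes (int q) z"
proof (cases "[z = 0] (mod int q)")
  case True
  thus ?thesis by (auto simp: QuadRes_def cong_def intro!: exI[of _ 0])
qed (simp add: chi_def Legendre_def split: if_splits)

lemma QuadRes_mult_prod:
  assumes "finite Q" "\<And>q. q \<in> Q \<Longrightarrow> prime q \<and> \<not> q dvd D \<and> QuadRes (int q) z" "QuadRes (int D) z"
  shows "QuadRes (int (D * \<Prod>Q)) z"
  using assms
proof (induction Q rule: finite_induct)
  case (insert q Q)
  have "coprime q x" if "x \<in> Q" for x
    using that insert.prems insert.hyps by (intro primes_coprime) auto
  hence "coprime q (\<Prod>Q)" by (rule prod_coprime_right)
  moreover have "coprime q D" using insert.prems by (intro prime_imp_coprime) auto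
  ultimately have "coprime q (D * \<Prod>Q)" by simp
  hence "coprime (int q) (int (D * \<Prod>Q))" by (simp only: coprime_int_iff)
  hence "QuadRes (int q * int (D * \<Prod>Q)) z"
    using insert by (intro QuadRes_mult) auto
  thus ?case using insert.hyps by (simp add: mult_ac)
qed simp

text \<open>Inside a class modulo \<open>D\<close> every difference is 0, hence a square, modulo
  \<open>D\<close>; by the Chinese remainder theorem it has to be a nonresidue at some prime of
  \<open>Q\<close>. There are \<open>D\<close> classes, and \<open>D * sqrt (\<Prod>Q)\<close> is
  \<open>sqrt m * sqrt D\<close>, whence the price of a discarded divisor.\<close>

theorem card_square_difference_free_le:
  fixes Q :: "nat set" and m D :: nat
  defines "R \<equiv> residue_ring (int m)" and "K \<equiv> {q \<in> Q. q mod 4 = 3}"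
  assumes m: "m = D * \<Prod>Q" "m > 1"
    and Q: "finite Q" "\<And>q. q \<in> Q \<Longrightarrow> prime q \<and> q > 2 \<and> \<not> q dvd D"
    and K: "odd (card K)" "\<And>q. q \<in> K \<Longrightarrow> y \<le> real q" "y > 0"
    and A: "A \<subseteq> carrier R" "difference_set R A \<inter> square_set R = {\<zero>\<^bsub>R\<^esub>}"
  shows "real (card A) \<le> real D * (2 ^ (card K)\<^sup>2 * sqrt (real (\<Prod>Q) / y))"
proof -
  interpret residues "int m" R by unfold_locales (use m(2) in \<open>auto simp: R_def\<close>)
  let ?B = "2 ^ (card K)\<^sup>2 * sqrt (real (\<Prod>Q) / y)"
  have car: "carrier R = {0..<int m}" by (auto simp: R_def residue_ring_def)
  have finA: "finite A" using A(1) by (rule finite_subset) (simp add: car)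
  define cl where "cl = (\<lambda>i. {a \<in> A. a mod int D = i})"
  have D: "D > 0" using m by (auto intro: Nat.gr0I)
  have "real (card (cl i)) \<le> ?B" for i
    unfolding K_def
  proof (rule card_difference_avoiding_le)
    fix a b assume ab: "a \<in> cl i" "b \<in> cl i" "a \<noteq> b"
    show "\<exists>q\<in>Q. chi q (a - b) = -1"
    proof (rule ccontr)
      assume "\<not> ?thesis"
      hence "QuadRes (int q) (a - b)" if "q \<in> Q" for q using that by (auto intro: QuadRes_of_chi)
      moreover have "int D dvd a - b" using ab by (simp add: cl_def flip: mod_eq_dvd_iff)
      hence "QuadRes (int D) (a - b)"
        by (auto simp: QuadRes_def cong_iff_dvd_diff dvd_diff_commute intro!: exI[of _ 0])
      ultimately have "QuadRes (int (D * \<Prod>Q)) (a - b)" using Q by (intro QuadRes_mult_prod) auto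
      then obtain x where x: "[x\<^sup>2 = a - b] (mod int m)" by (auto simp: QuadRes_def m(1))
      have in_car: "a \<in> carrier R" "b \<in> carrier R" "x mod int m \<in> carrier R"
        using ab A(1) m by (auto simp: cl_def car)
      have diff: "a \<ominus>\<^bsub>R\<^esub> b = (a - b) mod int m"
        unfolding a_minus_def by (simp add: res_neg_eq res_add_eq mod_simps)
      have "(x mod int m) [^]\<^bsub>R\<^esub> (2::nat) = x\<^sup>2 mod int m" by (rule pow_cong)
      also have "\<dots> = (a - b) mod int m" using x by (simp add: cong_def)
      finally have "a \<ominus>\<^bsub>R\<^esub> b = (x mod int m) [^]\<^bsub>R\<^esub> (2::nat)" unfolding diff by (rule sym)
      hence "a \<ominus>\<^bsub>R\<^esub> b \<in> square_set R" unfolding square_set_def using in_car(3) by blast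
      moreover have "a \<ominus>\<^bsub>R\<^esub> b \<in> difference_set R A" using ab by (auto simp: difference_set_def cl_def)
      ultimately have "a \<ominus>\<^bsub>R\<^esub> b = \<zero>\<^bsub>R\<^esub>" using A(2) by blast
      hence "a mod int m = b mod int m" using diff by (simp add: res_zero_eq mod_eq_dvd_iff dvd_eq_mod_eq_0)
      thus False using ab(3) in_car by (simp add: car)
    qed
  qed (use Q K finA in \<open>auto simp: K_def cl_def\<close>)
  hence "(\<Sum>i\<in>{0..<int D}. real (card (cl i))) \<le> (\<Sum>i\<in>{0..<int D}. ?B)" by (intro sum_mono)
  moreover have "card A \<le> (\<Sum>i\<in>{0..<int D}. card (cl i))"
  proof -
    have "A \<subseteq> (\<Union>i\<in>{0..<int D}. cl i)" using D by (auto simp: cl_def)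
    hence "card A \<le> card (\<Union>i\<in>{0..<int D}. cl i)" using finA by (intro card_mono) (auto simp: cl_def)
    also have "\<dots> \<le> (\<Sum>i\<in>{0..<int D}. card (cl i))" by (rule card_UN_le) simp
    finally show ?thesis .
  qed
  hence "real (card A) \<le> (\<Sum>i\<in>{0..<int D}. real (card (cl i)))"
    by (metis of_nat_mono of_nat_sum)
  ultimately show ?thesis by simp
qed

section \<open>Mertens' theorem for primes congruent to 3 modulo 4\<close>

lemma sum_divisors_swap:
  "(\<Sum>k\<in>{1..n}. \<Sum>d | d dvd k. h d k) = (\<Sum>d\<in>{1..n}. \<Sum>j\<in>{1..n div d}. h d (d * j :: nat))"
proof -
  have "(\<Sum>k\<in>{1..n}. \<Sum>d | d dvd k. h d k) = (\<Sum>(k, d)\<in>(SIGMA k:{1..n}. {d. d dvd k}). h d k)"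
    by (rule sum.Sigma) (auto intro: finite_divisors_nat)
  also have "\<dots> = (\<Sum>(d, j)\<in>(SIGMA d:{1..n}. {1..n div d}). h d (d * j))"
  proof -
    have to: "d \<ge> 1 \<and> d \<le> n \<and> k div d \<ge> 1 \<and> k div d \<le> n div d"
      if kd: "k \<ge> 1" "k \<le> n" "d dvd k" for k d
    proof -
      have "d > 0" "d \<le> k" using kd by (auto intro: dvd_imp_le dvd_pos_nat)
      thus ?thesis using kd by (simp add: div_le_mono Suc_le_eq div_greater_zero_iff)
    qed
    have bk: "d * j \<ge> 1 \<and> d * j \<le> n" if "d \<ge> 1" "j \<ge> 1" "j \<le> n div d" for d j
    proof -
      have "d * j \<le> d * (n div d)" using that by simp
      also have "\<dots> \<le> n" by (rule times_div_less_eq_dividend)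
      finally show ?thesis using that by simp
    qed
    let ?S = "SIGMA k:{1..n}. {d. d dvd k}" and ?T = "SIGMA d:{1..n}. {1..n div d}"
    show ?thesis
    proof (rule sum.reindex_bij_witness[of _ "\<lambda>(d, j). (d * j, d)" "\<lambda>(k, d). (d, k div d)"])
      fix a assume "a \<in> ?S"
      then obtain k d where a: "a = (k, d)" "k \<ge> 1" "k \<le> n" "d dvd k" by auto
      show "(case case a of (k, d) \<Rightarrow> (d, k div d) of (d, j) \<Rightarrow> (d * j, d)) = a" using a by simp
      show "(case a of (k, d) \<Rightarrow> (d, k div d)) \<in> ?T" using a to[OF a(2-4)] by simp
      show "(case case a of (k, d) \<Rightarrow> (d, k div d) of (d, j) \<Rightarrow> h d (d * j)) = (case a of (k, d) \<Rightarrow> h d k)"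
        using a by simp
    next
      fix b assume "b \<in> ?T"
      then obtain d j where b: "b = (d, j)" "d \<ge> 1" "d \<le> n" "j \<ge> 1" "j \<le> n div d" by auto
      show "(case case b of (d, j) \<Rightarrow> (d * j, d) of (k, d) \<Rightarrow> (d, k div d)) = b" using b by simp
      show "(case b of (d, j) \<Rightarrow> (d * j, d)) \<in> ?S" using b bk[OF b(2,4,5)] by simp
    qed
  qed
  also have "\<dots> = (\<Sum>d\<in>{1..n}. \<Sum>j\<in>{1..n div d}. h d (d * j))"
    by (rule sum.Sigma[symmetric]) auto
  finally show ?thesis .
qed

section \<open>Estimates of Chebyshev and Mertens for all primes\<close>

definition sum_ln :: "nat \<Rightarrow> real" where "sum_ln n = (\<Sum>k\<in>{1..n}. ln (real k))"

text \<open>Chebyshev's function psi; its companion \<open>sum_ln n\<close> is the logarithm of n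
  factorial.\<close>

definition psi_sum :: "nat \<Rightarrow> real" where "psi_sum n = (\<Sum>d\<in>{1..n}. mangoldt d)"

lemma ln_Suc_le: "n \<ge> 1 \<Longrightarrow> ln (real (Suc n)) \<le> ln (real n) + 1 / real n"
proof -
  assume n: "n \<ge> 1"
  have e: "real (Suc n) = real n * (1 + 1 / real n)" using n by (simp add: field_simps)
  have "0 < 1 + 1 / real n" by (simp add: add_pos_nonneg)
  hence "ln (real (Suc n)) = ln (real n) + ln (1 + 1 / real n)"
    unfolding e using n by (intro ln_mult_pos) auto
  thus ?thesis using ln_add_one_self_le_self[of "1 / real n"] n by simp
qed

lemma sum_ln_le: "sum_ln n \<le> n * ln n"
proof -
  have "sum_ln n \<le> (\<Sum>k\<in>{1..n}. ln (real n))" unfolding sum_ln_def by (intro sum_mono) auto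
  thus ?thesis by simp
qed

lemma sum_ln_ge: "sum_ln n \<ge> n * ln n - n"
proof (induction n)
  case (Suc n)
  show ?case
  proof (cases "n = 0")
    case False
    have "n * ln (real (Suc n)) \<le> n * (ln n + 1 / n)" using ln_Suc_le[of n] False by (intro mult_left_mono) auto
    also have "\<dots> = n * ln n + 1" using False by (simp add: distrib_left)
    finally show ?thesis using Suc by (simp add: sum_ln_def algebra_simps)
  qed (simp add: sum_ln_def)
qed (simp add: sum_ln_def)

lemma sum_ln_eq_mangoldt: "sum_ln n = (\<Sum>d\<in>{1..n}. mangoldt d * real (n div d))"
proof -
  have "sum_ln n = (\<Sum>k\<in>{1..n}. \<Sum>d | d dvd k. mangoldt d)"
    unfolding sum_ln_def by (intro sum.cong refl) (simp add: mangoldt_sum)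
  also have "\<dots> = (\<Sum>d\<in>{1..n}. \<Sum>j\<in>{1..n div d}. mangoldt d)" by (rule sum_divisors_swap)
  finally show ?thesis by (simp add: mult.commute)
qed

text \<open>Chebyshev's argument with n! / (h!)^2 for \<open>h = n div 2\<close>: in its logarithm
  \<open>mangoldt d\<close> has the coefficient \<open>n div d - 2 * (h div d)\<close>, which is
  nonnegative and equals 1 for \<open>d\<close> in \<open>{h<..n}\<close>. So passing from
  \<open>h\<close> to \<open>n\<close> adds at most 4n, and repeated halving sums to 8n.\<close>

lemma psi_sum_le: "psi_sum n \<le> 8 * n"
proof (induction n rule: less_induct)
  case (less n)
  define h where "h = n div 2"
  show ?case
  proof (cases "n \<le> 1")
    case True
    hence "n = 0 \<or> n = 1" by auto
    thus ?thesis by (auto simp: psi_sum_def)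
  next
    case False
    hence h: "h \<ge> 1" "h < n" "2 * h \<le> n" "n \<le> 2 * h + 1" by (auto simp: h_def)
    have "sum_ln h = (\<Sum>d\<in>{1..n}. mangoldt d * real (h div d))"
      unfolding sum_ln_eq_mangoldt using h by (intro sum.mono_neutral_left) auto
    hence "sum_ln n - 2 * sum_ln h = (\<Sum>d\<in>{1..n}. mangoldt d * (real (n div d) - 2 * real (h div d)))"
      by (simp add: sum_ln_eq_mangoldt[of n] sum_subtractf sum_distrib_left algebra_simps)
    also have "\<dots> \<ge> (\<Sum>d\<in>{h<..n}. mangoldt d * (real (n div d) - 2 * real (h div d)))"
    proof (rule sum_mono2)
      fix d assume "d \<in> {1..n} - {h<..n}"
      hence "d > 0" by auto
      have "2 * (h div d) \<le> n div d"
        using h(3) \<open>d > 0\<close> by (metis div_mult2_eq div_le_mono h_def mult.commute div_times_less_eq_dividend le_trans times_div_less_eq_dividend)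
      hence "real (2 * (h div d)) \<le> real (n div d)" by (rule of_nat_mono)
      thus "0 \<le> mangoldt d * (real (n div d) - 2 * real (h div d))" by (intro mult_nonneg_nonneg mangoldt_nonneg) auto
    qed auto
    also have "(\<Sum>d\<in>{h<..n}. mangoldt d * (real (n div d) - 2 * real (h div d))) = (\<Sum>d\<in>{h<..n}. mangoldt d)"
    proof (intro sum.cong refl)
      fix d assume "d \<in> {h<..n}"
      hence "n div d = 1" "h div d = 0" using h by (auto intro!: div_nat_eqI)
      thus "mangoldt d * (real (n div d) - 2 * real (h div d)) = mangoldt d" by simp
    qed
    also have "\<dots> = psi_sum n - psi_sum h"
    proof -
      have "{1..n} = {1..h} \<union> {h<..n}" using h by auto
      hence "psi_sum n = psi_sum h + (\<Sum>d\<in>{h<..n}. mangoldt d)"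
        unfolding psi_sum_def by (simp only:) (rule sum.union_disjoint, auto)
      thus ?thesis by simp
    qed
    finally have "psi_sum n \<le> psi_sum h + (sum_ln n - 2 * sum_ln h)" by simp
    also have "sum_ln n - 2 * sum_ln h \<le> n * ln n - 2 * (real h * ln h - real h)"
      using sum_ln_le[of n] sum_ln_ge[of h] by simp
    also have "\<dots> = (real n - 2 * real h) * ln n + 2 * real h * (ln n - ln h) + 2 * real h"
      by (simp add: algebra_simps)
    also have "\<dots> \<le> 1 * ln n + 2 * real h * 2 + 2 * real h"
    proof -
      have "(real n - 2 * real h) * ln n \<le> 1 * ln n" using h by (intro mult_right_mono) auto
      moreover have "ln (real n) - ln (real h) \<le> 2"
      proof -
        have "ln (real n) \<le> ln (3 * real h)" using h by (subst ln_le_cancel_iff) linarith+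
        also have "\<dots> = ln 3 + ln (real h)" using h by (simp add: ln_mult)
        finally show ?thesis using ln_le_minus_one[of "3::real"] by linarith
      qed
      hence "2 * real h * (ln n - ln h) \<le> 2 * real h * 2" by (intro mult_left_mono) auto
      ultimately show ?thesis by linarith
    qed
    also have "\<dots> \<le> 4 * n" using ln_le_minus_one[of "real n"] h by linarith
    finally have "psi_sum n \<le> psi_sum h + 4 * n" by simp
    moreover have "psi_sum h \<le> 8 * h" using less h by simp
    ultimately show ?thesis using h(3) by linarith
  qed
qed

lemma real_div_le_nat_div_plus_one:
  assumes "d > 0"
  shows "real n / real d \<le> real (n div d) + 1"
proof -
  have "n \<le> d * (n div d + 1)"
    using assms dividend_less_times_div[of d n] by (simp add: algebra_simps)
  hence "real n \<le> real (d * (n div d + 1))" by (rule of_nat_mono)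
  thus ?thesis using assms by (simp add: pos_divide_le_eq algebra_simps)
qed

text \<open>Replacing \<open>n div d\<close> by \<open>n / d\<close> in the expansion of
  \<open>sum_ln n\<close> changes it by at most \<open>psi_sum n\<close>, which is of order
  \<open>n\<close>.\<close>

lemma mangoldt_over_n_sum:
  assumes "n \<ge> 1"
  shows "\<bar>(\<Sum>d\<in>{1..n}. mangoldt d / d) - ln n\<bar> \<le> 8"
proof -
  let ?M = "\<Sum>d\<in>{1..n}. mangoldt d / d :: real"
  have "sum_ln n \<le> (\<Sum>d\<in>{1..n}. mangoldt d * (real n / d))"
    unfolding sum_ln_eq_mangoldt by (intro sum_mono mult_left_mono mangoldt_nonneg) (rule of_nat_div_le_of_nat)
  also have "\<dots> = n * ?M" by (simp add: sum_distrib_left mult_ac)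
  finally have "n * (ln n - 1) \<le> n * ?M" using sum_ln_ge[of n] by (simp add: algebra_simps)
  hence lo: "ln n - 1 \<le> ?M" using assms by simp
  have "n * ?M - psi_sum n = (\<Sum>d\<in>{1..n}. mangoldt d * (real n / d - 1))"
    by (simp add: psi_sum_def sum_distrib_left sum_subtractf algebra_simps)
  also have "\<dots> \<le> sum_ln n"
    unfolding sum_ln_eq_mangoldt
  proof (intro sum_mono mult_left_mono mangoldt_nonneg)
    fix d assume "d \<in> {1..n}"
    thus "real n / real d - 1 \<le> real (n div d)"
      using real_div_le_nat_div_plus_one[of d n] by simp
  qed
  also have "\<dots> \<le> n * ln n" by (rule sum_ln_le)
  finally have "n * ?M \<le> n * (ln n + 8)" using psi_sum_le[of n] by (simp add: algebra_simps)
  hence "?M \<le> ln n + 8" using assms by simp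
  thus ?thesis using lo by linarith
qed

section \<open>The nonprincipal character modulo 4\<close>

definition chi4 :: "nat \<Rightarrow> real" where
  "chi4 n = (if n mod 4 = 1 then 1 else if n mod 4 = 3 then -1 else 0)"

lemma chi4_mult: "chi4 (a * b) = chi4 a * chi4 b"
proof -
  have m: "(a * b) mod 4 = ((a mod 4) * (b mod 4)) mod 4" by (simp add: mod_mult_eq)
  have "a mod 4 \<in> {0, 1, 2, 3}" "b mod 4 \<in> {0, 1, 2, 3}" by auto
  thus ?thesis unfolding chi4_def m by auto
qed

lemma abs_chi4_le: "\<bar>chi4 n\<bar> \<le> 1"
  by (simp add: chi4_def)

lemma abs_sum_chi4_le: "\<bar>\<Sum>k\<le>n. chi4 (a + k)\<bar> \<le> 1"
proof -
  have P: "(\<Sum>k<m. chi4 k) = (if m mod 4 = 2 \<or> m mod 4 = 3 then 1 else 0)" for m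
  proof (induction m)
    case (Suc m)
    have "m mod 4 = 0 \<and> Suc m mod 4 = 1 \<or> m mod 4 = 1 \<and> Suc m mod 4 = 2 \<or>
        m mod 4 = 2 \<and> Suc m mod 4 = 3 \<or> m mod 4 = 3 \<and> Suc m mod 4 = 0" by presburger
    thus ?case using Suc by (auto simp: chi4_def)
  qed simp
  have "(\<Sum>k\<le>n. chi4 (a + k)) = (\<Sum>k<a + Suc n. chi4 k) - (\<Sum>k<a. chi4 k)"
    by (induction n) (auto simp: algebra_simps)
  thus ?thesis unfolding P by auto
qed

text \<open>Summation by parts: monotonicity makes the differences \<open>f k - f (Suc k)\<close>
  nonnegative, so together with \<open>f n\<close> they telescope to \<open>f 0\<close>.\<close>

lemma abel_bound:
  fixes c f :: "nat \<Rightarrow> real"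
  assumes c: "\<And>n. \<bar>\<Sum>k\<le>n. c k\<bar> \<le> 1" and f: "\<And>n. f (Suc n) \<le> f n" "\<And>n. 0 \<le> f n"
  shows "\<bar>\<Sum>k\<le>n. c k * f k\<bar> \<le> f 0"
proof -
  define S where "S = (\<lambda>n. \<Sum>k\<le>n. c k)"
  have "(\<Sum>k\<le>n. c k * f k) = S n * f n + (\<Sum>k<n. S k * (f k - f (Suc k)))"
    by (induction n) (auto simp: S_def algebra_simps)
  also have "\<bar>\<dots>\<bar> \<le> \<bar>S n * f n\<bar> + (\<Sum>k<n. \<bar>S k * (f k - f (Suc k))\<bar>)"
    by (rule order.trans[OF abs_triangle_ineq add_left_mono[OF sum_abs]])
  also have "\<dots> \<le> 1 * f n + (\<Sum>k<n. 1 * (f k - f (Suc k)))"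
  proof (intro add_mono sum_mono)
    show "\<bar>S n * f n\<bar> \<le> 1 * f n" unfolding abs_mult using c f by (intro mult_mono) (auto simp: S_def)
    show "\<bar>S k * (f k - f (Suc k))\<bar> \<le> 1 * (f k - f (Suc k))" for k
      unfolding abs_mult using c f(1)[of k] by (intro mult_mono) (auto simp: S_def)
  qed
  also have "\<dots> = f 0" by (simp add: sum_lessThan_telescope')
  finally show ?thesis .
qed

lemma abs_sum_chi4_weighted_le:
  fixes f :: "nat \<Rightarrow> real"
  assumes "\<And>k. k \<ge> a \<Longrightarrow> f (Suc k) \<le> f k" "\<And>k. k \<ge> a \<Longrightarrow> 0 \<le> f k"
  shows "\<bar>\<Sum>k\<in>{a..b}. chi4 k * f k\<bar> \<le> f a"
proof (cases "a \<le> b")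
  case True
  have "(\<Sum>k\<in>{a..b}. chi4 k * f k) = (\<Sum>k\<le>b - a. chi4 (a + k) * f (a + k))"
    using True by (intro sum.reindex_bij_witness[of _ "\<lambda>k. a + k" "\<lambda>k. k - a"]) auto
  thus ?thesis
    using abel_bound[of "\<lambda>k. chi4 (a + k)" "\<lambda>k. f (a + k)" "b - a"] assms abs_sum_chi4_le by simp
qed (use assms in auto)

text \<open>Partial sums of the series 1 - 1/3 + 1/5 - ..., the value at 1 of the L-function of
  \<open>chi4\<close>.\<close>

definition L4_partial :: "nat \<Rightarrow> real" where "L4_partial n = (\<Sum>k\<in>{1..n}. chi4 k / k)"

lemma L4_partial_diff: "n \<le> m \<Longrightarrow> \<bar>L4_partial m - L4_partial n\<bar> \<le> 1 / (real n + 1)"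
proof -
  assume "n \<le> m"
  hence "{1..m} = {1..n} \<union> {Suc n..m}" by auto
  hence "L4_partial m = L4_partial n + (\<Sum>k\<in>{Suc n..m}. chi4 k / k)"
    unfolding L4_partial_def by (simp only:) (rule sum.union_disjoint, auto)
  hence "L4_partial m - L4_partial n = (\<Sum>k\<in>{Suc n..m}. chi4 k * (1 / k))" by simp
  also have "\<bar>\<dots>\<bar> \<le> 1 / real (Suc n)"
    by (rule abs_sum_chi4_weighted_le) (auto simp: frac_le)
  finally show ?thesis by (simp add: add.commute)
qed

text \<open>The lower bound is the nonvanishing of the L-function at 1. For this character it is
  immediate: the first partial sum is 1 and the remainder after it is at most 1/2.\<close>

lemma L4_limit: "\<exists>L\<ge>1/2. \<forall>n. \<bar>L4_partial n - L\<bar> \<le> 1 / (real n + 1)"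
proof -
  have "Cauchy L4_partial"
  proof (rule CauchyI')
    fix e :: real assume "e > 0"
    then obtain M :: nat where M: "1 / (real M + 1) < e"
      by (metis add.commute nat_approx_posE of_nat_Suc)
    show "\<exists>M. \<forall>m\<ge>M. \<forall>n>m. dist (L4_partial m) (L4_partial n) < e"
    proof (intro exI[of _ M] allI impI)
      fix m n assume mn: "m \<ge> M" "n > m"
      have "\<bar>L4_partial n - L4_partial m\<bar> \<le> 1 / (real m + 1)" using mn by (intro L4_partial_diff) auto
      also have "\<dots> \<le> 1 / (real M + 1)" using mn by (intro divide_left_mono) auto
      finally show "dist (L4_partial m) (L4_partial n) < e" using M by (simp add: dist_real_def abs_minus_commute)
    qed
  qed
  then obtain L where L: "L4_partial \<longlonglongrightarrow> L" using Cauchy_convergent convergent_def by blast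
  have bd: "\<bar>L4_partial n - L\<bar> \<le> 1 / (real n + 1)" for n
  proof -
    have "(\<lambda>m. \<bar>L4_partial m - L4_partial n\<bar>) \<longlonglongrightarrow> \<bar>L - L4_partial n\<bar>"
      by (intro tendsto_intros L)
    hence "\<bar>L - L4_partial n\<bar> \<le> 1 / (real n + 1)"
      by (rule Lim_bounded) (use L4_partial_diff in blast)
    thus ?thesis by (simp add: abs_minus_commute)
  qed
  moreover have "L4_partial 1 = 1" by (simp add: L4_partial_def chi4_def)
  hence "\<bar>1 - L\<bar> \<le> 1/2" using bd[of 1] by simp
  hence "L \<ge> 1/2" by linarith
  ultimately show ?thesis by blast
qed

text \<open>The sum \<open>W\<close> of \<open>chi4 k * ln k / k\<close> is bounded by partial
  summation. Writing \<open>ln\<close> as a divisor sum of \<open>mangoldt\<close> turns it into a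
  sum over \<open>d\<close> with the factor \<open>L4_partial (n div d)\<close>. Replacing that
  factor by its limit \<open>L\<close> costs at most \<open>d / n\<close> for each \<open>d\<close>,
  in total \<open>psi_sum n / n\<close>, at most 8. Hence \<open>L\<close> times the wanted sum is
  at most 9, and \<open>L\<close> is not 0.\<close>

lemma chi4_mangoldt_sum_bounded: "\<exists>C. \<forall>n\<ge>1. \<bar>\<Sum>d\<in>{1..n}. chi4 d * (mangoldt d / d)\<bar> \<le> C"
proof -
  obtain L where L: "L \<ge> 1/2" "\<And>n. \<bar>L4_partial n - L\<bar> \<le> 1 / (real n + 1)" using L4_limit by blast
  have "\<bar>\<Sum>d\<in>{1..n}. chi4 d * (mangoldt d / d)\<bar> \<le> 9 / L" if n: "n \<ge> 1" for n
  proof -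
    define X where "X = (\<Sum>d\<in>{1..n}. chi4 d * (mangoldt d / real d))"
    define W where "W = (\<Sum>k\<in>{1..n}. chi4 k * (ln (real k) / k))"
    have "\<bar>W\<bar> \<le> 1"
    proof -
      \<comment> \<open>\<open>ln k / k\<close> decreases only beyond e, so the sum has to start at
        3; the two omitted terms vanish because \<open>ln 1\<close> and \<open>chi4 2\<close> are
        0.\<close>
      have "W = (\<Sum>k\<in>{3..n}. chi4 k * (ln (real k) / k))"
        unfolding W_def
      proof (rule sum.mono_neutral_right)
        show "\<forall>k\<in>{1..n} - {3..n}. chi4 k * (ln (real k) / real k) = 0"
        proof
          fix k assume "k \<in> {1..n} - {3..n}"
          hence "k = 1 \<or> k = 2" by auto
          thus "chi4 k * (ln (real k) / real k) = 0" by (auto simp: chi4_def)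
        qed
      qed auto
      also have "\<bar>\<dots>\<bar> \<le> ln (real 3) / real 3"
      proof (rule abs_sum_chi4_weighted_le)
        fix k :: nat assume k: "k \<ge> 3"
        have "exp 1 \<le> real k" using k exp_le by linarith
        hence "1 \<le> ln (real k)" using k by (subst ln_ge_iff) auto
        hence "k * ln (real (Suc k)) \<le> (real k + 1) * ln (real k)"
          using mult_left_mono[OF ln_Suc_le[of k], of "real k"] k by (simp add: algebra_simps)
        thus "ln (real (Suc k)) / real (Suc k) \<le> ln (real k) / real k"
          using k by (simp add: divide_simps mult.commute add.commute)
        show "0 \<le> ln (real k) / real k" using k by simp
      qed
      also have "\<dots> \<le> 1" using ln_le_minus_one[of "3::real"] by simp
      finally show ?thesis .
    qed
    have "W = (\<Sum>k\<in>{1..n}. \<Sum>d | d dvd k. chi4 k / k * mangoldt d)"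
      unfolding W_def
    proof (intro sum.cong refl)
      fix k assume "k \<in> {1..n}"
      hence "(\<Sum>d | d dvd k. mangoldt d) = ln (real k)" using mangoldt_sum[of k, where 'a = real] by simp
      moreover have "(\<Sum>d | d dvd k. chi4 k / k * mangoldt d) = chi4 k / k * (\<Sum>d | d dvd k. mangoldt d)"
        by (rule sum_distrib_left[symmetric])
      ultimately show "chi4 k * (ln (real k) / real k) = (\<Sum>d | d dvd k. chi4 k / k * mangoldt d)"
        by simp
    qed
    also have "\<dots> = (\<Sum>d\<in>{1..n}. \<Sum>j\<in>{1..n div d}. chi4 (d * j) / real (d * j) * mangoldt d)"
      by (rule sum_divisors_swap)
    also have "\<dots> = (\<Sum>d\<in>{1..n}. chi4 d * (mangoldt d / d) * L4_partial (n div d))"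
      by (simp add: L4_partial_def chi4_mult sum_distrib_left mult_ac)
    finally have W: "W = (\<Sum>d\<in>{1..n}. chi4 d * (mangoldt d / d) * L4_partial (n div d))" .
    have "W - L * X = (\<Sum>d\<in>{1..n}. chi4 d * (mangoldt d / d) * (L4_partial (n div d) - L))"
      unfolding W X_def sum_distrib_left sum_subtractf[symmetric]
      by (intro sum.cong refl) (simp only: right_diff_distrib mult_ac)
    hence "\<bar>W - L * X\<bar> = \<bar>\<Sum>d\<in>{1..n}. chi4 d * (mangoldt d / d) * (L4_partial (n div d) - L)\<bar>"
      by simp
    also have "\<dots> \<le> (\<Sum>d\<in>{1..n}. \<bar>chi4 d * (mangoldt d / d) * (L4_partial (n div d) - L)\<bar>)"
      by (rule sum_abs)
    also have "\<dots> \<le> (\<Sum>d\<in>{1..n}. mangoldt d / n)"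
    proof (rule sum_mono)
      fix d assume d: "d \<in> {1..n}"
      have "\<bar>L4_partial (n div d) - L\<bar> \<le> 1 / (real (n div d) + 1)" by (rule L)
      also have "\<dots> \<le> d / n"
      proof -
        have "real n / d \<le> real (n div d) + 1" using real_div_le_nat_div_plus_one[of d n] d by simp
        hence "real n \<le> d * (real (n div d) + 1)" using d by (simp add: divide_simps mult.commute)
        thus ?thesis using d by (simp add: divide_simps mult.commute)
      qed
      finally have "\<bar>L4_partial (n div d) - L\<bar> \<le> d / n" .
      hence "\<bar>chi4 d\<bar> * (mangoldt d / d) * \<bar>L4_partial (n div d) - L\<bar> \<le> 1 * (mangoldt d / d) * (d / n)"
        using abs_chi4_le[of d] mangoldt_nonneg[of d] by (intro mult_mono) auto
      also have "\<dots> = mangoldt d / n" using d by simp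
      finally show "\<bar>chi4 d * (mangoldt d / d) * (L4_partial (n div d) - L)\<bar> \<le> mangoldt d / n"
        by (simp add: abs_mult)
    qed
    also have "\<dots> = psi_sum n / n" by (simp add: psi_sum_def sum_divide_distrib)
    also have "\<dots> \<le> 8" using psi_sum_le[of n] n by (simp add: divide_simps)
    finally have "\<bar>L * X\<bar> \<le> 9" using \<open>\<bar>W\<bar> \<le> 1\<close> by linarith
    hence "L * \<bar>X\<bar> \<le> 9" using L(1) by (simp add: abs_mult)
    hence "\<bar>X\<bar> \<le> 9 / L" using L(1) by (simp add: field_simps)
    thus ?thesis unfolding X_def .
  qed
  thus ?thesis by blast
qed

lemma sum_ln_over_square_le: "(\<Sum>k\<in>{2..n}. ln (real k) / (real k)\<^sup>2) \<le> 2"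
proof -
  \<comment> \<open>The remainder \<open>(ln n + 2) / n\<close> is the tail integral
    \<open>(ln n + 1) / n\<close> of \<open>ln x / x^2\<close> plus \<open>1 / n\<close>, which
    absorbs the discretisation; at \<open>n = 1\<close> the bound is 0.\<close>
  have "n \<ge> 1 \<Longrightarrow> (\<Sum>k\<in>{2..n}. ln (real k) / (real k)\<^sup>2) \<le> 2 - (ln n + 2) / n" for n :: nat
  proof (induction n rule: dec_induct)
    case (step n)
    have "real n * ln (real (Suc n)) \<le> n * ln n + 1"
      using mult_left_mono[OF ln_Suc_le[of n], of "real n"] step(1) by (simp add: algebra_simps)
    hence "(ln n + 1) / (real n * real (Suc n)) \<le> ((real n + 1) * (ln n + 2) - n * (ln (Suc n) + 2)) / (real n * real (Suc n))"
      using step(1) by (intro divide_right_mono) (simp_all add: algebra_simps)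
    also have "\<dots> = (ln n + 2) / n - (ln (Suc n) + 2) / Suc n"
      using step(1) by (simp add: field_simps)
    finally have A: "(ln n + 1) / (real n * real (Suc n)) \<le> (ln n + 2) / n - (ln (Suc n) + 2) / Suc n" .
    have "1 / real n \<le> 1" using step(1) by simp
    hence "ln (real (Suc n)) \<le> ln n + 1" using ln_Suc_le[OF step(1)] by linarith
    hence "ln (real (Suc n)) / (real (Suc n))\<^sup>2 \<le> (ln n + 1) / (real n * real (Suc n))"
      using step(1) by (intro frac_le) (auto simp: power2_eq_square)
    hence "(\<Sum>k\<in>{2..n}. ln (real k) / (real k)\<^sup>2) + ln (real (Suc n)) / (real (Suc n))\<^sup>2 \<le>
        2 - (ln (Suc n) + 2) / Suc n" using A step(3) by linarith
    moreover have "{2..Suc n} = insert (Suc n) {2..n}" using step(1) by auto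
    ultimately show ?case by simp
  qed simp
  note bound = this
  show ?thesis
  proof (cases "n \<ge> 1")
    case True
    have "(ln n + 2) / real n \<ge> 0" using True by (simp add: add_nonneg_nonneg)
    thus ?thesis using bound[OF True] by linarith
  qed auto
qed

text \<open>For each prime the exponents from 2 on form a geometric series of sum at most
  \<open>2 * ln p / p^2\<close>, since \<open>1 / p\<close> is at most 1/2.\<close>

lemma sum_proper_prime_powers_le:
  "(\<Sum>d | d \<in> {1..n} \<and> \<not> prime d. mangoldt d / d) \<le> (4 :: real)"
proof -
  let ?N = "{d \<in> {1..n}. primepow d \<and> \<not> prime d}"
  let ?I = "SIGMA p:{p \<in> {2..n}. prime p}. {2..n}"
  have geo: "(\<Sum>k\<in>{2..m}. x ^ k) \<le> 2 * x\<^sup>2" if "0 \<le> x" "x \<le> 1/2" for x :: real and m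
  proof -
    have "m \<ge> 1 \<Longrightarrow> (\<Sum>k\<in>{2..m}. x ^ k) + 2 * x ^ Suc m \<le> 2 * x\<^sup>2"
    proof (induction m rule: dec_induct)
      case (step m)
      have "x ^ Suc m * (2 * x) \<le> x ^ Suc m * 1" using that by (intro mult_left_mono) auto
      hence "2 * x ^ Suc (Suc m) \<le> x ^ Suc m" by (simp add: mult_ac)
      moreover have "{2..Suc m} = insert (Suc m) {2..m}" using step(1) by auto
      hence "(\<Sum>k\<in>{2..Suc m}. x ^ k) = (\<Sum>k\<in>{2..m}. x ^ k) + x ^ Suc m" by simp
      ultimately show ?case using step(3) by linarith
    qed (simp add: power2_eq_square)
    moreover have "0 \<le> x ^ Suc m" using that by simp
    ultimately have "m \<ge> 1 \<Longrightarrow> ?thesis" by linarith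
    thus ?thesis by (cases "m \<ge> 1") auto
  qed
  have "(\<Sum>d | d \<in> {1..n} \<and> \<not> prime d. mangoldt d / d) = (\<Sum>d\<in>?N. mangoldt d / d :: real)"
    by (rule sum.mono_neutral_right) (auto simp: mangoldt_def)
  also have "\<dots> \<le> (\<Sum>d\<in>(\<lambda>(p, k). p ^ k) ` ?I. mangoldt d / d)"
  proof (rule sum_mono2)
    show "?N \<subseteq> (\<lambda>(p, k). p ^ k) ` ?I"
    proof
      fix d assume d: "d \<in> ?N"
      then obtain p k where pk: "prime p" "k > 0" "d = p ^ k" by (auto simp: primepow_def)
      have k: "k \<ge> 2" using d pk by (cases "k = 1") auto
      have "k < 2 ^ k" by (rule less_exp)
      also have "2 ^ k \<le> p ^ k" using pk prime_ge_2_nat by (intro power_mono) auto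
      also have "\<dots> \<le> n" using d pk by simp
      finally have "k \<le> n" by simp
      moreover have "p \<le> n" using d pk self_le_power[of p k] prime_ge_1_nat[of p] by simp
      ultimately show "d \<in> (\<lambda>(p, k). p ^ k) ` ?I"
        using k pk prime_ge_2_nat[of p] by (intro image_eqI[of _ _ "(p, k)"]) auto
    qed
  qed (auto simp: mangoldt_nonneg)
  also have "\<dots> \<le> (\<Sum>x\<in>?I. ((\<lambda>d. mangoldt d / d) \<circ> (\<lambda>(p, k). p ^ k)) x)"
    by (rule sum_image_le) (auto simp: mangoldt_nonneg)
  also have "\<dots> = (\<Sum>p | p \<in> {2..n} \<and> prime p. \<Sum>k\<in>{2..n}. ln (real p) * (1 / real p) ^ k)"
    by (subst sum.Sigma) (auto intro!: sum.cong simp: power_one_over divide_inverse power_inverse)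
  also have "\<dots> \<le> (\<Sum>p | p \<in> {2..n} \<and> prime p. ln (real p) * (2 * (1 / real p)\<^sup>2))"
    unfolding sum_distrib_left[symmetric]
  proof (intro sum_mono mult_left_mono geo)
    fix p assume "p \<in> {p. p \<in> {2..n} \<and> prime p}"
    thus "1 / real p \<le> 1 / 2" "0 \<le> ln (real p)" by auto
  qed auto
  also have "\<dots> \<le> (\<Sum>p\<in>{2..n}. ln (real p) * (2 * (1 / real p)\<^sup>2))"
    by (rule sum_mono2) auto
  also have "\<dots> = 2 * (\<Sum>k\<in>{2..n}. ln (real k) / (real k)\<^sup>2)"
    by (simp add: sum_distrib_left power_one_over divide_inverse power_inverse mult_ac)
  also have "\<dots> \<le> 4" using sum_ln_over_square_le[of n] by simp
  finally show ?thesis .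
qed

definition primes3 :: "real \<Rightarrow> real \<Rightarrow> nat set" where
  "primes3 u v = {p. prime p \<and> p mod 4 = 3 \<and> u < real p \<and> real p \<le> v}"

lemma finite_primes3 [simp]: "finite (primes3 u v)"
proof (rule finite_subset)
  show "primes3 u v \<subseteq> {..nat \<lfloor>v\<rfloor>}" by (auto simp: primes3_def le_nat_floor)
qed simp

text \<open>On odd numbers \<open>(1 - chi4 d) / 2\<close> is the indicator of the class 3 modulo 4.
  The difference of the full sum and the twisted sum is therefore twice the wanted one, up to the
  term of the prime 2, and the errors 12, \<open>C + 4\<close> and 1 add up to
  \<open>C + 17\<close>.\<close>

lemma mertens_3mod4_nat:
  "\<exists>C. \<forall>n\<ge>1. \<bar>(\<Sum>p\<in>primes3 0 (real n). ln p / p) - ln n / 2\<bar> \<le> C"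
proof -
  obtain C where C: "\<And>n. n \<ge> 1 \<Longrightarrow> \<bar>\<Sum>d\<in>{1..n}. chi4 d * (mangoldt d / d)\<bar> \<le> C"
    using chi4_mangoldt_sum_bounded by blast
  have "\<bar>(\<Sum>p\<in>primes3 0 (real n). ln p / p) - ln n / 2\<bar> \<le> (C + 17) / 2" if n: "n \<ge> 1" for n
  proof -
    let ?Pr = "{d \<in> {1..n}. prime d}" and ?Co = "{d. d \<in> {1..n} \<and> \<not> prime d}"
    let ?m = "\<lambda>d. mangoldt d / real d"
    have spl: "(\<Sum>d\<in>{1..n}. g d) = (\<Sum>d\<in>?Pr. g d) + (\<Sum>d\<in>?Co. g d)" for g :: "nat \<Rightarrow> real"
      by (subst sum.union_disjoint[symmetric]) (auto intro!: sum.cong)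
    have co: "0 \<le> (\<Sum>d\<in>?Co. ?m d)" "(\<Sum>d\<in>?Co. ?m d) \<le> 4"
      using sum_proper_prime_powers_le[of n] by (auto intro!: sum_nonneg simp: mangoldt_nonneg)
    have "\<bar>\<Sum>d\<in>?Co. chi4 d * ?m d\<bar> \<le> (\<Sum>d\<in>?Co. \<bar>chi4 d * ?m d\<bar>)" by (rule sum_abs)
    also have "\<dots> \<le> (\<Sum>d\<in>?Co. ?m d)"
    proof (rule sum_mono)
      fix d
      show "\<bar>chi4 d * ?m d\<bar> \<le> ?m d"
        using mult_right_mono[OF abs_chi4_le[of d], of "?m d"] mangoldt_nonneg[of d] by (simp add: abs_mult)
    qed
    finally have co': "\<bar>\<Sum>d\<in>?Co. chi4 d * ?m d\<bar> \<le> 4" using co by linarith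
    have A: "\<bar>(\<Sum>d\<in>?Pr. ?m d) - ln n\<bar> \<le> 12"
      using mangoldt_over_n_sum[OF n] spl[of ?m] co by linarith
    have B: "\<bar>\<Sum>d\<in>?Pr. chi4 d * ?m d\<bar> \<le> C + 4"
      using C[OF n] spl[of "\<lambda>d. chi4 d * ?m d"] co' by linarith
    have "(\<Sum>d\<in>?Pr. ?m d) - (\<Sum>d\<in>?Pr. chi4 d * ?m d) =
        (\<Sum>d\<in>?Pr. (if d mod 4 = 3 then 2 * ?m d else 0) + (if d = 2 then ?m d else 0))"
      unfolding sum_subtractf[symmetric]
    proof (intro sum.cong refl)
      fix d assume "d \<in> ?Pr"
      hence "d = 2 \<or> odd d" using prime_odd_nat[of d] prime_ge_2_nat[of d] by force
      hence "d = 2 \<or> d mod 4 = 1 \<or> d mod 4 = 3" by presburger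
      thus "?m d - chi4 d * ?m d = (if d mod 4 = 3 then 2 * ?m d else 0) + (if d = 2 then ?m d else 0)"
        by (auto simp: chi4_def)
    qed
    also have "\<dots> = 2 * (\<Sum>d\<in>?Pr. if d mod 4 = 3 then ?m d else 0) + (\<Sum>d\<in>?Pr. if d = 2 then ?m d else 0)"
      unfolding sum.distrib sum_distrib_left by (simp add: if_distrib cong: if_cong)
    also have "(\<Sum>d\<in>?Pr. if d mod 4 = 3 then ?m d else 0) = (\<Sum>p\<in>primes3 0 (real n). ln p / p)"
      by (rule sum.mono_neutral_cong_right) (auto simp: primes3_def prime_gt_0_nat Suc_le_eq)
    finally have E: "(\<Sum>d\<in>?Pr. ?m d) - (\<Sum>d\<in>?Pr. chi4 d * ?m d) =
        2 * (\<Sum>p\<in>primes3 0 (real n). ln p / p) + (\<Sum>d\<in>?Pr. if d = 2 then ?m d else 0)" .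
    have F: "(\<Sum>d\<in>?Pr. if d = 2 then ?m d else 0) = (if 2 \<in> ?Pr then ln 2 / 2 else 0)"
      by (subst sum.delta) auto
    have "0 \<le> ln (2::real)" "ln (2::real) \<le> 1" using ln_le_minus_one[of "2::real"] by auto
    hence "0 \<le> (\<Sum>d\<in>?Pr. if d = 2 then ?m d else 0)" "(\<Sum>d\<in>?Pr. if d = 2 then ?m d else 0) \<le> 1"
      unfolding F by auto
    moreover have "\<bar>s - l / 2\<bar> \<le> (C + 17) / 2"
      if "\<bar>a - l\<bar> \<le> 12" "\<bar>b\<bar> \<le> C + 4" "a - b = 2 * s + e" "0 \<le> e" "e \<le> 1" for a b s e l :: real
      using that by argo
    ultimately show ?thesis using A B E by blast
  qed
  thus ?thesis by blast
qed

lemma mertens_3mod4: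
  "\<exists>C\<ge>1. \<forall>u v. 1 \<le> u \<longrightarrow> u \<le> v \<longrightarrow> \<bar>(\<Sum>p\<in>primes3 u v. ln p / p) - ln (v / u) / 2\<bar> \<le> C"
proof -
  obtain C where C: "\<And>n. n \<ge> 1 \<Longrightarrow> \<bar>(\<Sum>p\<in>primes3 0 (real n). ln p / p) - ln n / 2\<bar> \<le> C"
    using mertens_3mod4_nat by blast
  have real: "\<bar>(\<Sum>p\<in>primes3 0 y. ln p / p) - ln y / 2\<bar> \<le> C + 1" if y: "y \<ge> 1" for y
  proof -
    define n where "n = nat \<lfloor>y\<rfloor>"
    have n: "n \<ge> 1" "real n \<le> y" "y < real n + 1" using y by (auto simp: n_def le_nat_iff)
    have "real p \<le> y \<longleftrightarrow> real p \<le> real n" for p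
    proof
      assume "real p \<le> y"
      hence "p \<le> n" unfolding n_def by (rule le_nat_floor)
      thus "real p \<le> real n" by simp
    qed (use n(2) in linarith)
    hence "primes3 0 y = primes3 0 (real n)" by (auto simp: primes3_def)
    moreover have "ln (real n) \<le> ln y" using n by simp
    moreover have "ln y \<le> ln (real n) + 1"
    proof -
      have "ln y \<le> ln (real (Suc n))" using n by simp
      moreover have "1 / real n \<le> 1" using n by simp
      ultimately show ?thesis using ln_Suc_le[OF n(1)] by linarith
    qed
    ultimately show ?thesis using C[OF n(1)] by (simp add: abs_if split: if_splits)
  qed
  have "\<bar>(\<Sum>p\<in>primes3 u v. ln p / p) - ln (v / u) / 2\<bar> \<le> 2 * C + 2" if uv: "1 \<le> u" "u \<le> v" for u v
  proof -
    have "primes3 0 v = primes3 0 u \<union> primes3 u v" "primes3 0 u \<inter> primes3 u v = {}"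
      using uv by (auto simp: primes3_def)
    hence "(\<Sum>p\<in>primes3 0 v. ln p / p) = (\<Sum>p\<in>primes3 0 u. ln p / p) + (\<Sum>p\<in>primes3 u v. ln p / p)"
      by (simp add: sum.union_disjoint)
    moreover have "ln (v / u) = ln v - ln u" using uv by (simp add: ln_div)
    ultimately show ?thesis using real[of u] real[of v] uv unfolding abs_if by (auto split: if_splits simp: field_simps)
  qed
  moreover have "0 \<le> C" using C[of 1] by linarith
  ultimately show ?thesis by (intro exI[of _ "2 * C + 2"]) auto
qed

section \<open>Lacunary prime factors of almost all integers\<close>

lemma sum_dvd_indicator:
  assumes "d > 0"
  shows "(\<Sum>m\<in>{1..N}. if d dvd m then c else 0) = c * real (N div d)"
proof -
  have "{m \<in> {1..N}. d dvd m} = (\<lambda>j. d * j) ` {1..N div d}"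
  proof (intro equalityI subsetI)
    fix m assume "m \<in> {m \<in> {1..N}. d dvd m}"
    then obtain j where j: "m = d * j" "1 \<le> m" "m \<le> N" by auto
    hence "j \<ge> 1" "j \<le> N div d" using assms by (auto simp: less_eq_div_iff_mult_less_eq mult.commute intro: Nat.gr0I)
    thus "m \<in> (\<lambda>j. d * j) ` {1..N div d}" using j by auto
  next
    fix m assume "m \<in> (\<lambda>j. d * j) ` {1..N div d}"
    then obtain j where "m = d * j" "j \<in> {1..N div d}" by (rule imageE)
    hence j: "m = d * j" "1 \<le> j" "j \<le> N div d" by auto
    have "d * j \<le> N" using j(3) assms by (simp add: less_eq_div_iff_mult_less_eq mult.commute)
    thus "m \<in> {m \<in> {1..N}. d dvd m}" using j assms by auto
  qed
  moreover have "inj_on (\<lambda>j. d * j) {1..N div d}" using assms by (auto simp: inj_on_def)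
  ultimately have "card {m \<in> {1..N}. d dvd m} = N div d" by (simp add: card_image)
  moreover have "(\<Sum>m\<in>{1..N}. if d dvd m then c else 0) = (\<Sum>m\<in>{m \<in> {1..N}. d dvd m}. c)"
    by (rule sum.inter_filter[symmetric]) simp
  ultimately show ?thesis by (simp add: mult.commute)
qed

text \<open>Divisibility by coprime numbers is asymptotically independent: for such a pair 1 / lcm
  is the product of the two densities and cancels against the square of the mean, so only pairs with
  a common factor remain. In the second moment the rounding has the favourable sign; the error term
  stems from the first moment alone.\<close>

lemma variance_bound:
  fixes d :: "'a \<Rightarrow> nat" and w :: "'a \<Rightarrow> real" and N :: nat
  assumes I: "finite I" "\<And>i. i \<in> I \<Longrightarrow> d i > 0" "\<And>i. i \<in> I \<Longrightarrow> w i \<ge> 0"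
  defines "f \<equiv> \<lambda>m::nat. \<Sum>i\<in>I. if d i dvd m then w i else 0" and "\<mu> \<equiv> \<Sum>i\<in>I. w i / d i"
  shows "(\<Sum>m\<in>{1..N}. (f m - \<mu>)\<^sup>2) \<le>
    N * (\<Sum>i\<in>I. \<Sum>j\<in>I. if coprime (d i) (d j) then 0 else w i * w j / lcm (d i) (d j)) + 2 * \<mu> * (\<Sum>i\<in>I. w i)"
proof -
  let ?n = "\<Sum>i\<in>I. \<Sum>j\<in>I. if coprime (d i) (d j) then 0 else w i * w j / lcm (d i) (d j)"
  have mu0: "\<mu> \<ge> 0" unfolding \<mu>_def using I by (intro sum_nonneg) auto
  have sq: "(\<Sum>m\<in>{1..N}. (f m)\<^sup>2) \<le> N * (?n + \<mu>\<^sup>2)"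
  proof -
    have "(\<Sum>m\<in>{1..N}. (f m)\<^sup>2) = (\<Sum>m\<in>{1..N}. \<Sum>i\<in>I. \<Sum>j\<in>I. if lcm (d i) (d j) dvd m then w i * w j else 0)"
    proof (rule sum.cong[OF refl])
      fix m
      have "(f m)\<^sup>2 = (\<Sum>i\<in>I. \<Sum>j\<in>I. (if d i dvd m then w i else 0) * (if d j dvd m then w j else 0))"
        by (simp only: f_def power2_eq_square sum_product)
      also have "\<dots> = (\<Sum>i\<in>I. \<Sum>j\<in>I. if lcm (d i) (d j) dvd m then w i * w j else 0)"
        by (intro sum.cong refl) auto
      finally show "(f m)\<^sup>2 = \<dots>" .
    qed
    also have "\<dots> = (\<Sum>i\<in>I. \<Sum>m\<in>{1..N}. \<Sum>j\<in>I. if lcm (d i) (d j) dvd m then w i * w j else 0)"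
      by (rule sum.swap)
    also have "\<dots> = (\<Sum>i\<in>I. \<Sum>j\<in>I. \<Sum>m\<in>{1..N}. if lcm (d i) (d j) dvd m then w i * w j else 0)"
      by (rule sum.cong[OF refl], rule sum.swap)
    also have "\<dots> = (\<Sum>i\<in>I. \<Sum>j\<in>I. w i * w j * real (N div lcm (d i) (d j)))"
      by (intro sum.cong refl sum_dvd_indicator) (use I(2) in \<open>auto simp: lcm_pos_nat\<close>)
    also have "\<dots> \<le> (\<Sum>i\<in>I. \<Sum>j\<in>I. N * ((if coprime (d i) (d j) then 0 else w i * w j / lcm (d i) (d j)) +
        w i / d i * (w j / d j)))"
    proof (intro sum_mono)
      fix i j assume ij: "i \<in> I" "j \<in> I"
      have "w i * w j * real (N div lcm (d i) (d j)) \<le> w i * w j * (N / lcm (d i) (d j))"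
        using I(3) ij by (intro mult_left_mono of_nat_div_le_of_nat) auto
      also have "\<dots> = N * (w i * w j / lcm (d i) (d j))" by simp
      also have "\<dots> \<le> N * ((if coprime (d i) (d j) then 0 else w i * w j / lcm (d i) (d j)) + w i / d i * (w j / d j))"
        using I(3) ij by (intro mult_left_mono) (auto simp: lcm_coprime)
      finally show "w i * w j * real (N div lcm (d i) (d j)) \<le> \<dots>" .
    qed
    also have "\<dots> = N * (?n + \<mu>\<^sup>2)"
      by (simp only: sum_distrib_left[symmetric] sum.distrib \<mu>_def power2_eq_square sum_product)
    finally show ?thesis .
  qed
  have lin: "(\<Sum>m\<in>{1..N}. f m) \<ge> N * \<mu> - (\<Sum>i\<in>I. w i)"
  proof -
    have "(\<Sum>m\<in>{1..N}. f m) = (\<Sum>i\<in>I. \<Sum>m\<in>{1..N}. if d i dvd m then w i else 0)"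
      unfolding f_def by (rule sum.swap)
    also have "\<dots> = (\<Sum>i\<in>I. w i * real (N div d i))"
      using I(2) by (intro sum.cong refl sum_dvd_indicator) auto
    also have "\<dots> \<ge> (\<Sum>i\<in>I. w i * (N / d i - 1))"
    proof (intro sum_mono mult_left_mono)
      fix i assume i: "i \<in> I"
      thus "real N / real (d i) - 1 \<le> real (N div d i)"
        using real_div_le_nat_div_plus_one[of "d i" N] I(2) by simp
    qed (use I in auto)
    also have "(\<Sum>i\<in>I. w i * (N / d i - 1)) = N * \<mu> - (\<Sum>i\<in>I. w i)"
      by (simp add: \<mu>_def sum_distrib_left sum_subtractf right_diff_distrib mult_ac)
    finally show ?thesis .
  qed
  have "(\<Sum>m\<in>{1..N}. (f m - \<mu>)\<^sup>2) = (\<Sum>m\<in>{1..N}. (f m)\<^sup>2 - 2 * \<mu> * f m + \<mu>\<^sup>2)"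
    by (intro sum.cong refl) (simp add: power2_eq_square algebra_simps)
  also have "\<dots> = (\<Sum>m\<in>{1..N}. (f m)\<^sup>2) - 2 * \<mu> * (\<Sum>m\<in>{1..N}. f m) + N * \<mu>\<^sup>2"
    by (simp add: sum.distrib sum_subtractf sum_distrib_left)
  also have "\<dots> \<le> N * (?n + \<mu>\<^sup>2) - 2 * \<mu> * (N * \<mu> - (\<Sum>i\<in>I. w i)) + N * \<mu>\<^sup>2"
    using sq mult_left_mono[OF lin, of "2 * \<mu>"] mu0 by linarith
  also have "\<dots> = N * ?n + 2 * \<mu> * (\<Sum>i\<in>I. w i)"
    by (simp add: algebra_simps power2_eq_square)
  finally show ?thesis .
qed

lemma markov_count:
  fixes g :: "nat \<Rightarrow> real"
  assumes "finite A" "\<And>m. m \<in> A \<Longrightarrow> 0 \<le> g m"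
  shows "real (card {m \<in> A. a \<le> g m}) * a \<le> (\<Sum>m\<in>A. g m)"
proof -
  have "real (card {m \<in> A. a \<le> g m}) * a = (\<Sum>m\<in>{m \<in> A. a \<le> g m}. a)" by simp
  also have "\<dots> \<le> (\<Sum>m\<in>{m \<in> A. a \<le> g m}. g m)" by (intro sum_mono) auto
  also have "\<dots> \<le> (\<Sum>m\<in>A. g m)" using assms by (intro sum_mono2) auto
  finally show ?thesis .
qed

section \<open>Reciprocals of primes congruent to 3 modulo 4\<close>

lemma sum_primes3_split:
  fixes f :: "nat \<Rightarrow> real"
  assumes "u \<le> v" "v \<le> w"
  shows "sum f (primes3 u w) = sum f (primes3 u v) + sum f (primes3 v w)"
proof -
  have "primes3 u w = primes3 u v \<union> primes3 v w" "primes3 u v \<inter> primes3 v w = {}"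
    using assms by (auto simp: primes3_def)
  thus ?thesis by (simp add: sum.union_disjoint)
qed

lemma primes3_ge_3: "p \<in> primes3 u v \<Longrightarrow> p \<ge> 3"
proof -
  assume "p \<in> primes3 u v"
  hence "prime p" "p mod 4 = 3" by (auto simp: primes3_def)
  moreover from this have "p \<ge> 2" "p \<noteq> 2" using prime_ge_2_nat by auto
  ultimately show "p \<ge> 3" by linarith
qed

text \<open>Wide enough to be symmetric: if \<open>q\<close> lies above
  \<open>p powr (1 / T)\<close> and is at most p^2, then \<open>q\<close> is in
  \<open>nbrs T p\<close> and \<open>p\<close> is in \<open>nbrs T q\<close>. The count of
  overlapping pairs relies on both.\<close>

definition nbrs :: "real \<Rightarrow> nat \<Rightarrow> nat set" where
  "nbrs T s = primes3 (real s powr (1 / (2 * T))) (real s powr T)"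

context
  fixes C :: real
  assumes C: "C \<ge> 1"
    and mertens: "\<And>u v. 1 \<le> u \<Longrightarrow> u \<le> v \<Longrightarrow> \<bar>(\<Sum>p\<in>primes3 u v. ln p / p) - ln (v / u) / 2\<bar> \<le> C"
begin

lemma sum_ln_over_primes3_le:
  assumes "1 \<le> v"
  shows "(\<Sum>p\<in>primes3 0 v. ln p / p) \<le> ln v / 2 + C"
proof -
  have "primes3 0 v = primes3 1 v"
  proof (intro equalityI subsetI)
    fix p assume p: "p \<in> primes3 0 v"
    show "p \<in> primes3 1 v" using p primes3_ge_3[OF p] by (auto simp: primes3_def)
  qed (auto simp: primes3_def)
  thus ?thesis using mertens[of 1 v] assms by simp
qed

lemma sum_inverse_primes3_le:
  assumes "1 < u" "u \<le> v"
  shows "(\<Sum>p\<in>primes3 u v. 1 / p) \<le> (ln (v / u) / 2 + C) / ln u"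
proof -
  have "(\<Sum>p\<in>primes3 u v. 1 / p) \<le> (\<Sum>p\<in>primes3 u v. ln p / p / ln u)"
  proof (rule sum_mono)
    fix p assume p: "p \<in> primes3 u v"
    hence "ln u \<le> ln (real p)" using assms by (auto simp: primes3_def)
    hence "1 \<le> ln (real p) / ln u" using assms by simp
    hence "1 / real p * 1 \<le> 1 / real p * (ln (real p) / ln u)" by (intro mult_left_mono) auto
    thus "1 / real p \<le> ln p / p / ln u" by simp
  qed
  also have "\<dots> = (\<Sum>p\<in>primes3 u v. ln p / p) / ln u" by (simp add: sum_divide_distrib)
  also have "\<dots> \<le> (ln (v / u) / 2 + C) / ln u"
    using mertens[of u v] assms by (intro divide_right_mono) auto
  finally show ?thesis .
qed

lemma sum_inverse_primes3_ge:
  assumes "1 \<le> u" "u \<le> v" "1 < v"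
  shows "(ln (v / u) / 2 - C) / ln v \<le> (\<Sum>p\<in>primes3 u v. 1 / p)"
proof -
  have "(ln (v / u) / 2 - C) / ln v \<le> (\<Sum>p\<in>primes3 u v. ln p / p) / ln v"
    using mertens[of u v] assms by (intro divide_right_mono) auto
  also have "\<dots> = (\<Sum>p\<in>primes3 u v. ln p / p / ln v)" by (simp add: sum_divide_distrib)
  also have "\<dots> \<le> (\<Sum>p\<in>primes3 u v. 1 / p)"
  proof (rule sum_mono)
    fix p assume p: "p \<in> primes3 u v"
    hence "ln (real p) \<le> ln v" using primes3_ge_3[OF p] assms by (auto simp: primes3_def)
    hence "ln (real p) / ln v \<le> 1" using assms by simp
    hence "1 / real p * (ln (real p) / ln v) \<le> 1 / real p * 1" by (intro mult_left_mono) auto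
    thus "ln p / p / ln v \<le> 1 / real p" by simp
  qed
  finally show ?thesis .
qed

text \<open>Every interval from \<open>sqrt v\<close> to \<open>v\<close> contributes at least 1/8
  once \<open>16 * C \<le> ln v\<close>. So the sum can be made arbitrarily large while the lower
  endpoint stays a fixed power of \<open>X\<close>.\<close>

lemma sum_inverse_primes3_large:
  assumes "X > 1" "8 * C \<le> ln X / 2 ^ n"
  shows "real n / 8 \<le> (\<Sum>p\<in>primes3 (X powr (1 / 2 ^ n)) X. 1 / p)"
  using assms(2)
proof (induction n)
  case (Suc n)
  define v where "v = X powr (1 / 2 ^ n)"
  define u where "u = X powr (1 / 2 ^ Suc n)"
  have le: "(1::real) / 2 ^ Suc n \<le> 1 / 2 ^ n" "(1::real) / 2 ^ n \<le> 1" by (auto simp: divide_simps)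
  have uv: "1 \<le> u" "u \<le> v" "1 < v" "v \<le> X"
    using assms(1) le powr_mono[OF le(1), of X] powr_mono[OF le(2), of X]
    by (auto simp: u_def v_def ge_one_powr_ge_zero)
  have lnv: "ln v = ln X / 2 ^ n" "ln u = ln X / 2 ^ n / 2" using assms(1) by (auto simp: u_def v_def ln_powr)
  have big: "16 * C \<le> ln v" using Suc.prems lnv by simp
  have "ln (v / u) / 2 = ln v / 4" using uv lnv by (simp add: ln_div)
  hence "(ln v / 4 - C) / ln v \<le> (\<Sum>p\<in>primes3 u v. 1 / p)"
    using sum_inverse_primes3_ge[OF uv(1,2,3)] by (simp only:)
  moreover have "1 / 8 \<le> (ln v / 4 - C) / ln v" using big uv C by (simp add: divide_simps)
  moreover have "real n / 8 \<le> (\<Sum>p\<in>primes3 v X. 1 / p)"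
    unfolding v_def using Suc.IH Suc.prems lnv big C by (simp add: v_def)
  moreover have "(\<Sum>p\<in>primes3 u X. 1 / p) = (\<Sum>p\<in>primes3 u v. 1 / p) + (\<Sum>p\<in>primes3 v X. 1 / p)"
    by (rule sum_primes3_split[OF uv(2,4)])
  ultimately have "real n / 8 + 1 / 8 \<le> (\<Sum>p\<in>primes3 u X. 1 / p)" by linarith
  thus ?case by (simp add: u_def add_divide_distrib)
qed (simp add: sum_nonneg)

text \<open>The endpoints are fixed powers of \<open>s\<close>, so \<open>ln s\<close> cancels and
  the bound depends on \<open>T\<close> alone. This uniformity controls the variance.\<close>

lemma sum_inverse_nbrs_le:
  assumes "T \<ge> 2" "s > 1" "2 * T * C \<le> ln s"
  shows "(\<Sum>r\<in>nbrs T s. 1 / r) \<le> T\<^sup>2 + 1"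
proof -
  have s: "ln (real s) > 0" using assms by simp
  have "1 / (2 * T) \<le> 1" using assms(1) by simp
  hence ord: "1 / (2 * T) \<le> T" using assms(1) by linarith
  have "(\<Sum>r\<in>nbrs T s. 1 / r) \<le> (ln (s powr T / s powr (1 / (2 * T))) / 2 + C) / ln (s powr (1 / (2 * T)))"
    unfolding nbrs_def using assms ord by (intro sum_inverse_primes3_le powr_mono) auto
  also have "\<dots> = ((T - 1 / (2 * T)) * ln s / 2 + C) / (ln s / (2 * T))"
    using assms by (simp add: ln_powr ln_div algebra_simps)
  also have "\<dots> \<le> (T * ln s / 2 + C) / (ln s / (2 * T))"
    using assms s by (intro divide_right_mono add_mono mult_right_mono) auto
  also have "\<dots> = T\<^sup>2 + 2 * T * C / ln s"
    using assms s by (simp add: field_simps power2_eq_square)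
  also have "\<dots> \<le> T\<^sup>2 + 1" using assms s by simp
  finally show ?thesis .
qed

text \<open>
  Splitting at \<open>p powr (3/2)\<close> matters: applying \<open>sum_inverse_primes3_le\<close> to \<open>(p, p\<^sup>2]\<close> at once gives
  \<open>1/2\<close> in place of \<open>5/12\<close>, and the expected defect would no longer be below \<open>1\<close>.
\<close>

lemma sum_inverse_above_le:
  assumes "p > 1" "ln p \<ge> 240 * C"
  shows "(\<Sum>q\<in>primes3 p ((real p)\<^sup>2). 1 / q) \<le> 5 / 12 + 2 * C / ln p"
proof -
  define y where "y = real p powr (3/2)"
  have l: "ln (real p) > 0" using assms by simp
  have y: "real p \<le> y" "y \<le> (real p)\<^sup>2"
    using assms powr_mono[of 1 "3/2" "real p"] powr_mono[of "3/2" 2 "real p"] by (auto simp: y_def)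
  have ln_y: "ln y = 3 / 2 * ln p" using assms by (simp add: y_def ln_powr)
  have "(\<Sum>q\<in>primes3 p ((real p)\<^sup>2). 1 / q) = (\<Sum>q\<in>primes3 p y. 1 / q) + (\<Sum>q\<in>primes3 y ((real p)\<^sup>2). 1 / q)"
    by (rule sum_primes3_split[OF y])
  also have "\<dots> \<le> (ln (y / p) / 2 + C) / ln p + (ln ((real p)\<^sup>2 / y) / 2 + C) / ln y"
    using assms y by (intro add_mono sum_inverse_primes3_le) auto
  also have "\<dots> = (ln p / 4 + C) / ln p + (ln p / 4 + C) / (3 / 2 * ln p)"
  proof -
    have "ln (y / p) = ln p / 2" "ln ((real p)\<^sup>2 / y) = ln p / 2"
      using assms y ln_y by (simp_all add: ln_div ln_realpow)
    thus ?thesis by (simp add: ln_y)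
  qed
  also have "\<dots> = 5 / 12 + 5 / 3 * C / ln p" using l by (simp add: field_simps)
  also have "\<dots> \<le> 5 / 12 + 2 * C / ln p" using l C by (intro add_left_mono divide_right_mono) auto
  finally show ?thesis .
qed

end

text \<open>The lcm is \<open>s * t * r\<close> unless \<open>r = t\<close>, where it drops to
  \<open>s * t\<close>; this exceptional term is the extra 1.\<close>

lemma sum_inverse_lcm_le:
  assumes "prime s" "prime t" "finite R" "\<And>r. r \<in> R \<Longrightarrow> prime r"
  shows "(\<Sum>r\<in>R. 1 / real (lcm (s * t) (s * r))) \<le> (1 + (\<Sum>r\<in>R. 1 / real r)) / real (s * t)"
proof -
  have "(\<Sum>r\<in>R. 1 / real (lcm (s * t) (s * r))) \<le> (\<Sum>r\<in>R. ((if r = t then 1 else 0) + 1 / real r) / real (s * t))"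
  proof (rule sum_mono)
    fix r assume r: "r \<in> R"
    have l: "lcm (s * t) (s * r) = s * lcm t r" by (simp add: lcm_mult_left)
    show "1 / real (lcm (s * t) (s * r)) \<le> ((if r = t then 1 else 0) + 1 / real r) / real (s * t)"
    proof (cases "r = t")
      case True
      have "1 / real (s * t) \<le> (1 + 1 / real r) / real (s * t)" by (intro divide_right_mono) auto
      thus ?thesis using True l by simp
    next
      case False
      hence "coprime t r" using assms r by (intro primes_coprime) auto
      thus ?thesis using False l by (simp add: lcm_coprime mult_ac)
    qed
  qed
  also have "\<dots> = ((\<Sum>r\<in>R. if r = t then 1 else 0) + (\<Sum>r\<in>R. 1 / real r)) / real (s * t)"
    by (simp only: sum_divide_distrib[symmetric] sum.distrib)
  also have "\<dots> \<le> (1 + (\<Sum>r\<in>R. 1 / real r)) / real (s * t)"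
    using assms(3) by (intro divide_right_mono add_right_mono) auto
  finally show ?thesis .
qed

lemma sum_union_le:
  fixes f :: "'a \<Rightarrow> real"
  assumes "finite A" "finite B" "\<And>x. f x \<ge> 0"
  shows "sum f (A \<union> B) \<le> sum f A + sum f B"
  using sum_Un[OF assms(1,2), of f] sum_nonneg[of "A \<inter> B" f] assms(3) by simp

text \<open>A pair whose product is not coprime to \<open>p * q\<close> contains \<open>p\<close> or
  \<open>q\<close> in one of its two places. That gives four families; in each the other prime runs
  through \<open>R p\<close> or \<open>R q\<close>, by the two-sided relation assumed of
  \<open>I\<close>.\<close>

lemma overlap_sum_le:
  fixes I :: "(nat \<times> nat) set" and R :: "nat \<Rightarrow> nat set"
  assumes I: "finite I" "\<And>p q. (p, q) \<in> I \<Longrightarrow> prime p \<and> prime q \<and> q \<in> R p \<and> p \<in> R q"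
    and R: "\<And>s. finite (R s)" "\<And>s r. r \<in> R s \<Longrightarrow> prime r"
    and S: "(\<Sum>r\<in>R p. 1 / real r) \<le> S" "(\<Sum>r\<in>R q. 1 / real r) \<le> S"
    and pq: "(p, q) \<in> I"
  shows "(\<Sum>(a, b)\<in>I. if coprime (p * q) (a * b) then 0 else 1 / real (lcm (p * q) (a * b))) \<le> 4 * (1 + S) / (p * q)"
proof -
  let ?f = "\<lambda>x. 1 / real (lcm (p * q) (fst x * snd x))"
  let ?U = "(Pair p ` R p \<union> Pair q ` R q) \<union> ((\<lambda>r. (r, p)) ` R p \<union> (\<lambda>r. (r, q)) ` R q)"
  have pr: "prime p" "prime q" using I(2)[OF pq] by auto
  have "(\<Sum>(a, b)\<in>I. if coprime (p * q) (a * b) then 0 else 1 / real (lcm (p * q) (a * b))) =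
      (\<Sum>x\<in>{x \<in> I. \<not> coprime (p * q) (fst x * snd x)}. ?f x)"
    using I(1) by (subst sum.inter_filter) (auto intro!: sum.cong)
  also have "\<dots> \<le> sum ?f ?U"
  proof (rule sum_mono2)
    show "{x \<in> I. \<not> coprime (p * q) (fst x * snd x)} \<subseteq> ?U"
    proof
      fix x assume x: "x \<in> {x \<in> I. \<not> coprime (p * q) (fst x * snd x)}"
      obtain a b where ab: "x = (a, b)" by (cases x)
      have 1: "prime a" "prime b" "b \<in> R a" "a \<in> R b" using x ab I(2) by auto
      have "a = p \<or> a = q \<or> b = p \<or> b = q"
      proof (rule ccontr)
        assume "\<not> ?thesis"
        hence "coprime p a" "coprime p b" "coprime q a" "coprime q b"
          using pr 1 by (auto intro: primes_coprime)
        thus False using x ab by simp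
      qed
      thus "x \<in> ?U" using 1 ab by auto
    qed
  qed (use R in auto)
  also have "\<dots> \<le> (sum ?f (Pair p ` R p) + sum ?f (Pair q ` R q)) +
      (sum ?f ((\<lambda>r. (r, p)) ` R p) + sum ?f ((\<lambda>r. (r, q)) ` R q))"
    using R(1) by (intro order.trans[OF sum_union_le add_mono[OF sum_union_le sum_union_le]]) auto
  also have "\<dots> = ((\<Sum>r\<in>R p. 1 / real (lcm (p * q) (p * r))) + (\<Sum>r\<in>R q. 1 / real (lcm (q * p) (q * r)))) +
      ((\<Sum>r\<in>R p. 1 / real (lcm (p * q) (p * r))) + (\<Sum>r\<in>R q. 1 / real (lcm (q * p) (q * r))))"
    by (simp add: sum.reindex inj_on_def mult.commute)
  also have "\<dots> \<le> ((1 + S) / (p * q) + (1 + S) / (p * q)) + ((1 + S) / (p * q) + (1 + S) / (p * q))"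
  proof -
    have "(\<Sum>r\<in>R p. 1 / real (lcm (p * q) (p * r))) \<le> (1 + (\<Sum>r\<in>R p. 1 / real r)) / (p * q)"
      by (rule sum_inverse_lcm_le) (use pr R in auto)
    also have "\<dots> \<le> (1 + S) / (p * q)" using S by (intro divide_right_mono) auto
    finally have A: "(\<Sum>r\<in>R p. 1 / real (lcm (p * q) (p * r))) \<le> (1 + S) / (p * q)" .
    have "(\<Sum>r\<in>R q. 1 / real (lcm (q * p) (q * r))) \<le> (1 + (\<Sum>r\<in>R q. 1 / real r)) / (q * p)"
      by (rule sum_inverse_lcm_le) (use pr R in auto)
    also have "\<dots> \<le> (1 + S) / (q * p)" using S by (intro divide_right_mono) auto
    finally have "(\<Sum>r\<in>R q. 1 / real (lcm (q * p) (q * r))) \<le> (1 + S) / (p * q)" by (simp add: mult.commute)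
    with A show ?thesis by linarith
  qed
  finally show ?thesis by simp
qed

section \<open>Lacunary primes and the moments of their defect\<close>

definition lacunary_at :: "nat \<Rightarrow> nat \<Rightarrow> bool" where
  "lacunary_at m p \<longleftrightarrow> prime p \<and> p mod 4 = 3 \<and> p dvd m \<and>
    (\<forall>q\<in>primes3 p ((real p)\<^sup>2). \<not> q dvd m) \<and>
    (\<Sum>q\<in>{q \<in> primes3 0 p - {p}. q dvd m}. ln q) \<le> 24 / 25 * ln p"

text \<open>Turan's variance argument: among primes only equal pairs fail to be coprime, so the
  variance is of the order of the mean.\<close>

lemma few_prime_divisors_count:
  fixes N :: nat and \<Lambda> :: real
  assumes J: "finite J" "\<And>p. p \<in> J \<Longrightarrow> prime p"
  defines "\<Lambda> \<equiv> \<Sum>p\<in>J. 1 / real p"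
  shows "real (card {m \<in> {1..N}. (\<Sum>p\<in>J. if p dvd m then 1 else 0) \<le> 197 / 200 * \<Lambda>}) * (3 / 200 * \<Lambda>)\<^sup>2
     \<le> N * \<Lambda> + 2 * \<Lambda> * card J"
proof -
  let ?f = "\<lambda>m::nat. \<Sum>p\<in>J. if p dvd m then 1 else (0::real)"
  have L0: "\<Lambda> \<ge> 0" unfolding \<Lambda>_def by (intro sum_nonneg) auto
  have "(\<Sum>i\<in>J. \<Sum>j\<in>J. if coprime i j then 0 else 1 * 1 / real (lcm i j)) = (\<Sum>i\<in>J. \<Sum>j\<in>J. if j = i then 1 / real i else 0)"
  proof (intro sum.cong refl)
    fix i j assume ij: "i \<in> J" "j \<in> J"
    show "(if coprime i j then 0 else 1 * 1 / real (lcm i j)) = (if j = i then 1 / real i else 0)"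
    proof (cases "i = j")
      case True
      thus ?thesis using J(2)[OF ij(1)] by (auto dest: not_prime_unit)
    next
      case False
      thus ?thesis using primes_coprime[of i j] J(2) ij by simp
    qed
  qed
  also have "\<dots> = \<Lambda>" using J(1) by (simp add: \<Lambda>_def)
  finally have ov: "(\<Sum>i\<in>J. \<Sum>j\<in>J. if coprime i j then 0 else 1 * 1 / real (lcm i j)) = \<Lambda>" .
  have "real (card {m \<in> {1..N}. ?f m \<le> 197 / 200 * \<Lambda>}) * (3 / 200 * \<Lambda>)\<^sup>2 \<le>
      real (card {m \<in> {1..N}. (3 / 200 * \<Lambda>)\<^sup>2 \<le> (?f m - \<Lambda>)\<^sup>2}) * (3 / 200 * \<Lambda>)\<^sup>2"
  proof (intro mult_right_mono of_nat_mono card_mono subsetI)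
    fix m assume "m \<in> {m \<in> {1..N}. ?f m \<le> 197 / 200 * \<Lambda>}"
    hence m: "m \<in> {1..N}" "3 / 200 * \<Lambda> \<le> \<Lambda> - ?f m" by auto
    hence "(3 / 200 * \<Lambda>)\<^sup>2 \<le> (\<Lambda> - ?f m)\<^sup>2" using L0 by (intro power_mono) auto
    thus "m \<in> {m \<in> {1..N}. (3 / 200 * \<Lambda>)\<^sup>2 \<le> (?f m - \<Lambda>)\<^sup>2}" using m(1) by (simp add: power2_commute)
  qed auto
  also have "\<dots> \<le> (\<Sum>m\<in>{1..N}. (?f m - \<Lambda>)\<^sup>2)" by (rule markov_count) auto
  also have "\<dots> \<le> N * (\<Sum>i\<in>J. \<Sum>j\<in>J. if coprime i j then 0 else 1 * 1 / real (lcm i j)) + 2 * \<Lambda> * (\<Sum>i\<in>J. 1)"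
    unfolding \<Lambda>_def using J by (intro variance_bound[where d = "\<lambda>p. p"]) (auto simp: prime_gt_0_nat)
  also have "\<dots> = N * \<Lambda> + 2 * \<Lambda> * card J" by (subst ov) simp
  finally show ?thesis .
qed

text \<open>The overlap of a pair is at most a constant times its own density, so the variance is
  linear, not quadratic, in the mean number of pairs. The factor 16 is 4 for the product of two
  weights times 4 for the families of \<open>overlap_sum_le\<close>.\<close>

lemma many_close_pairs_count:
  fixes N :: nat and I :: "(nat \<times> nat) set" and R :: "nat \<Rightarrow> nat set" and w :: "nat \<times> nat \<Rightarrow> real"
    and S \<Lambda> :: real
  assumes I: "finite I" "\<And>p q. (p, q) \<in> I \<Longrightarrow> prime p \<and> prime q \<and> q \<in> R p \<and> p \<in> R q"
    and R: "\<And>s. finite (R s)" "\<And>s r. r \<in> R s \<Longrightarrow> prime r"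
    and S: "\<And>p q. (p, q) \<in> I \<Longrightarrow> (\<Sum>r\<in>R p. 1 / real r) \<le> S \<and> (\<Sum>r\<in>R q. 1 / real r) \<le> S" "S \<ge> 0"
    and w: "\<And>x. x \<in> I \<Longrightarrow> 0 \<le> w x \<and> w x \<le> 2"
    and mean: "(\<Sum>(p, q)\<in>I. w (p, q) / real (p * q)) \<le> 19 / 20 * \<Lambda>" and L0: "\<Lambda> \<ge> 0"
  shows "real (card {m \<in> {1..N}. 97 / 100 * \<Lambda> \<le> (\<Sum>(p, q)\<in>I. if p * q dvd m then w (p, q) else 0)}) * (1 / 50 * \<Lambda>)\<^sup>2
     \<le> N * (16 * (1 + S) * (\<Sum>(p, q)\<in>I. 1 / real (p * q))) + 8 * (real (card I))\<^sup>2"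
proof -
  let ?d = "\<lambda>x. fst x * snd x"
  let ?f = "\<lambda>m::nat. \<Sum>x\<in>I. if ?d x dvd m then w x else 0"
  define \<mu> where "\<mu> = (\<Sum>x\<in>I. w x / real (?d x))"
  define W where "W = (\<Sum>x\<in>I. w x)"
  have f: "(\<Sum>(p, q)\<in>I. if p * q dvd m then w (p, q) else 0) = ?f m" for m
    by (auto simp: case_prod_unfold intro!: sum.cong)
  have mu: "\<mu> \<le> 19 / 20 * \<Lambda>" using mean by (simp add: \<mu>_def case_prod_unfold)
  have d: "?d x > 0" if "x \<in> I" for x using I(2)[of "fst x" "snd x"] that by (auto simp: prime_gt_0_nat)
  have ov: "(\<Sum>x\<in>I. \<Sum>y\<in>I. if coprime (?d x) (?d y) then 0 else w x * w y / real (lcm (?d x) (?d y)))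
      \<le> 16 * (1 + S) * (\<Sum>x\<in>I. 1 / real (?d x))"
  proof -
    have "(\<Sum>x\<in>I. \<Sum>y\<in>I. if coprime (?d x) (?d y) then 0 else w x * w y / real (lcm (?d x) (?d y))) \<le>
        (\<Sum>x\<in>I. \<Sum>y\<in>I. 4 * (if coprime (?d x) (?d y) then 0 else 1 / real (lcm (?d x) (?d y))))"
    proof (intro sum_mono)
      fix x y assume xy: "x \<in> I" "y \<in> I"
      have "w x * w y \<le> 2 * 2" using w xy by (intro mult_mono) auto
      hence "w x * w y / real (lcm (?d x) (?d y)) \<le> 4 / real (lcm (?d x) (?d y))"
        by (intro divide_right_mono) auto
      thus "(if coprime (?d x) (?d y) then 0 else w x * w y / real (lcm (?d x) (?d y))) \<le>
          4 * (if coprime (?d x) (?d y) then 0 else 1 / real (lcm (?d x) (?d y)))" by simp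
    qed
    also have "\<dots> = (\<Sum>x\<in>I. 4 * (\<Sum>y\<in>I. if coprime (?d x) (?d y) then 0 else 1 / real (lcm (?d x) (?d y))))"
      by (simp only: sum_distrib_left)
    also have "\<dots> \<le> (\<Sum>x\<in>I. 4 * (4 * (1 + S) / real (?d x)))"
    proof (intro sum_mono mult_left_mono)
      fix x assume x: "x \<in> I"
      obtain p q where pq: "x = (p, q)" by (cases x)
      have "(\<Sum>(a, b)\<in>I. if coprime (p * q) (a * b) then 0 else 1 / real (lcm (p * q) (a * b))) \<le> 4 * (1 + S) / real (p * q)"
        by (rule overlap_sum_le[OF I R]) (use S(1)[of p q] x pq in auto)
      thus "(\<Sum>y\<in>I. if coprime (?d x) (?d y) then 0 else 1 / real (lcm (?d x) (?d y))) \<le> 4 * (1 + S) / real (?d x)"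
        by (simp only: pq case_prod_unfold fst_conv snd_conv)
    qed auto
    also have "\<dots> = 16 * (1 + S) * (\<Sum>x\<in>I. 1 / real (?d x))" by (simp add: sum_distrib_left)
    finally show ?thesis .
  qed
  have "W \<le> (\<Sum>x\<in>I. 2)" unfolding W_def using w by (intro sum_mono) auto
  hence W: "W \<le> 2 * card I" by simp
  have "\<mu> \<le> W"
    unfolding \<mu>_def W_def
  proof (rule sum_mono)
    fix x assume x: "x \<in> I"
    have "real (?d x) \<ge> 1" using d[OF x] by linarith
    hence "w x / real (?d x) \<le> w x / 1" using w[OF x] by (intro divide_left_mono) auto
    thus "w x / real (?d x) \<le> w x" by simp
  qed
  moreover have "0 \<le> \<mu>" unfolding \<mu>_def using w by (intro sum_nonneg) auto
  ultimately have "2 * \<mu> * W \<le> 2 * (2 * real (card I)) * (2 * real (card I))"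
    using W by (intro mult_mono) auto
  hence err: "2 * \<mu> * W \<le> 8 * (real (card I))\<^sup>2" by (simp add: power2_eq_square)
  have "real (card {m \<in> {1..N}. 97 / 100 * \<Lambda> \<le> ?f m}) * (1 / 50 * \<Lambda>)\<^sup>2 \<le>
      real (card {m \<in> {1..N}. (1 / 50 * \<Lambda>)\<^sup>2 \<le> (?f m - \<mu>)\<^sup>2}) * (1 / 50 * \<Lambda>)\<^sup>2"
  proof (intro mult_right_mono of_nat_mono card_mono subsetI)
    fix m assume "m \<in> {m \<in> {1..N}. 97 / 100 * \<Lambda> \<le> ?f m}"
    hence m: "m \<in> {1..N}" "1 / 50 * \<Lambda> \<le> ?f m - \<mu>" using mu by auto
    hence "(1 / 50 * \<Lambda>)\<^sup>2 \<le> (?f m - \<mu>)\<^sup>2" using L0 by (intro power_mono) auto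
    thus "m \<in> {m \<in> {1..N}. (1 / 50 * \<Lambda>)\<^sup>2 \<le> (?f m - \<mu>)\<^sup>2}" using m(1) by simp
  qed auto
  also have "\<dots> \<le> (\<Sum>m\<in>{1..N}. (?f m - \<mu>)\<^sup>2)" by (rule markov_count) auto
  also have "\<dots> \<le> N * (\<Sum>x\<in>I. \<Sum>y\<in>I. if coprime (?d x) (?d y) then 0 else w x * w y / real (lcm (?d x) (?d y))) + 2 * \<mu> * W"
    unfolding \<mu>_def W_def using I(1) d w by (intro variance_bound) auto
  also have "\<dots> \<le> N * (16 * (1 + S) * (\<Sum>x\<in>I. 1 / real (?d x))) + 8 * (real (card I))\<^sup>2"
    using ov err by (intro add_mono mult_left_mono) auto
  finally show ?thesis by (simp only: case_prod_unfold prod.collapse)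
qed

lemma card_primes3_le: "0 \<le> v \<Longrightarrow> real (card (primes3 u v)) \<le> v"
proof -
  assume v: "0 \<le> v"
  have "primes3 u v \<subseteq> {1..nat \<lfloor>v\<rfloor>}" by (auto simp: primes3_def le_nat_floor prime_gt_0_nat Suc_le_eq)
  hence "card (primes3 u v) \<le> nat \<lfloor>v\<rfloor>" using card_mono[of "{1..nat \<lfloor>v\<rfloor>}"] by simp
  hence "real (card (primes3 u v)) \<le> real (nat \<lfloor>v\<rfloor>)" by simp
  also have "\<dots> \<le> v" using v by simp
  finally show ?thesis .
qed

text \<open>Primes far below \<open>p\<close> are separated from \<open>near\<close> because the sum
  of \<open>1 / q\<close> over all \<open>q < p\<close> is unbounded, which would spoil the
  variance. Their logarithmic weight is only about a fraction \<open>1 / T\<close> of the whole, so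
  a first moment suffices for them.\<close>

definition below :: "real \<Rightarrow> nat \<Rightarrow> nat set" where "below T p = primes3 0 (real p powr (1 / T))"

definition near :: "real \<Rightarrow> nat \<Rightarrow> nat set" where
  "near T p = primes3 (real p powr (1 / T)) ((real p)\<^sup>2) - {p}"

text \<open>Below \<open>p\<close>, the logarithm of \<open>q\<close> in units of the cap
  \<open>24/25 * ln p\<close> of \<open>lacunary_at\<close>; above \<open>p\<close>, one prime alone
  is fatal.\<close>

definition weight :: "nat \<times> nat \<Rightarrow> real" where
  "weight = (\<lambda>(p, q). if q < p then 25 / 24 * ln q / ln p else 1)"

lemma weight_bounds: "p > 1 \<Longrightarrow> q > 1 \<Longrightarrow> 0 \<le> weight (p, q) \<and> weight (p, q) \<le> 2"
proof -
  assume pq: "p > 1" "q > 1"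
  have "25 / 24 * ln (real q) / ln (real p) \<le> 2" if "q < p"
  proof -
    have "ln (real q) \<le> ln (real p)" "ln (real p) > 0" using that pq by auto
    hence "25 / 24 * ln (real q) \<le> 2 * ln (real p)" by linarith
    thus ?thesis using \<open>ln (real p) > 0\<close> by (simp add: divide_le_eq)
  qed
  thus ?thesis using pq by (auto simp: weight_def)
qed

text \<open>Either way of failing is paid for: a prime divisor in the gap carries weight 1, and a
  product above the cap means that the weights of the smaller primes add to more than 1. Stated with
  \<open>p * q dvd m\<close>, the defect becomes a weighted divisor count.\<close>

lemma not_lacunary_pointwise:
  fixes p m :: nat
  assumes p: "prime p" "p mod 4 = 3" "p dvd m" "\<not> lacunary_at m p" and T: "T \<ge> 2"
  shows "1 \<le> (\<Sum>q\<in>near T p. if p * q dvd m then weight (p, q) else 0) +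
             (\<Sum>q\<in>below T p. if p * q dvd m then weight (p, q) else 0)"
proof -
  let ?g = "\<lambda>q. if p * q dvd m then weight (p, q) else 0"
  have p1: "p > 1" using p(1) prime_gt_1_nat by blast
  have fin: "finite (near T p)" "finite (below T p)" by (auto simp: near_def below_def)
  have prime: "prime q" if "q \<in> near T p \<union> below T p" for q
    using that by (auto simp: near_def below_def primes3_def)
  have g0: "0 \<le> ?g q" if "q \<in> near T p \<union> below T p" for q
    using weight_bounds[OF p1, of q] prime[OF that] prime_gt_1_nat by auto
  have pT: "real p powr (1 / T) \<le> real p powr 1" using T p1 by (intro powr_mono) auto
  have mult: "p * q dvd m" if "q dvd m" "prime q" "q \<noteq> p" for q
    using that p primes_coprime[of p q] by (intro divides_mult) auto
  show ?thesis
  proof (cases "\<exists>q\<in>primes3 p ((real p)\<^sup>2). q dvd m")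
    case True
    then obtain q where q: "q \<in> primes3 p ((real p)\<^sup>2)" "q dvd m" by blast
    have "q > p" "prime q" using q by (auto simp: primes3_def)
    hence "q \<in> near T p" using q pT p1 by (auto simp: near_def primes3_def)
    moreover have "?g q = 1" using mult[of q] q \<open>q > p\<close> \<open>prime q\<close> by (simp add: weight_def)
    ultimately have "1 \<le> (\<Sum>q\<in>near T p. ?g q)"
      using member_le_sum[of q "near T p" ?g] fin g0 by simp
    moreover have "0 \<le> (\<Sum>q\<in>below T p. ?g q)" using g0 by (intro sum_nonneg) auto
    ultimately show ?thesis by linarith
  next
    case False
    let ?D = "{q \<in> primes3 0 p - {p}. q dvd m}"
    have lp: "ln (real p) > 0" using p1 by simp
    have big: "24 / 25 * ln p < (\<Sum>q\<in>?D. ln q)" using p False by (auto simp: lacunary_at_def)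
    have D: "q < p" "prime q" "p * q dvd m" "q \<in> near T p \<union> below T p" if "q \<in> ?D" for q
    proof -
      show "q < p" "prime q" using that by (auto simp: primes3_def)
      thus "p * q dvd m" using mult that by auto
      have "real q \<le> (real p)\<^sup>2"
      proof -
        have "real q \<le> real p * 1" using \<open>q < p\<close> by simp
        also have "\<dots> \<le> real p * real p" using p1 by (intro mult_left_mono) auto
        finally show ?thesis by (simp add: power2_eq_square)
      qed
      thus "q \<in> near T p \<union> below T p" using that by (auto simp: near_def below_def primes3_def)
    qed
    have "1 \<le> 25 / 24 / ln p * (\<Sum>q\<in>?D. ln q)"
      using big lp by (simp add: field_simps)
    also have "\<dots> = (\<Sum>q\<in>?D. ?g q)"
      unfolding sum_distrib_left by (intro sum.cong refl) (use D in \<open>auto simp: weight_def\<close>)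
    also have "\<dots> \<le> (\<Sum>q\<in>near T p \<union> below T p. ?g q)"
      using fin g0 D(4) by (intro sum_mono2) auto
    also have "\<dots> = (\<Sum>q\<in>near T p. ?g q) + (\<Sum>q\<in>below T p. ?g q)"
      using fin by (intro sum.union_disjoint) (auto simp: near_def below_def primes3_def)
    finally show ?thesis .
  qed
qed

text \<open>If no \<open>p\<close> in \<open>J\<close> is lacunary, the number \<open>NJ\<close> of
  divisors from \<open>J\<close> is at most \<open>Vn + Vf\<close>. Since \<open>NJ\<close>
  concentrates at its mean, \<open>Vn\<close> concentrates at a mean of at most 19/20 of it, and
  \<open>Vf\<close> is rarely large by Markov's inequality, one of three rare events must
  occur.\<close>

lemma exists_lacunary_prime_scale:
  fixes N n :: nat and C T M \<Lambda> :: real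
  assumes C: "C \<ge> 1"
    and mertens: "\<And>u v. 1 \<le> u \<Longrightarrow> u \<le> v \<Longrightarrow> \<bar>(\<Sum>p\<in>primes3 u v. ln p / p) - ln (v / u) / 2\<bar> \<le> C"
    and T: "T \<ge> 2" and N: "N \<ge> 1"
  defines "X \<equiv> real N powr (1 / 12)"
  defines "u \<equiv> X powr (1 / 2 ^ n)"
  defines "J \<equiv> primes3 u X"
  defines "\<Lambda> \<equiv> \<Sum>p\<in>J. 1 / real p"
  defines "S \<equiv> T\<^sup>2 + 1"
  assumes M: "240 * C * T\<^sup>2 \<le> ln u" and L: "\<Lambda> \<ge> 1"
  shows "real (card {m \<in> {1..N}. \<forall>p\<in>J. \<not> lacunary_at m p}) \<le>
    N * (100 / T + 2500 * (16 * (1 + S) * S + 20) / \<Lambda>)"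
proof -
  have T2: "T\<^sup>2 \<ge> 4" "T\<^sup>2 \<ge> 2 * T"
    using T power_mono[of 2 T 2] mult_right_mono[of 2 T T] by (auto simp: power2_eq_square)
  have CT: "240 * C * T\<^sup>2 \<ge> 960 * C" "240 * C * T\<^sup>2 \<ge> 480 * C * T"
    using C T2 mult_left_mono[of 4 "T\<^sup>2" "240 * C"] mult_left_mono[of "2 * T" "T\<^sup>2" "240 * C"] by auto
  have lnJ: "ln (real p) \<ge> 240 * C * T\<^sup>2" "ln (real p) \<ge> 960 * C" "ln (real p) > 0" "p > 1" if "p \<in> J" for p
  proof -
    have "ln u > 0" using M CT C by linarith
    moreover have "u > 0" using N by (simp add: u_def X_def)
    ultimately have u: "u > 1" by simp
    show "p > 1" using that primes3_ge_3[of p u X] by (simp add: J_def)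
    have "ln u \<le> ln (real p)" using that u by (auto simp: J_def primes3_def)
    thus "ln (real p) \<ge> 240 * C * T\<^sup>2" "ln (real p) \<ge> 960 * C" "ln (real p) > 0"
      using M CT C by linarith+
  qed
  have prJ: "prime p" "p mod 4 = 3" if "p \<in> J" for p using that by (auto simp: J_def primes3_def)
  have X: "X \<ge> 1" using N by (simp add: X_def ge_one_powr_ge_zero)
  \<comment> \<open>The exponent 1/12 is chosen for the rounding error: at most X^3 pairs occur,
    their error is of order X^6, and \<open>N\<close> absorbs it.\<close>
  have "X ^ 12 = X powr real 12" using X by (intro powr_realpow[symmetric]) simp
  hence NX: "real N = X ^ 12" using N by (simp add: X_def powr_powr)
  have "S \<ge> 0" by (simp add: S_def)
  let ?w = "\<lambda>m p q. if p * q dvd m then weight (p, q) else 0"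
  define NJ where "NJ = (\<lambda>m. \<Sum>p\<in>J. if p dvd m then 1 else (0::real))"
  define I where "I = (SIGMA p:J. near T p)"
  define Vn where "Vn = (\<lambda>m. \<Sum>(p, q)\<in>I. ?w m p q)"
  define Vf where "Vf = (\<lambda>m. \<Sum>p\<in>J. \<Sum>q\<in>below T p. ?w m p q)"
  have finJ: "finite J" by (simp add: J_def)
  have finn: "finite (near T p)" "finite (below T p)" for p by (auto simp: near_def below_def)
  have finI: "finite I" using finJ finn by (auto simp: I_def)
  have Vn: "Vn m = (\<Sum>p\<in>J. \<Sum>q\<in>near T p. ?w m p q)" for m
    unfolding Vn_def I_def using finJ finn by (subst sum.Sigma) auto

  have point: "NJ m \<le> Vn m + Vf m" if "\<forall>p\<in>J. \<not> lacunary_at m p" for m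
    unfolding NJ_def Vn Vf_def sum.distrib[symmetric]
  proof (rule sum_mono)
    fix p assume p: "p \<in> J"
    show "(if p dvd m then 1 else 0) \<le> (\<Sum>q\<in>near T p. ?w m p q) + (\<Sum>q\<in>below T p. ?w m p q)"
    proof (cases "p dvd m")
      case True
      thus ?thesis using not_lacunary_pointwise[of p m T] prJ[OF p] that p T by auto
    next
      case False
      hence "\<not> p * q dvd m" for q by (meson dvd_mult_left)
      thus ?thesis using False by simp
    qed
  qed
  \<comment> \<open>97/100 + 1/100 is below 197/200, so the three alternatives are exhaustive; the
    thresholds leave 3/200 below the mean of \<open>NJ\<close> and 1/50 above the bound 19/20 for
    the mean of \<open>Vn\<close>.\<close>
  have cover: "{m \<in> {1..N}. \<forall>p\<in>J. \<not> lacunary_at m p} \<subseteq>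
     {m \<in> {1..N}. NJ m \<le> 197 / 200 * \<Lambda>} \<union> ({m \<in> {1..N}. 97 / 100 * \<Lambda> \<le> Vn m} \<union> {m \<in> {1..N}. 1 / 100 * \<Lambda> \<le> Vf m})"
  proof
    fix m assume m: "m \<in> {m \<in> {1..N}. \<forall>p\<in>J. \<not> lacunary_at m p}"
    hence "NJ m \<le> Vn m + Vf m" using point by blast
    hence "NJ m \<le> 197 / 200 * \<Lambda> \<or> 97 / 100 * \<Lambda> \<le> Vn m \<or> 1 / 100 * \<Lambda> \<le> Vf m" using L by linarith
    thus "m \<in> {m \<in> {1..N}. NJ m \<le> 197 / 200 * \<Lambda>} \<union> ({m \<in> {1..N}. 97 / 100 * \<Lambda> \<le> Vn m} \<union> {m \<in> {1..N}. 1 / 100 * \<Lambda> \<le> Vf m})"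
      using m by blast
  qed

  have b1: "real (card {m \<in> {1..N}. NJ m \<le> 197 / 200 * \<Lambda>}) \<le> N * (2500 * 6 / \<Lambda>)"
  proof -
    have "real (card J) \<le> X" unfolding J_def using X by (intro card_primes3_le) auto
    also have "X \<le> real N" unfolding NX using X self_le_power[of X 12] by simp
    finally have cJ: "real (card J) \<le> real N" .
    have "real (card {m \<in> {1..N}. NJ m \<le> 197 / 200 * \<Lambda>}) * (3 / 200 * \<Lambda>)\<^sup>2 \<le> N * \<Lambda> + 2 * \<Lambda> * card J"
      unfolding NJ_def \<Lambda>_def using finJ prJ by (intro few_prime_divisors_count) auto
    also have "\<dots> \<le> N * \<Lambda> + 2 * \<Lambda> * N" using cJ L by (intro add_left_mono mult_left_mono) auto
    also have "\<dots> = 3 * N * \<Lambda>" by simp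
    finally have "real (card {m \<in> {1..N}. NJ m \<le> 197 / 200 * \<Lambda>}) * (9 / 40000 * \<Lambda>) * \<Lambda> \<le> 3 * N * \<Lambda>"
      by (simp add: power2_eq_square)
    hence "real (card {m \<in> {1..N}. NJ m \<le> 197 / 200 * \<Lambda>}) * (9 / 40000 * \<Lambda>) \<le> 3 * N"
      using L mult_le_cancel_right_pos[of \<Lambda>] by auto
    hence "real (card {m \<in> {1..N}. NJ m \<le> 197 / 200 * \<Lambda>}) * \<Lambda> \<le> N * (40000 / 3)" by (simp add: mult_ac)
    also have "\<dots> \<le> real N * (2500 * 6)" by (intro mult_left_mono) auto
    finally show ?thesis using L by (simp add: field_simps)
  qed

  \<comment> \<open>The square of \<open>T\<close> in hypothesis \<open>M\<close> is there for
    \<open>q\<close>: its logarithm may be smaller than \<open>ln p\<close> by almost a factor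
    \<open>T\<close> and must still reach \<open>2 * T * C\<close>.\<close>
  have nbr: "q \<in> nbrs T p \<and> p \<in> nbrs T q \<and> prime p \<and> prime q \<and> p > 1 \<and> q > 1 \<and>
      2 * T * C \<le> ln p \<and> 2 * T * C \<le> ln q" if pq: "(p, q) \<in> I" for p q
  proof -
    have p: "p \<in> J" and q: "q \<in> near T p" using pq by (auto simp: I_def)
    have q1: "prime q" "q > 1" using q primes3_ge_3[of q] by (auto simp: near_def primes3_def)
    have qlo: "real p powr (1 / T) < real q" and qhi: "real q \<le> real p powr 2"
      using q lnJ(4)[OF p] by (auto simp: near_def primes3_def)
    have lp: "ln p > 0" "p > 1" using lnJ[OF p] by auto
    have lnlo: "ln p / T < ln q"
    proof -
      have "ln (real p powr (1 / T)) < ln (real q)" using qlo lp q1 by (subst ln_less_cancel_iff) auto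
      thus ?thesis using lp by (simp add: ln_powr)
    qed
    have lnhi: "ln q \<le> 2 * ln p"
    proof -
      have "ln (real q) \<le> ln (real p powr 2)" using qhi q1 lp by (subst ln_le_cancel_iff) auto
      also have "\<dots> = 2 * ln p" using lp by (subst ln_powr) auto
      finally show ?thesis .
    qed
    have powr_less: "real a powr c < real b" if "c * ln a < ln b" "a > 1" "b > 1" for a b :: nat and c
    proof -
      have "ln (real a powr c) < ln (real b)" using that by (simp add: ln_powr)
      thus ?thesis using that by (subst (asm) ln_less_cancel_iff) auto
    qed
    have le_powr: "real b \<le> real a powr c" if "ln b \<le> c * ln a" "a > 1" "b > 1" for a b :: nat and c
    proof -
      have "ln (real b) \<le> ln (real a powr c)" using that by (simp add: ln_powr)
      thus ?thesis using that by (subst (asm) ln_le_cancel_iff) auto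
    qed
    have "1 / (2 * T) * ln p < ln q"
    proof -
      have "1 / (2 * T) * ln p \<le> ln p / T" using T lp by (simp add: field_simps)
      thus ?thesis using lnlo by linarith
    qed
    hence A1: "real p powr (1 / (2 * T)) < real q" using lp q1 by (intro powr_less) auto
    have "2 * ln p \<le> T * ln p" using T lp by (intro mult_right_mono) auto
    hence "ln q \<le> T * ln p" using lnhi by linarith
    hence A2: "real q \<le> real p powr T" using lp q1 by (intro le_powr) auto
    have "1 / (2 * T) * ln q < ln p"
    proof -
      have "1 / (2 * T) * ln q \<le> 1 / (2 * T) * (2 * ln p)" using lnhi T by (intro mult_left_mono) auto
      also have "\<dots> = ln p / T" using T by simp
      also have "\<dots> < ln p" using T lp by (simp add: divide_less_eq)
      finally show ?thesis .
    qed
    hence A3: "real q powr (1 / (2 * T)) < real p" using lp q1 by (intro powr_less) auto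
    have "ln p \<le> T * ln q" using lnlo T by (simp add: divide_less_eq mult.commute)
    hence A4: "real p \<le> real q powr T" using lp q1 by (intro le_powr) auto
    have big: "240 * C * T\<^sup>2 \<le> ln p" using lnJ[OF p] by simp
    have pos: "0 \<le> C * T" "0 \<le> C * T\<^sup>2" using C T by auto
    have "2 * T * C = 2 * (C * T)" "480 * C * T = 480 * (C * T)" "240 * C * T\<^sup>2 = 240 * (C * T\<^sup>2)"
      "2 * T * C * T = 2 * (C * T\<^sup>2)" by (simp_all add: power2_eq_square)
    hence B1: "2 * T * C \<le> ln p" and "2 * T * C * T \<le> ln p" using big CT(2) pos by linarith+
    hence "2 * T * C \<le> ln p / T" using T by (simp add: le_divide_eq)
    hence B2: "2 * T * C \<le> ln q" using lnlo by linarith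
    have "q mod 4 = 3" using q by (auto simp: near_def primes3_def)
    thus ?thesis using A1 A2 A3 A4 B1 B2 prJ[OF p] lp q1 by (simp add: nbrs_def primes3_def)
  qed
  have Sbd: "(\<Sum>r\<in>nbrs T s. 1 / real r) \<le> S" if "s > 1" "2 * T * C \<le> ln s" for s
    unfolding S_def using sum_inverse_nbrs_le[OF C mertens] T that by auto

  \<comment> \<open>The main terms 25/48 and 5/12 add to 45/48. The error is
    \<open>73/24 * (C / ln p)\<close>, and \<open>ln p \<ge> 960 * C\<close> keeps the total below
    19/20.\<close>
  have mean: "(\<Sum>(p, q)\<in>I. weight (p, q) / real (p * q)) \<le> 19 / 20 * \<Lambda>"
  proof -
    have "(\<Sum>(p, q)\<in>I. weight (p, q) / real (p * q)) = (\<Sum>p\<in>J. \<Sum>q\<in>near T p. weight (p, q) / real (p * q))"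
      unfolding I_def using finJ finn by (subst sum.Sigma) auto
    also have "\<dots> \<le> (\<Sum>p\<in>J. 1 / real p * (19 / 20))"
    proof (rule sum_mono)
      fix p assume p: "p \<in> J"
      have lp: "ln p > 0" "p > 1" "ln p \<ge> 960 * C" using lnJ[OF p] by auto
      let ?A = "primes3 0 p - {p}" and ?B = "primes3 p ((real p)\<^sup>2)"
      have "(\<Sum>q\<in>near T p. weight (p, q) / q) \<le> (\<Sum>q\<in>?A \<union> ?B. weight (p, q) / q)"
      proof (rule sum_mono2)
        fix q assume "q \<in> ?A \<union> ?B - near T p"
        hence "q > 1" using primes3_ge_3[of q] by fastforce
        thus "0 \<le> weight (p, q) / q" using weight_bounds[of p q] lp by simp
      qed (auto simp: near_def primes3_def)
      also have "\<dots> = (\<Sum>q\<in>?A. weight (p, q) / q) + (\<Sum>q\<in>?B. weight (p, q) / q)"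
        by (rule sum.union_disjoint) (auto simp: primes3_def)
      also have "(\<Sum>q\<in>?B. weight (p, q) / q) = (\<Sum>q\<in>?B. 1 / q)"
        by (intro sum.cong refl) (auto simp: weight_def primes3_def)
      also have "\<dots> \<le> 5 / 12 + 2 * C / ln p"
        using sum_inverse_above_le[OF C mertens] lp C by auto
      also have "(\<Sum>q\<in>?A. weight (p, q) / q) = 25 / 24 / ln p * (\<Sum>q\<in>?A. ln q / q)"
        unfolding sum_distrib_left by (intro sum.cong refl) (auto simp: weight_def primes3_def)
      also have "\<dots> \<le> 25 / 24 / ln p * (ln p / 2 + C)"
      proof (rule mult_left_mono)
        have "(\<Sum>q\<in>?A. ln q / q) \<le> (\<Sum>q\<in>primes3 0 p. ln q / q)"
        proof (rule sum_mono2)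
          fix q assume "q \<in> primes3 0 p - ?A"
          hence "q \<ge> 3" using primes3_ge_3[of q] by blast
          thus "0 \<le> ln (real q) / real q" by simp
        qed auto
        also have "\<dots> \<le> ln p / 2 + C" using sum_ln_over_primes3_le[OF C mertens] lp by auto
        finally show "(\<Sum>q\<in>?A. ln q / q) \<le> ln p / 2 + C" .
      qed (use lp in auto)
      also have "25 / 24 / ln p * (ln p / 2 + C) = 25 / 48 + 25 / 24 * (C / ln p)"
        using lp by (simp add: field_simps)
      finally have "(\<Sum>q\<in>near T p. weight (p, q) / q) \<le> 45 / 48 + 73 / 24 * (C / ln p)" by simp
      moreover have "C / ln p \<le> 1 / 960" using lp by (simp add: divide_le_eq)
      ultimately have "(\<Sum>q\<in>near T p. weight (p, q) / q) \<le> 19 / 20" by linarith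
      hence "1 / real p * (\<Sum>q\<in>near T p. weight (p, q) / q) \<le> 1 / real p * (19 / 20)" by (intro mult_left_mono) auto
      thus "(\<Sum>q\<in>near T p. weight (p, q) / real (p * q)) \<le> 1 / real p * (19 / 20)"
        by (simp add: sum_distrib_left)
    qed
    also have "\<dots> = 19 / 20 * \<Lambda>" unfolding \<Lambda>_def sum_distrib_left by (simp only: mult.commute)
    finally show ?thesis .
  qed

  have b2: "real (card {m \<in> {1..N}. 97 / 100 * \<Lambda> \<le> Vn m}) \<le> N * (2500 * (16 * (1 + S) * S + 8) / \<Lambda>)"
  proof -
    have "real (card {m \<in> {1..N}. 97 / 100 * \<Lambda> \<le> Vn m}) * (1 / 50 * \<Lambda>)\<^sup>2
       \<le> N * (16 * (1 + S) * (\<Sum>(p, q)\<in>I. 1 / real (p * q))) + 8 * (real (card I))\<^sup>2"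
      unfolding Vn_def
    proof (rule many_close_pairs_count[where R = "nbrs T"])
      show "0 \<le> weight x \<and> weight x \<le> 2" if "x \<in> I" for x
        using nbr[of "fst x" "snd x"] weight_bounds[of "fst x" "snd x"] that by auto
      show "(\<Sum>r\<in>nbrs T p. 1 / real r) \<le> S \<and> (\<Sum>r\<in>nbrs T q. 1 / real r) \<le> S" if "(p, q) \<in> I" for p q
        using nbr[OF that] Sbd[of p] Sbd[of q] by blast
      show "prime p \<and> prime q \<and> q \<in> nbrs T p \<and> p \<in> nbrs T q" if "(p, q) \<in> I" for p q
        using nbr[OF that] by blast
      show "finite (nbrs T s)" for s by (simp add: nbrs_def)
      show "prime r" if "r \<in> nbrs T s" for r s using that by (simp add: nbrs_def primes3_def)
    qed (use finI mean L \<open>S \<ge> 0\<close> in auto)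
    also have "\<dots> \<le> N * (16 * (1 + S) * (S * \<Lambda>)) + 8 * real N"
    proof (intro add_mono mult_left_mono)
      have "(\<Sum>(p, q)\<in>I. 1 / real (p * q)) = (\<Sum>p\<in>J. \<Sum>q\<in>near T p. 1 / real (p * q))"
        unfolding I_def using finJ finn by (subst sum.Sigma) auto
      also have "\<dots> \<le> (\<Sum>p\<in>J. S * (1 / real p))"
      proof (rule sum_mono)
        fix p assume p: "p \<in> J"
        have sub: "near T p \<subseteq> nbrs T p" using nbr p by (auto simp: I_def)
        have lp: "p > 1" "2 * T * C \<le> ln p"
        proof -
          show "p > 1" using lnJ[OF p] by simp
          have "2 * T * C \<le> 480 * C * T" using C T by simp
          thus "2 * T * C \<le> ln p" using lnJ(1)[OF p] CT(2) by linarith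
        qed
        have "(\<Sum>q\<in>near T p. 1 / real q) \<le> (\<Sum>q\<in>nbrs T p. 1 / real q)"
          using sub by (intro sum_mono2) (auto simp: nbrs_def)
        also have "\<dots> \<le> S" using Sbd lp by blast
        finally have "1 / real p * (\<Sum>q\<in>near T p. 1 / real q) \<le> 1 / real p * S" by (intro mult_left_mono) auto
        thus "(\<Sum>q\<in>near T p. 1 / real (p * q)) \<le> S * (1 / real p)"
          by (simp add: sum_distrib_left mult.commute)
      qed
      also have "\<dots> = S * \<Lambda>" by (simp add: \<Lambda>_def sum_distrib_left)
      finally show "(\<Sum>(p, q)\<in>I. 1 / real (p * q)) \<le> S * \<Lambda>" .
      have "I \<subseteq> J \<times> primes3 0 (X\<^sup>2)"
      proof
        fix x assume "x \<in> I"
        then obtain p q where x: "x = (p, q)" "p \<in> J" "q \<in> near T p" by (auto simp: I_def)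
        have "real q \<le> (real p)\<^sup>2" using x(3) by (simp add: near_def primes3_def)
        also have "\<dots> \<le> X\<^sup>2" using x(2) by (intro power_mono) (auto simp: J_def primes3_def)
        finally show "x \<in> J \<times> primes3 0 (X\<^sup>2)" using x by (auto simp: near_def primes3_def prime_gt_0_nat)
      qed
      hence "card I \<le> card (J \<times> primes3 0 (X\<^sup>2))" using finJ by (intro card_mono) auto
      also have "\<dots> = card J * card (primes3 0 (X\<^sup>2))" by (rule card_cartesian_product)
      finally have "real (card I) \<le> real (card J) * real (card (primes3 0 (X\<^sup>2)))"
        by (metis of_nat_mono of_nat_mult)
      also have "\<dots> \<le> X * X\<^sup>2"
        unfolding J_def using X by (intro mult_mono card_primes3_le) auto
      finally have "(real (card I))\<^sup>2 \<le> (X * X\<^sup>2)\<^sup>2" by (intro power_mono) auto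
      also have "\<dots> = X ^ 6" by (simp add: power_mult_distrib flip: power_mult power_add)
      also have "\<dots> \<le> X ^ 12" using X by (intro power_increasing) auto
      finally show "(real (card I))\<^sup>2 \<le> real N" by (simp add: NX)
    qed (use \<open>S \<ge> 0\<close> in auto)
    also have "\<dots> \<le> N * (16 * (1 + S) * (S * \<Lambda>)) + 8 * real N * \<Lambda>"
      using L mult_left_mono[of 1 \<Lambda> "8 * real N"] by simp
    also have "\<dots> = N * (16 * (1 + S) * S + 8) * \<Lambda>" by (simp add: algebra_simps)
    finally have "real (card {m \<in> {1..N}. 97 / 100 * \<Lambda> \<le> Vn m}) * (\<Lambda> / 2500) * \<Lambda> \<le> N * (16 * (1 + S) * S + 8) * \<Lambda>"
      by (simp add: power2_eq_square)
    hence "real (card {m \<in> {1..N}. 97 / 100 * \<Lambda> \<le> Vn m}) * (\<Lambda> / 2500) \<le> N * (16 * (1 + S) * S + 8)"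
      using L by (simp only: mult_le_cancel_right_pos)
    thus ?thesis using L by (simp add: field_simps)
  qed

  \<comment> \<open>Up to \<open>p powr (1 / T)\<close> the sum of \<open>ln q / q\<close> is about
    \<open>ln p / (2 * T)\<close>, so \<open>Vf\<close> has mean at most 1 / T times that of
    \<open>NJ\<close>, and Markov's inequality at 1/100 of the latter gives 100 / T.\<close>
  have b3: "real (card {m \<in> {1..N}. 1 / 100 * \<Lambda> \<le> Vf m}) \<le> N * (100 / T)"
  proof -
    have w0: "0 \<le> weight (p, q)" if "p \<in> J" "q \<in> below T p" for p q
    proof -
      have "q \<ge> 3" using primes3_ge_3 that(2) unfolding below_def by blast
      thus ?thesis using weight_bounds[of p q] lnJ(4)[OF that(1)] by simp
    qed
    have "real (card {m \<in> {1..N}. 1 / 100 * \<Lambda> \<le> Vf m}) * (1 / 100 * \<Lambda>) \<le> (\<Sum>m\<in>{1..N}. Vf m)"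
      unfolding Vf_def using w0 by (intro markov_count sum_nonneg) auto
    also have "\<dots> = (\<Sum>p\<in>J. \<Sum>q\<in>below T p. \<Sum>m\<in>{1..N}. ?w m p q)"
      unfolding Vf_def by (subst sum.swap, rule sum.cong[OF refl], rule sum.swap)
    also have "\<dots> \<le> (\<Sum>p\<in>J. N * (1 / T * (1 / real p)))"
    proof (rule sum_mono)
      fix p assume p: "p \<in> J"
      have lp: "ln p > 0" "p > 1" "480 * C * T \<le> ln p" using lnJ[OF p] CT(2) by auto
      have lt: "q < p" "q > 1" if "q \<in> below T p" for q
      proof -
        have "real q \<le> real p powr (1 / T)" using that by (auto simp: below_def primes3_def)
        also have "\<dots> < real p powr 1" using T lp by (intro powr_less_mono) auto
        finally show "q < p" using lp by simp
        have "q \<ge> 3" using primes3_ge_3 that unfolding below_def by blast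
        thus "q > 1" by simp
      qed
      have "(\<Sum>q\<in>below T p. \<Sum>m\<in>{1..N}. ?w m p q) = (\<Sum>q\<in>below T p. weight (p, q) * real (N div (p * q)))"
        using lt lp by (intro sum.cong refl sum_dvd_indicator) fastforce
      also have "\<dots> \<le> (\<Sum>q\<in>below T p. weight (p, q) * (N / real (p * q)))"
        using w0[OF p] by (intro sum_mono mult_left_mono of_nat_div_le_of_nat) auto
      also have "\<dots> = (\<Sum>q\<in>below T p. N / p * (25 / 24) / ln p * (ln q / q))"
        by (intro sum.cong refl) (use lt in \<open>auto simp: weight_def mult_ac\<close>)
      also have "\<dots> = N / p * (25 / 24) / ln p * (\<Sum>q\<in>below T p. ln q / q)" by (simp only: sum_distrib_left)
      also have "\<dots> \<le> N / p * (25 / 24) / ln p * (ln p / T / 2 + C)"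
      proof (rule mult_left_mono)
        have "1 \<le> real p powr (1 / T)" using lp T by (intro ge_one_powr_ge_zero) auto
        from sum_ln_over_primes3_le[OF C _ this] have "(\<Sum>q\<in>below T p. ln q / q) \<le> ln (real p powr (1 / T)) / 2 + C"
          unfolding below_def using mertens by blast
        thus "(\<Sum>q\<in>below T p. ln q / q) \<le> ln p / T / 2 + C" using lp by (simp add: ln_powr)
      qed (use lp in auto)
      also have "\<dots> = N * (1 / real p) * (25 / 24 * (1 / (2 * T) + C / ln p))" using lp by (simp add: field_simps)
      also have "\<dots> \<le> N * (1 / real p) * (1 / T)"
      proof (rule mult_left_mono)
        have "C / ln p \<le> 1 / (480 * T)" using lp T C by (simp add: divide_le_eq field_simps)
        hence "25 / 24 * (1 / (2 * T) + C / ln p) \<le> 25 / 24 * (1 / (2 * T) + 1 / (480 * T))" by (intro mult_left_mono add_left_mono) auto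
        also have "\<dots> = 25 / 24 * (241 / 480) * (1 / T)" using T by (simp add: field_simps)
        also have "\<dots> \<le> 1 * (1 / T)" using T by (intro mult_right_mono) auto
        finally show "25 / 24 * (1 / (2 * T) + C / ln p) \<le> 1 / T" by simp
      qed auto
      finally show "(\<Sum>q\<in>below T p. \<Sum>m\<in>{1..N}. ?w m p q) \<le> N * (1 / T * (1 / real p))" by (simp add: mult_ac)
    qed
    also have "\<dots> = N * (1 / T) * \<Lambda>" by (simp add: \<Lambda>_def sum_distrib_left mult_ac)
    finally have "real (card {m \<in> {1..N}. 1 / 100 * \<Lambda> \<le> Vf m}) * (1 / 100) * \<Lambda> \<le> N * (1 / T) * \<Lambda>" by simp
    hence "real (card {m \<in> {1..N}. 1 / 100 * \<Lambda> \<le> Vf m}) * (1 / 100) \<le> N * (1 / T)"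
      using L by (simp only: mult_le_cancel_right_pos)
    thus ?thesis by simp
  qed

  have "real (card {m \<in> {1..N}. \<forall>p\<in>J. \<not> lacunary_at m p}) \<le>
      real (card ({m \<in> {1..N}. NJ m \<le> 197 / 200 * \<Lambda>} \<union> ({m \<in> {1..N}. 97 / 100 * \<Lambda> \<le> Vn m} \<union> {m \<in> {1..N}. 1 / 100 * \<Lambda> \<le> Vf m})))"
    using cover by (intro of_nat_mono card_mono) auto
  also have "\<dots> \<le> real (card {m \<in> {1..N}. NJ m \<le> 197 / 200 * \<Lambda>}) +
      (real (card {m \<in> {1..N}. 97 / 100 * \<Lambda> \<le> Vn m}) + real (card {m \<in> {1..N}. 1 / 100 * \<Lambda> \<le> Vf m}))"
    using card_Un_le[of "{m \<in> {1..N}. NJ m \<le> 197 / 200 * \<Lambda>}"] card_Un_le[of "{m \<in> {1..N}. 97 / 100 * \<Lambda> \<le> Vn m}"]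
    by (smt (verit, best) of_nat_add of_nat_mono)
  also have "\<dots> \<le> N * (2500 * 6 / \<Lambda>) + (N * (2500 * (16 * (1 + S) * S + 8) / \<Lambda>) + N * (100 / T))"
    by (intro add_mono b1 b2 b3)
  also have "\<dots> = N * (100 / T + 2500 * (16 * (1 + S) * S + 14) / \<Lambda>)"
    by (simp add: algebra_simps add_divide_distrib)
  also have "\<dots> \<le> N * (100 / T + 2500 * (16 * (1 + S) * S + 20) / \<Lambda>)"
    using L by (intro mult_left_mono add_left_mono divide_right_mono) auto
  finally show ?thesis .
qed

text \<open>The parameters are fixed in the order \<open>T\<close>, \<open>n\<close>,
  \<open>\<eta>\<close>, \<open>N0\<close>: \<open>T\<close> makes the first-moment term at most
  half of \<open>\<delta>\<close>, \<open>n\<close> makes the sum of reciprocals large enough for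
  the variance terms, \<open>\<eta>\<close> turns the lower end of the window into
  \<open>N powr \<eta>\<close>, and \<open>N0\<close> makes that end large compared with
  \<open>C * T^2\<close>.\<close>

lemma lacunary_prime_exists_almost_all:
  fixes \<delta> :: real
  assumes \<delta>: "\<delta> > 0"
  shows "\<exists>\<eta>>0. \<exists>N0. \<forall>N\<ge>N0.
    real (card {m \<in> {1..N}. \<forall>p. real N powr \<eta> < real p \<longrightarrow> \<not> lacunary_at m p}) \<le> \<delta> * real N"
proof -
  obtain C where C: "C \<ge> 1" and mertens:
    "\<And>u v. 1 \<le> u \<Longrightarrow> u \<le> v \<Longrightarrow> \<bar>(\<Sum>p\<in>primes3 u v. ln p / p) - ln (v / u) / 2\<bar> \<le> C"
    using mertens_3mod4 by blast
  define T where "T = max 2 (200 / \<delta>)"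
  define S where "S = T\<^sup>2 + 1"
  define B where "B = 2500 * (16 * (1 + S) * S + 20)"
  define n where "n = nat \<lceil>8 * max 1 (2 * B / \<delta>)\<rceil>"
  define \<eta> where "\<eta> = 1 / (12 * 2 ^ n :: real)"
  define N0 where "N0 = nat \<lceil>exp (240 * C * T\<^sup>2 / \<eta>)\<rceil> + 1"
  have T: "T \<ge> 2" "100 / T \<le> \<delta> / 2"
  proof -
    show T2: "T \<ge> 2" by (simp add: T_def)
    have "200 / \<delta> \<le> T" by (simp add: T_def)
    thus "100 / T \<le> \<delta> / 2" using \<delta> T2 by (simp add: field_simps)
  qed
  have B: "B > 0" by (simp add: B_def S_def add_nonneg_pos)
  have \<eta>: "\<eta> > 0" by (simp add: \<eta>_def)
  have n: "max 1 (2 * B / \<delta>) \<le> real n / 8" unfolding n_def by linarith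
  have "real (card {m \<in> {1..N}. \<forall>p. real N powr \<eta> < real p \<longrightarrow> \<not> lacunary_at m p}) \<le> \<delta> * N"
    if N: "N \<ge> N0" for N
  proof -
    define X where "X = real N powr (1 / 12)"
    define J where "J = primes3 (X powr (1 / 2 ^ n)) X"
    define \<Lambda> where "\<Lambda> = (\<Sum>p\<in>J. 1 / real p)"
    have N1: "N \<ge> 1" using N by (simp add: N0_def)
    have "exp (240 * C * T\<^sup>2 / \<eta>) \<le> real N" using N unfolding N0_def by linarith
    hence "ln (exp (240 * C * T\<^sup>2 / \<eta>)) \<le> ln (real N)" using N1 by (subst ln_le_cancel_iff) auto
    hence lnN: "240 * C * T\<^sup>2 \<le> \<eta> * ln (real N)" using \<eta> by (simp add: divide_le_eq mult.commute)
    have u: "X powr (1 / 2 ^ n) = real N powr \<eta>" by (simp add: X_def \<eta>_def powr_powr)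
    have lnu: "ln (X powr (1 / 2 ^ n)) = \<eta> * ln (real N)" unfolding u using N1 by (simp add: ln_powr)
    have lnX: "ln X / 2 ^ n = \<eta> * ln (real N)" using N1 by (simp add: X_def \<eta>_def ln_powr)
    have big: "240 * C * T\<^sup>2 \<ge> 960 * C"
      using C mult_left_mono[OF power_mono[OF T(1), of 2], of "240 * C"] by simp
    have "X > 1"
    proof -
      have "0 < \<eta> * ln (real N)" using lnN big C by linarith
      hence "ln X / 2 ^ n > 0" using lnX by simp
      hence "ln X > 0" by (simp add: zero_less_divide_iff)
      moreover have "X > 0" using N1 by (simp add: X_def)
      ultimately show ?thesis by simp
    qed
    have "real n / 8 \<le> \<Lambda>"
    proof -
      have "8 * C \<le> ln X / 2 ^ n" using lnN big C lnX by linarith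
      thus ?thesis
        unfolding \<Lambda>_def J_def by (intro sum_inverse_primes3_large[OF C mertens] \<open>X > 1\<close>) auto
    qed
    hence L: "\<Lambda> \<ge> 1" "2 * B / \<delta> \<le> \<Lambda>" using n by auto
    have "real (card {m \<in> {1..N}. \<forall>p. real N powr \<eta> < real p \<longrightarrow> \<not> lacunary_at m p}) \<le>
        real (card {m \<in> {1..N}. \<forall>p\<in>J. \<not> lacunary_at m p})"
      by (intro of_nat_mono card_mono) (auto simp: J_def u primes3_def)
    also have "\<dots> \<le> N * (100 / T + B / \<Lambda>)"
      unfolding J_def X_def B_def S_def \<Lambda>_def
    proof (rule exists_lacunary_prime_scale[OF C _ T(1) N1])
      show "240 * C * T\<^sup>2 \<le> ln ((real N powr (1 / 12)) powr (1 / 2 ^ n))"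
        using lnN lnu by (simp add: X_def)
      show "1 \<le> (\<Sum>p\<in>primes3 ((real N powr (1 / 12)) powr (1 / 2 ^ n)) (real N powr (1 / 12)). 1 / real p)"
        using L(1) by (simp add: \<Lambda>_def J_def X_def)
    qed (use mertens in blast)
    also have "\<dots> \<le> N * (\<delta> / 2 + \<delta> / 2)"
    proof (intro mult_left_mono add_mono T)
      have "2 * B \<le> \<delta> * \<Lambda>" using L(2) \<delta> by (simp add: divide_le_eq mult.commute)
      thus "B / \<Lambda> \<le> \<delta> / 2" using L(1) by (simp add: divide_le_eq)
    qed auto
    also have "\<dots> = \<delta> * N" by simp
    finally show ?thesis .
  qed
  thus ?thesis using \<eta> by blast
qed

text \<open>A union bound over \<open>d\<close>, with 1 / d^2 at most 1 / (d - 1) - 1 / d.\<close>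

lemma large_square_divisor_count:
  assumes "D \<ge> 1"
  shows "real (card {m \<in> {1..N}. \<exists>d>D. d\<^sup>2 dvd m}) \<le> real N / real D"
proof -
  have tel: "(\<Sum>d\<in>{Suc D..D + n}. 1 / (real d)\<^sup>2) \<le> 1 / real D - 1 / real (D + n)" for n
  proof (induction n)
    case (Suc n)
    define a where "a = real (D + n)"
    have a: "a > 0" using assms by (simp add: a_def)
    have Sa: "real (Suc (D + n)) = a + 1" by (simp add: a_def)
    have "1 / (a + 1)\<^sup>2 \<le> 1 / (a * (a + 1))"
      unfolding power2_eq_square using a by (intro divide_left_mono mult_right_mono) auto
    also have "\<dots> = 1 / a - 1 / (a + 1)"
      using a by (simp add: field_simps)
    finally have step: "1 / (a + 1)\<^sup>2 \<le> 1 / a - 1 / (a + 1)" .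
    have "{Suc D..D + Suc n} = insert (Suc (D + n)) {Suc D..D + n}" by auto
    hence "(\<Sum>d\<in>{Suc D..D + Suc n}. 1 / (real d)\<^sup>2) = (\<Sum>d\<in>{Suc D..D + n}. 1 / (real d)\<^sup>2) + 1 / (a + 1)\<^sup>2"
      by (simp only: Sa[symmetric]) simp
    also have "\<dots> \<le> (1 / real D - 1 / a) + (1 / a - 1 / (a + 1))"
      using Suc step by (intro add_mono) (simp_all add: a_def)
    also have "\<dots> = 1 / real D - 1 / real (D + Suc n)" by (simp add: a_def)
    finally show ?case .
  qed simp
  have "{m \<in> {1..N}. \<exists>d>D. d\<^sup>2 dvd m} \<subseteq> (\<Union>d\<in>{Suc D..D + N}. {m \<in> {1..N}. d\<^sup>2 dvd m})"
  proof
    fix m assume "m \<in> {m \<in> {1..N}. \<exists>d>D. d\<^sup>2 dvd m}"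
    then obtain d where d: "1 \<le> m" "m \<le> N" "d > D" "d\<^sup>2 dvd m" by auto
    have "d \<le> d\<^sup>2" by (simp add: power2_eq_square)
    also have "\<dots> \<le> m" using d by (intro dvd_imp_le) auto
    finally have "d \<in> {Suc D..D + N}" using d by simp
    moreover have "m \<in> {m \<in> {1..N}. d\<^sup>2 dvd m}" using d by simp
    ultimately show "m \<in> (\<Union>d\<in>{Suc D..D + N}. {m \<in> {1..N}. d\<^sup>2 dvd m})" by (rule UN_I)
  qed
  hence "card {m \<in> {1..N}. \<exists>d>D. d\<^sup>2 dvd m} \<le> card (\<Union>d\<in>{Suc D..D + N}. {m \<in> {1..N}. d\<^sup>2 dvd m})"
    by (rule card_mono[rotated]) simp
  also have "\<dots> \<le> (\<Sum>d\<in>{Suc D..D + N}. card {m \<in> {1..N}. d\<^sup>2 dvd m})" by (rule card_UN_le) simp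
  finally have "real (card {m \<in> {1..N}. \<exists>d>D. d\<^sup>2 dvd m}) \<le> real (\<Sum>d\<in>{Suc D..D + N}. card {m \<in> {1..N}. d\<^sup>2 dvd m})"
    by (rule of_nat_mono)
  also have "\<dots> = (\<Sum>d\<in>{Suc D..D + N}. real (card {m \<in> {1..N}. d\<^sup>2 dvd m}))" by (rule of_nat_sum)
  also have "\<dots> \<le> (\<Sum>d\<in>{Suc D..D + N}. N * (1 / (real d)\<^sup>2))"
  proof (rule sum_mono)
    fix d assume d: "d \<in> {Suc D..D + N}"
    have "real (card {m \<in> {1..N}. d\<^sup>2 dvd m}) = (\<Sum>m\<in>{1..N}. if d\<^sup>2 dvd m then 1 else 0)"
      using sum.inter_filter[of "{1..N}" "\<lambda>_. 1 :: real" "\<lambda>m. d\<^sup>2 dvd m"] by simp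
    also have "\<dots> = real (N div d\<^sup>2)" using sum_dvd_indicator[of "d\<^sup>2" "1::real" N] d by simp
    also have "\<dots> \<le> N / real (d\<^sup>2)" by (rule of_nat_div_le_of_nat)
    finally show "real (card {m \<in> {1..N}. d\<^sup>2 dvd m}) \<le> N * (1 / (real d)\<^sup>2)" by simp
  qed
  also have "\<dots> = N * (\<Sum>d\<in>{Suc D..D + N}. 1 / (real d)\<^sup>2)" by (simp only: sum_distrib_left)
  also have "\<dots> \<le> N * (1 / real D - 1 / real (D + N))" by (intro mult_left_mono tel) auto
  also have "\<dots> \<le> N * (1 / real D)" by (intro mult_left_mono) auto
  finally show ?thesis by simp
qed

section \<open>The bound for almost all moduli\<close>

text \<open>The saving is the ratio of the discarded divisor to the lower bound \<open>y\<close> for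
  the primes of \<open>K\<close>. Up to a factor depending on \<open>D\<close>, the divisor is at
  most \<open>p powr (24/25)\<close> with \<open>y = p\<close>, or has one further factor
  \<open>p\<close> with \<open>y = p^2\<close>: in both cases \<open>p powr (- 1/25)\<close>
  remains. All primes of \<open>K\<close> are at least \<open>p\<close> and their product divides
  \<open>m < p ^ k\<close>, so \<open>K\<close> has at most \<open>k\<close> elements.\<close>

lemma card_le_of_lacunary:
  fixes m p D k :: nat
  defines "R \<equiv> residue_ring (int m)"
  assumes m: "m > 1" "m < p ^ k" and lac: "lacunary_at m p"
    and sq: "\<And>d. d\<^sup>2 dvd m \<Longrightarrow> d \<le> D" "D < p"
    and A: "A \<subseteq> carrier R" "difference_set R A \<inter> square_set R = {\<zero>\<^bsub>R\<^esub>}"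
  shows "real (card A) \<le> 2 ^ k\<^sup>2 * sqrt m * sqrt (2 * real D ^ 3 * real p powr (- 1 / 25))"
proof -
  define Pm where "Pm = prime_factors m"
  have Pm: "prime q" "q dvd m" "q \<ge> 2" if "q \<in> Pm" for q
    using that prime_ge_2_nat by (auto simp: Pm_def)
  have fin: "finite Pm" by (simp add: Pm_def)
  have p: "prime p" "p mod 4 = 3" "p dvd m" "p \<ge> 2"
    and gap: "\<And>q. q \<in> primes3 p ((real p)\<^sup>2) \<Longrightarrow> \<not> q dvd m"
    and low: "(\<Sum>q\<in>{q \<in> primes3 0 p - {p}. q dvd m}. ln q) \<le> 24 / 25 * ln p"
    using lac prime_ge_2_nat by (auto simp: lacunary_at_def)
  define Kge where "Kge = {q \<in> Pm. q mod 4 = 3 \<and> \<not> q\<^sup>2 dvd m \<and> p \<le> q}"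
  \<comment> \<open>Dropping \<open>p\<close> repairs the parity; by the gap condition the remaining
    primes then exceed p^2, which is the value of \<open>y\<close> in this case.\<close>
  define K where "K = (if odd (card Kge) then Kge else Kge - {p})"
  define y where "y = (if odd (card Kge) then real p else (real p)\<^sup>2)"
  define Q where "Q = {q \<in> Pm. q \<noteq> 2 \<and> \<not> q\<^sup>2 dvd m \<and> (q mod 4 = 1 \<or> q \<in> K)}"
  have finK: "finite Kge" using fin by (simp add: Kge_def)
  \<comment> \<open>If p^2 divided \<open>m\<close>, \<open>p\<close> would be at most
    \<open>D\<close>, contrary to \<open>D < p\<close>.\<close>
  have pK: "p \<in> Kge" using p sq(1)[of p] sq(2) m by (auto simp: Kge_def Pm_def prime_factors_dvd)
  have KQ: "{q \<in> Q. q mod 4 = 3} = K"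
    by (auto simp: Q_def K_def Kge_def split: if_splits)
  have finQ: "finite Q" using fin by (simp add: Q_def)
  have oddK: "odd (card K)"
    using pK finK by (auto simp: K_def card_gt_0_iff)
  have y0: "y > 0" using p by (simp add: y_def)
  have yK: "y \<le> real q" if q: "q \<in> K" for q
  proof (cases "odd (card Kge)")
    case True
    thus ?thesis using q by (auto simp: K_def y_def Kge_def)
  next
    case False
    hence qp: "q > p" "q \<in> Kge" using q by (auto simp: K_def Kge_def)
    hence "q \<notin> primes3 p ((real p)\<^sup>2)" using gap[of q] Pm[of q] by (auto simp: Kge_def)
    hence "\<not> real q \<le> (real p)\<^sup>2" using qp Pm[of q] by (auto simp: primes3_def Kge_def)
    thus ?thesis using False by (simp add: y_def)
  qed
  have KD: "card K \<le> k"
  proof -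
    have Ksub: "K \<subseteq> Pm" by (auto simp: K_def Kge_def)
    have "p ^ card K = (\<Prod>q\<in>K. p)" by simp
    also have "\<dots> \<le> \<Prod>K"
    proof (rule prod_mono)
      have "K \<subseteq> Kge" by (auto simp: K_def)
      thus "0 \<le> p \<and> p \<le> q" if "q \<in> K" for q using that by (auto simp: Kge_def)
    qed
    also have "\<dots> \<le> m"
    proof (rule dvd_imp_le)
      have "\<Prod>K dvd \<Prod>Pm" using Ksub fin by (rule prod_dvd_prod_subset[rotated])
      also have "\<Prod>Pm dvd (\<Prod>q\<in>Pm. q ^ multiplicity q m)"
        using m by (intro prod_dvd_prod) (auto simp: Pm_def prime_factors_multiplicity)
      also have "\<dots> = m" using prime_factorization_nat[of m] m by (simp add: Pm_def)
      finally show "\<Prod>K dvd m" .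
    qed (use m in simp)
    finally have "p ^ card K < p ^ k" using m by linarith
    thus ?thesis using p by (simp add: power_strict_increasing_iff)
  qed
  define D0 where "D0 = (\<Prod>q\<in>Pm - Q. q ^ multiplicity q m)"
  have mult1: "multiplicity q m = 1" if "q \<in> Pm" "\<not> q\<^sup>2 dvd m" for q
  proof -
    have "multiplicity q m < 2" using that m Pm[of q] by (intro multiplicity_lessI) auto
    moreover have "multiplicity q m > 0" using that(1) by (simp add: Pm_def prime_factors_multiplicity)
    ultimately show ?thesis by linarith
  qed
  have mfac: "m = D0 * \<Prod>Q"
  proof -
    have "m = (\<Prod>q\<in>Pm. q ^ multiplicity q m)" using prime_factorization_nat[of m] m by (simp add: Pm_def)
    also have "\<dots> = D0 * (\<Prod>q\<in>Q. q ^ multiplicity q m)"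
      unfolding D0_def using fin by (intro prod.subset_diff) (auto simp: Q_def)
    also have "(\<Prod>q\<in>Q. q ^ multiplicity q m) = \<Prod>Q"
      using mult1 by (intro prod.cong) (auto simp: Q_def)
    finally show ?thesis .
  qed
  have Qprop: "prime q \<and> q > 2 \<and> \<not> q dvd D0" if q: "q \<in> Q" for q
  proof -
    have qp: "prime q" "q \<ge> 2" "q \<noteq> 2" using q Pm[of q] by (auto simp: Q_def)
    have "\<not> q dvd D0"
    proof
      assume "q dvd D0"
      then obtain r where r: "r \<in> Pm - Q" "q dvd r ^ multiplicity r m"
        unfolding D0_def using prime_dvd_prod_iff[of "Pm - Q" q] fin qp by auto
      hence "q dvd r" using qp prime_dvd_power by blast
      hence "q = r" using qp Pm[of r] r primes_dvd_imp_eq by blast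
      thus False using r q by simp
    qed
    thus ?thesis using qp by auto
  qed
  \<comment> \<open>An exponent e of at least 2 satisfies e \<le> 3 * (e div 2), with equality at 3.
    So \<open>d ^ 3\<close> dominates all primes occurring to a higher power, while d^2 divides
    \<open>m\<close> and hence \<open>d \<le> D\<close>.\<close>
  define d where "d = (\<Prod>q\<in>Pm. q ^ (multiplicity q m div 2))"
  have "d\<^sup>2 = (\<Prod>q\<in>Pm. q ^ (2 * (multiplicity q m div 2)))"
    unfolding d_def prod_power_distrib by (simp only: power_mult[symmetric] mult.commute)
  also have "\<dots> dvd (\<Prod>q\<in>Pm. q ^ multiplicity q m)"
    by (intro prod_dvd_prod le_imp_power_dvd) auto
  also have "\<dots> = m" using prime_factorization_nat[of m] m by (simp add: Pm_def)
  finally have dD: "d \<le> D" using sq(1) by blast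
  \<comment> \<open>The discarded simple primes congruent to 3 modulo 4: those below
    \<open>p\<close>, and \<open>p\<close> itself if it was dropped for parity.\<close>
  define B where "B = {q \<in> Pm - Q. q mod 4 = 3 \<and> \<not> q\<^sup>2 dvd m}"
  have D0le: "D0 \<le> 2 * d ^ 3 * \<Prod>B"
  proof -
    have "D0 \<le> (\<Prod>q\<in>Pm - Q. (if q = 2 then 2 else 1) * (q ^ (multiplicity q m div 2)) ^ 3 *
        (if q mod 4 = 3 \<and> \<not> q\<^sup>2 dvd m then q else 1))"
      unfolding D0_def
    proof (intro prod_mono conjI)
      fix q assume q: "q \<in> Pm - Q"
      show "q ^ multiplicity q m \<le> (if q = 2 then 2 else 1) * (q ^ (multiplicity q m div 2)) ^ 3 *
        (if q mod 4 = 3 \<and> \<not> q\<^sup>2 dvd m then q else 1)"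
      proof (cases "q\<^sup>2 dvd m")
        case True
        hence "multiplicity q m \<ge> 2" using Pm[of q] q m by (intro multiplicity_geI) auto
        hence "multiplicity q m \<le> multiplicity q m div 2 * 3" by linarith
        hence "q ^ multiplicity q m \<le> (q ^ (multiplicity q m div 2)) ^ 3"
          using Pm[of q] q by (subst power_mult[symmetric], intro power_increasing) auto
        also have "\<dots> \<le> (if q = 2 then 2 else 1) * (q ^ (multiplicity q m div 2)) ^ 3" by simp
        finally show ?thesis using True by simp
      next
        case False
        have "q = 2 \<or> odd q" using Pm[of q] q prime_odd_nat[of q] by force
        hence "q = 2 \<or> q mod 4 = 1 \<or> q mod 4 = 3" by presburger
        thus ?thesis using False q mult1[of q] by (auto simp: Q_def)
      qed
    qed auto
    also have "\<dots> = (\<Prod>q\<in>Pm - Q. if q = 2 then 2 else 1) * (\<Prod>q\<in>Pm - Q. q ^ (multiplicity q m div 2)) ^ 3 *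
        (\<Prod>q\<in>Pm - Q. if q mod 4 = 3 \<and> \<not> q\<^sup>2 dvd m then q else 1)"
      by (simp only: prod.distrib prod_power_distrib)
    also have "(\<Prod>q\<in>Pm - Q. if q mod 4 = 3 \<and> \<not> q\<^sup>2 dvd m then q else 1) = \<Prod>B"
      unfolding B_def using fin by (intro prod.inter_filter[symmetric]) auto
    also have "(\<Prod>q\<in>Pm - Q. if q = 2 then 2 else 1) * (\<Prod>q\<in>Pm - Q. q ^ (multiplicity q m div 2)) ^ 3 * \<Prod>B
        \<le> 2 * d ^ 3 * \<Prod>B"
    proof (intro mult_right_mono mult_mono power_mono)
      show "(\<Prod>q\<in>Pm - Q. if q = 2 then 2 else 1) \<le> (2::nat)"
        using fin by (subst prod.delta) auto
      show "(\<Prod>q\<in>Pm - Q. q ^ (multiplicity q m div 2)) \<le> d"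
        unfolding d_def
      proof (rule dvd_imp_le)
        show "(\<Prod>q\<in>Pm - Q. q ^ (multiplicity q m div 2)) dvd (\<Prod>q\<in>Pm. q ^ (multiplicity q m div 2))"
          using fin by (intro prod_dvd_prod_subset) auto
        show "0 < (\<Prod>q\<in>Pm. q ^ (multiplicity q m div 2))" using Pm by (intro prod_pos) (auto simp: prime_gt_0_nat)
      qed
    qed auto
    finally show ?thesis .
  qed
  define P0 where "P0 = (\<Prod>q\<in>{q \<in> primes3 0 p - {p}. q dvd m}. real q)"
  have P0: "0 \<le> P0" "P0 \<le> real p powr (24 / 25)"
  proof -
    have pos: "real q > 0" if "q \<in> {q \<in> primes3 0 p - {p}. q dvd m}" for q
      using that by (auto simp: primes3_def)
    show "0 \<le> P0" unfolding P0_def by (intro prod_nonneg) auto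
    have "P0 > 0" unfolding P0_def using pos by (intro prod_pos) auto
    have "ln P0 = (\<Sum>q\<in>{q \<in> primes3 0 p - {p}. q dvd m}. ln q)"
      unfolding P0_def using pos by (intro ln_prod) auto
    also have "\<dots> \<le> ln (real p powr (24 / 25))" using low p by (simp add: ln_powr)
    finally show "P0 \<le> real p powr (24 / 25)"
      using \<open>P0 > 0\<close> p by (subst (asm) ln_le_cancel_iff) auto
  qed
  have By: "real (\<Prod>B) / y \<le> real p powr (- 1 / 25)"
  proof -
    have Bsub: "B - (if odd (card Kge) then {} else {p}) \<subseteq> {q \<in> primes3 0 p - {p}. q dvd m}"
    proof
      fix q assume q: "q \<in> B - (if odd (card Kge) then {} else {p})"
      hence qB: "q \<in> Pm" "q \<notin> Q" "q mod 4 = 3" "\<not> q\<^sup>2 dvd m" by (auto simp: B_def)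
      have "q \<notin> K" using qB by (auto simp: Q_def)
      hence "q < p" using q qB pK by (auto simp: K_def Kge_def split: if_splits)
      thus "q \<in> {q \<in> primes3 0 p - {p}. q dvd m}" using qB Pm[of q] by (auto simp: primes3_def)
    qed
    have finB: "finite B" using fin by (simp add: B_def)
    have "real (\<Prod>(B - (if odd (card Kge) then {} else {p}))) \<le> P0"
      unfolding P0_def of_nat_prod
    proof (rule prod_mono2[OF _ Bsub])
      fix b assume "b \<in> {q \<in> primes3 0 p - {p}. q dvd m} - (B - (if odd (card Kge) then {} else {p}))"
      thus "1 \<le> real b" by (auto simp: primes3_def)
    qed auto
    hence le: "real (\<Prod>(B - (if odd (card Kge) then {} else {p}))) \<le> real p powr (24 / 25)" using P0 by linarith
    have eq: "real p powr (24 / 25) / real p = real p powr (- 1 / 25)"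
      using p powr_diff[of "real p" "24 / 25" 1] by simp
    show ?thesis
    proof (cases "odd (card Kge)")
      case True
      hence "real (\<Prod>B) / y \<le> real p powr (24 / 25) / real p"
        using le p by (simp add: y_def divide_right_mono)
      thus ?thesis using eq by simp
    next
      case False
      have "\<Prod>B \<le> p * \<Prod>(B - {p})"
      proof (cases "p \<in> B")
        case True
        thus ?thesis using finB by (simp add: prod.remove)
      next
        case False
        thus ?thesis using p by simp
      qed
      hence "real (\<Prod>B) \<le> real p * real (\<Prod>(B - {p}))" by (metis of_nat_mono of_nat_mult)
      also have "\<dots> \<le> real p * real p powr (24 / 25)" using le False by (intro mult_left_mono) auto
      finally have "real (\<Prod>B) / (real p)\<^sup>2 \<le> real p * real p powr (24 / 25) / (real p)\<^sup>2"
        by (intro divide_right_mono) auto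
      also have "\<dots> = real p powr (24 / 25) / real p" using p by (simp add: power2_eq_square)
      finally show ?thesis using eq False by (simp add: y_def)
    qed
  qed
  have D0y: "real D0 / y \<le> 2 * real D ^ 3 * real p powr (- 1 / 25)"
  proof -
    have "D0 \<le> 2 * D ^ 3 * \<Prod>B"
      using D0le dD by (meson le_trans mult_le_mono1 mult_le_mono2 power_mono zero_le)
    hence "real D0 \<le> real (2 * D ^ 3 * \<Prod>B)" by (rule of_nat_mono)
    hence "real D0 / y \<le> 2 * real D ^ 3 * real (\<Prod>B) / y" using y0 by (intro divide_right_mono) auto
    also have "\<dots> = 2 * real D ^ 3 * (real (\<Prod>B) / y)" by simp
    also have "\<dots> \<le> 2 * real D ^ 3 * real p powr (- 1 / 25)" using By by (intro mult_left_mono) auto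
    finally show ?thesis .
  qed
  have "real (card A) \<le> real D0 * (2 ^ (card {q \<in> Q. q mod 4 = 3})\<^sup>2 * sqrt (real (\<Prod>Q) / y))"
    unfolding KQ
    using card_square_difference_free_le[of m D0 Q y A, OF mfac m(1) finQ Qprop, unfolded KQ, OF _ oddK yK y0] A
    unfolding R_def by blast
  also have "\<dots> = 2 ^ (card K)\<^sup>2 * (real D0 * sqrt (real (\<Prod>Q) / y))" by (simp add: KQ)
  also have "real D0 * sqrt (real (\<Prod>Q) / y) = sqrt m * sqrt (real D0 / y)"
  proof -
    have "real m = real D0 * real (\<Prod>Q)" using mfac by (metis of_nat_mult)
    hence "real m * (real D0 / y) = (real D0)\<^sup>2 * (real (\<Prod>Q) / y)" by (simp add: power2_eq_square)
    thus ?thesis by (metis real_sqrt_mult real_sqrt_abs abs_of_nat)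
  qed
  also have "2 ^ (card K)\<^sup>2 * (sqrt m * sqrt (real D0 / y)) \<le>
      2 ^ k\<^sup>2 * (sqrt m * sqrt (2 * real D ^ 3 * real p powr (- 1 / 25)))"
    using KD D0y y0 by (intro mult_mono power_increasing power_mono real_sqrt_le_mono) auto
  finally show ?thesis by (simp add: mult.assoc)
qed

section \<open>The density statement\<close>

lemma lower_density_eq_1I:
  assumes "\<And>\<delta> :: real. \<delta> > 0 \<Longrightarrow> eventually (\<lambda>N. real (card ({1..N} - M)) \<le> \<delta> * real N) sequentially"
  shows "lower_density M = 1"
proof -
  have "(\<lambda>N. real (card (M \<inter> {1..N})) / real N) \<longlonglongrightarrow> 1"
  proof (rule LIMSEQ_I)
    fix r :: real assume r: "r > 0"
    obtain N0 where N0: "\<And>N. N \<ge> N0 \<Longrightarrow> real (card ({1..N} - M)) \<le> r / 2 * N"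
      using assms[of "r / 2"] r by (auto simp: eventually_sequentially)
    show "\<exists>no. \<forall>N\<ge>no. norm (real (card (M \<inter> {1..N})) / real N - 1) < r"
    proof (intro exI[of _ "max N0 1"] allI impI)
      fix N assume N: "N \<ge> max N0 1"
      have "card {1..N} = card ({1..N} - M) + card (M \<inter> {1..N})"
      proof -
        have "card {1..N} = card (({1..N} - M) \<union> (M \<inter> {1..N}))" by (rule arg_cong[of _ _ card]) auto
        also have "\<dots> = card ({1..N} - M) + card (M \<inter> {1..N})" by (rule card_Un_disjoint) auto
        finally show ?thesis .
      qed
      hence "real N = real (card ({1..N} - M)) + real (card (M \<inter> {1..N}))" by simp
      moreover have "real (card ({1..N} - M)) \<le> r / 2 * N" using N0 N by simp
      ultimately have "real (card (M \<inter> {1..N})) / real N - 1 = - (real (card ({1..N} - M)) / real N)"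
        "real (card ({1..N} - M)) / real N \<le> r / 2"
        using N by (auto simp: field_simps)
      moreover have "0 \<le> real (card ({1..N} - M)) / real N" by simp
      ultimately show "norm (real (card (M \<inter> {1..N})) / real N - 1) < r"
        using r unfolding real_norm_def by linarith
    qed
  qed
  hence "(\<lambda>N. ereal (real (card (M \<inter> {1..N})) / real N)) \<longlonglongrightarrow> ereal 1" by simp
  thus ?thesis unfolding lower_density_def by (simp add: lim_imp_Liminf one_ereal_def)
qed

lemma eventually_le_powr:
  fixes a c :: real
  assumes "a > 0"
  shows "eventually (\<lambda>N. c \<le> real N powr a) sequentially"
  using eventually_ge_at_top[of "nat \<lceil>max c 1 powr (1 / a)\<rceil>"]
proof eventually_elim
  case (elim N)
  hence "max c 1 powr (1 / a) \<le> real N" by linarith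
  hence "(max c 1 powr (1 / a)) powr a \<le> real N powr a" using assms by (intro powr_mono2) auto
  moreover have "(max c 1 powr (1 / a)) powr a = max c 1" using assms by (simp add: powr_powr)
  ultimately show ?case by linarith
qed

theorem corollary1p3:
  fixes \<epsilon> :: "nat \<Rightarrow> real"
  assumes "\<And>m. m \<ge> 1 \<Longrightarrow> \<epsilon> m > 0"
    and "\<epsilon> \<longlonglongrightarrow> 0"
  shows "almost_all (\<lambda>m. \<forall>A \<subseteq> carrier (residue_ring (int m)).
           difference_set (residue_ring (int m)) A \<inter> square_set (residue_ring (int m))
             = {\<zero>\<^bsub>residue_ring (int m)\<^esub>}
           \<longrightarrow> real (card A) \<le> real m powr (1 / 2 - \<epsilon> m))"
proof -
  define P where "P = (\<lambda>m. \<forall>A \<subseteq> carrier (residue_ring (int m)).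
           difference_set (residue_ring (int m)) A \<inter> square_set (residue_ring (int m))
             = {\<zero>\<^bsub>residue_ring (int m)\<^esub>}
           \<longrightarrow> real (card A) \<le> real m powr (1 / 2 - \<epsilon> m))"
  have "lower_density {m. m \<ge> 1 \<and> P m} = 1"
  proof (rule lower_density_eq_1I)
    fix \<delta> :: real assume \<delta>: "\<delta> > 0"
    \<comment> \<open>\<open>\<eta>\<close> depends only on the tolerated proportion
      \<open>\<delta>\<close>, so outside the exceptional set a fixed power of \<open>m\<close> is
      saved; any \<open>\<epsilon>\<close> tending to 0 is eventually below
      \<open>\<eta> / 100\<close>, however slowly it decays. Three quarters of
      \<open>\<delta>\<close> are spent: on small \<open>m\<close>, on \<open>m\<close> without a
      large lacunary prime, and on \<open>m\<close> with a large square divisor.\<close>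
    obtain \<eta> N1 where \<eta>: "\<eta> > 0" and N1: "\<And>N. N \<ge> N1 \<Longrightarrow>
        real (card {m \<in> {1..N}. \<forall>p. real N powr \<eta> < real p \<longrightarrow> \<not> lacunary_at m p}) \<le> \<delta> / 4 * N"
      using lacunary_prime_exists_almost_all[of "\<delta> / 4"] \<delta> by auto
    define D where "D = nat \<lceil>4 / \<delta>\<rceil> + 1"
    define k where "k = nat \<lceil>1 / \<eta>\<rceil>"
    have D: "D \<ge> 1" "4 / \<delta> \<le> real D" unfolding D_def by linarith+
    have k: "1 \<le> \<eta> * real k"
    proof -
      have "1 / \<eta> \<le> real k" unfolding k_def by linarith
      thus ?thesis using \<eta> by (simp add: divide_le_eq mult.commute)
    qed
    obtain m0 where m0: "\<And>m. m \<ge> m0 \<Longrightarrow> \<epsilon> m \<le> \<eta> / 100"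
    proof -
      have "eventually (\<lambda>m. \<epsilon> m < \<eta> / 100) sequentially"
        using assms(2) \<eta> by (intro order_tendstoD) auto
      then obtain m0 where m0: "\<And>m. m \<ge> m0 \<Longrightarrow> \<epsilon> m < \<eta> / 100"
        unfolding eventually_sequentially by blast
      show ?thesis by (rule that[of m0], rule less_imp_le, rule m0)
    qed
    \<comment> \<open>The part of the bound independent of \<open>m\<close> and \<open>p\<close>.
      \<open>N powr (\<eta> / 100)\<close> absorbs it, while \<open>p powr (- 1 / 50)\<close> saves
      \<open>N powr (- \<eta> / 50)\<close>; half of that saving survives.\<close>
    define c where "c = 2 ^ k\<^sup>2 * sqrt (2 * real D ^ 3)"
    have "eventually (\<lambda>N. c \<le> real N powr (\<eta> / 100)) sequentially"
      using \<eta> by (intro eventually_le_powr) simp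
    moreover have "eventually (\<lambda>N. real D \<le> real N powr \<eta>) sequentially"
      using \<eta> by (rule eventually_le_powr)
    moreover have "eventually (\<lambda>N. real (m0 + 2) \<le> \<delta> / 4 * real N) sequentially"
      using eventually_ge_at_top[of "nat \<lceil>real (m0 + 2) / (\<delta> / 4)\<rceil>"]
    proof eventually_elim
      case (elim N)
      hence "real (m0 + 2) / (\<delta> / 4) \<le> real N" by linarith
      thus ?case using \<delta> by (simp add: pos_divide_le_eq mult.commute)
    qed
    ultimately show "eventually (\<lambda>N. real (card ({1..N} - {m. m \<ge> 1 \<and> P m})) \<le> \<delta> * real N) sequentially"
      using eventually_ge_at_top[of N1]
    proof eventually_elim
      case (elim N)
      let ?B1 = "{m \<in> {1..N}. \<forall>p. real N powr \<eta> < real p \<longrightarrow> \<not> lacunary_at m p}"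
      let ?B2 = "{m \<in> {1..N}. \<exists>d>D. d\<^sup>2 dvd m}"
      have good: "P m" if m: "m \<in> {1..N}" "m \<ge> m0 + 2" "m \<notin> ?B1" "m \<notin> ?B2" for m
        unfolding P_def
      proof (intro allI impI)
        fix A assume A: "A \<subseteq> carrier (residue_ring (int m))"
          "difference_set (residue_ring (int m)) A \<inter> square_set (residue_ring (int m)) = {\<zero>\<^bsub>residue_ring (int m)\<^esub>}"
        have "\<not> (\<forall>p. real N powr \<eta> < real p \<longrightarrow> \<not> lacunary_at m p)" using m(1,3) by simp
        then obtain p where p: "real N powr \<eta> < real p" "lacunary_at m p" by blast
        have N: "N \<ge> 1" "m \<le> N" using m by auto
        have "m < p ^ k"
        proof -
          have "real m \<le> real N powr 1" using N by simp
          also have "\<dots> \<le> real N powr (\<eta> * real k)" using k N by (intro powr_mono) auto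
          also have "\<dots> = (real N powr \<eta>) powr real k" by (rule powr_powr[symmetric])
          also have "\<dots> = (real N powr \<eta>) ^ k" using N by (intro powr_realpow) simp
          also have "\<dots> < real p ^ k"
          proof (rule power_strict_mono)
            show "k > 0" using k by (cases k) auto
          qed (use p in auto)
          finally have "real m < real (p ^ k)" by simp
          thus ?thesis by (simp only: of_nat_less_iff)
        qed
        have Dp: "D < p" using elim(2) p(1) by linarith
        have "\<not> (\<exists>d>D. d\<^sup>2 dvd m)" using m(1,4) by simp
        hence sq: "d \<le> D" if "d\<^sup>2 dvd m" for d using that not_le by blast
        have "m > 1" using m(2) by simp
        have "real (card A) \<le> 2 ^ k\<^sup>2 * sqrt m * sqrt (2 * real D ^ 3 * real p powr (- 1 / 25))"
          by (rule card_le_of_lacunary[OF \<open>m > 1\<close> \<open>m < p ^ k\<close> p(2) sq Dp A])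
        also have "\<dots> = sqrt m * (c * real p powr (- 1 / 50))"
        proof -
          have "sqrt (real p powr (- 1 / 25)) = (real p powr (- 1 / 25)) powr (1 / 2)"
            by (rule powr_half_sqrt[symmetric]) simp
          also have "\<dots> = real p powr (- 1 / 50)" unfolding powr_powr by simp
          finally show ?thesis by (simp add: c_def real_sqrt_mult)
        qed
        also have "\<dots> \<le> sqrt m * (real N powr (\<eta> / 100) * real N powr (- \<eta> / 50))"
        proof (intro mult_left_mono mult_mono elim)
          have "real p powr (- 1 / 50) \<le> (real N powr \<eta>) powr (- 1 / 50)"
            using p(1) N by (intro powr_mono2') auto
          thus "real p powr (- 1 / 50) \<le> real N powr (- \<eta> / 50)" by (simp add: powr_powr)
        qed auto
        also have "\<dots> = sqrt m * real N powr (- (\<eta> / 100))" unfolding powr_add[symmetric] by simp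
        also have "\<dots> \<le> sqrt m * real m powr (- \<epsilon> m)"
        proof (rule mult_left_mono)
          have "real N powr (- (\<eta> / 100)) \<le> real m powr (- (\<eta> / 100))"
            using m \<eta> by (intro powr_mono2') auto
          also have "\<dots> \<le> real m powr (- \<epsilon> m)" using m m0[of m] by (intro powr_mono) auto
          finally show "real N powr (- (\<eta> / 100)) \<le> real m powr (- \<epsilon> m)" .
        qed auto
        also have "\<dots> = real m powr (1 / 2 - \<epsilon> m)"
        proof -
          have "sqrt m = real m powr (1 / 2)" by (rule powr_half_sqrt[symmetric]) simp
          thus ?thesis using powr_add[of "real m" "1 / 2" "- \<epsilon> m"] by (simp only: diff_conv_add_uminus)
        qed
        finally show "real (card A) \<le> real m powr (1 / 2 - \<epsilon> m)" .
      qed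
      have "{1..N} - {m. m \<ge> 1 \<and> P m} \<subseteq> {..<m0 + 2} \<union> (?B1 \<union> ?B2)"
      proof
        fix m assume "m \<in> {1..N} - {m. m \<ge> 1 \<and> P m}"
        hence "m \<in> {1..N}" "\<not> P m" by auto
        thus "m \<in> {..<m0 + 2} \<union> (?B1 \<union> ?B2)" using good[of m] by (meson UnCI lessThan_iff not_le)
      qed
      hence "card ({1..N} - {m. m \<ge> 1 \<and> P m}) \<le> card ({..<m0 + 2} \<union> (?B1 \<union> ?B2))"
        by (rule card_mono[rotated]) simp
      also have "\<dots> \<le> (m0 + 2) + (card ?B1 + card ?B2)"
        using card_Un_le[of "{..<m0 + 2}" "?B1 \<union> ?B2"] card_Un_le[of ?B1 ?B2] by simp
      finally have "real (card ({1..N} - {m. m \<ge> 1 \<and> P m})) \<le> real ((m0 + 2) + (card ?B1 + card ?B2))"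
        by (rule of_nat_mono)
      also have "\<dots> = real (m0 + 2) + (real (card ?B1) + real (card ?B2))" by simp
      also have "\<dots> \<le> \<delta> / 4 * real N + (\<delta> / 4 * real N + \<delta> / 4 * real N)"
      proof (intro add_mono N1 elim)
        have "real (card ?B2) \<le> real N / real D" by (rule large_square_divisor_count[OF D(1)])
        also have "\<dots> \<le> real N * (\<delta> / 4)"
        proof -
          have "4 \<le> \<delta> * real D" using D(2) \<delta> by (simp add: divide_le_eq mult.commute)
          hence "1 / real D \<le> \<delta> / 4" using D(1) by (simp add: divide_le_eq)
          hence "real N * (1 / real D) \<le> real N * (\<delta> / 4)" by (rule mult_left_mono) simp
          thus ?thesis by simp
        qed
        finally show "real (card ?B2) \<le> \<delta> / 4 * real N" by (simp add: mult.commute)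
      qed
      also have "\<dots> \<le> \<delta> * real N" using \<delta> by simp
      finally show ?case .
    qed
  qed
  moreover have "{m. m \<ge> 1 \<and> P m} \<subseteq> {1..}" by auto
  ultimately show ?thesis unfolding almost_all_def P_def by (intro exI[of _ "{m. m \<ge> 1 \<and> P m}"]) (auto simp: P_def)
qed

end
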